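(* Let $S$ be an inverse semigroup with zero. (1) The universal groupoid $\mathsf{G}_{u}(S)$ is homeomorphic to the weak booleanization of the groupoid $\mathsf{G}_{P}(\mathsf{D}(S))$. In particular, the weakly boolean inverse semigroup $\mathsf{B}(S)=\mathsf{KB}(\mathsf{G}_u(S))$ of compact-open bisections of $\mathsf{G}_u(S)$ has the property that the universal groupoid $\mathsf{G}_{u}(S)$ is homeomorphic to the groupoid $\mathsf{G}_{P}(\mathsf{B}(S))$. (2) If $S$ also satisfies the weak meet condition then this weak booleanization is in fact a booleanization.
   Context: Inverse semigroups carry their natural partial order; $a^{\downarrow}=\{y:y\le a\}$, $A^{\downarrow}=\bigcup_{a\in A}a^{\downarrow}$. Order ideals (downward closed subsets) contain the zero. Elements $s,t$ are compatible if $s^{-1}t$ and $st^{-1}$ are idempotents. A distributive inverse semigroup is an inverse semigroup in which finite compatible subsets have joins and multiplication distributes over them. It is weakly boolean if its semilattice of idempotents is a boolean algebra (not necessarily with top element). An inverse $\wedge$-semigroup is an inverse semigroup with all binary meets. $S$ satisfies the weak meet condition if every intersection $a^{\downarrow}\cap b^{\downarrow}$ equals $F^{\downarrow}$ for some finite set $F$. A filter is a non-empty, upward closed subset $F$ such that for $a,b\in F$ there is $c\in F$ with $c\le a,b$; all filters are proper ($0\notin F$). A filter in a distributive inverse semigroup is prime if $a\vee b\in F$ implies $a\in F$ or $b\in F$. Filters are composed as follows: $\mathbf{d}(A)=(A^{-1}A)^{\uparrow}$, $\mathbf{r}(A)=(AA^{-1})^{\uparrow}$ (upward closures), and $A\cdot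 B=(AB)^{\uparrow}$ is defined iff $\mathbf{d}(A)=\mathbf{r}(B)$; this makes the set of all filters on $S$, and the set of prime filters on a distributive inverse semigroup, into groupoids. The universal groupoid $\mathsf{G}_u(S)$ is the groupoid of all filters on $S$ with the patch topology, whose basis consists of the sets $U_{x;x_1,\dots,x_n}=U_x\cap U_{x_1}^c\cap\dots\cap U_{x_n}^c$ with $x_1,\dots,x_n\le x$, where $U_x$ is the set of all filters containing $x$ and $^c$ denotes complement. For a distributive inverse semigroup $D$, $\mathsf{G}_P(D)$ is the groupoid of prime filters on $D$ with its usual topology, with basis the sets $Y_s$ ($s\in D$) of all prime filters containing $s$. The patch topology on $\mathsf{G}_P(D)$ has as basis the sets $Y_s\cap Y_t^c$ with $t\le s$. $\mathsf{G}_P(D)$ equipped with the patch topology is called the weak booleanization of $\mathsf{G}_P(D)$ with its usual topology; when $D$ is a distributive inverse $\wedge$-semigroup it is called the booleanization. $\mathsf{D}(S)$ is the distributive inverse semigroup of all finitely generated compatible order ideals $\{a_1,\dots,a_m\}^{\downarrow}$ of $S$ under subset multiplication (the finite elements of the pseudogroup of all compatible order ideals of $S$). For an étale groupoid $G$ with set of identities $G_o$, a bisection is a subset $A$ with $A^{-1}A,AA^{-1}\subseteq G_o$, and $\mathsf{KB}(G)$ is the set of compact-open bisections under subset multiplication. "Homeomorphic" means isomorphic as topological groupoids. *)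

theory Defs
  imports
    "HOL-Analysis.Product_Topology"
    "HOL-Algebra.Lattice"
begin

section \<open>Inverse semigroups\<close>

text \<open>Semigroups carry an explicit carrier set, because the semigroups of order ideals and of
  bisections below are proper subsets of their ambient powerset types.\<close>

record 'a sgrp = "'a partial_object" +
  mult :: "'a \<Rightarrow> 'a \<Rightarrow> 'a" (infixl \<open>\<otimes>\<index>\<close> 70)

definition is_inverse :: "('a, 'm) sgrp_scheme \<Rightarrow> 'a \<Rightarrow> 'a \<Rightarrow> bool" where
  "is_inverse S a b \<longleftrightarrow> b \<in> carrier S \<and> a \<otimes>\<^bsub>S\<^esub> b \<otimes>\<^bsub>S\<^esub> a = a \<and> b \<otimes>\<^bsub>S\<^esub> a \<otimes>\<^bsub>S\<^esub> b = b"

definition is_zero :: "('a, 'm) sgrp_scheme \<Rightarrow> 'a \<Rightarrow> bool" where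
  "is_zero S z \<longleftrightarrow> z \<in> carrier S \<and> (\<forall>a\<in>carrier S. z \<otimes>\<^bsub>S\<^esub> a = z \<and> a \<otimes>\<^bsub>S\<^esub> z = z)"

locale inverse_semigroup =
  fixes S :: "('a, 'm) sgrp_scheme" (structure)
  assumes m_closed: "\<lbrakk>a \<in> carrier S; b \<in> carrier S\<rbrakk> \<Longrightarrow> a \<otimes> b \<in> carrier S"
    and m_assoc: "\<lbrakk>a \<in> carrier S; b \<in> carrier S; c \<in> carrier S\<rbrakk> \<Longrightarrow> (a \<otimes> b) \<otimes> c = a \<otimes> (b \<otimes> c)"
    and unique_inverse: "a \<in> carrier S \<Longrightarrow> \<exists>!b. is_inverse S a b"

locale inverse_semigroup_with_zero = inverse_semigroup +
  assumes zero_exists: "\<exists>z. is_zero S z"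

definition sinv :: "('a, 'm) sgrp_scheme \<Rightarrow> 'a \<Rightarrow> 'a" where
  "sinv S a = (THE b. is_inverse S a b)"

definition szero :: "('a, 'm) sgrp_scheme \<Rightarrow> 'a" where
  "szero S = (THE z. is_zero S z)"

definition idempotents :: "('a, 'm) sgrp_scheme \<Rightarrow> 'a set" where
  "idempotents S = {e \<in> carrier S. e \<otimes>\<^bsub>S\<^esub> e = e}"

definition sle :: "('a, 'm) sgrp_scheme \<Rightarrow> 'a \<Rightarrow> 'a \<Rightarrow> bool" where
  "sle S a b \<longleftrightarrow> (\<exists>e\<in>idempotents S. a = b \<otimes>\<^bsub>S\<^esub> e)"

definition natural_order :: "('a, 'm) sgrp_scheme \<Rightarrow> 'a gorder" where
  "natural_order S = \<lparr>carrier = carrier S, eq = (=), le = sle S\<rparr>"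

definition idempotent_order :: "('a, 'm) sgrp_scheme \<Rightarrow> 'a gorder" where
  "idempotent_order S = \<lparr>carrier = idempotents S, eq = (=), le = sle S\<rparr>"

definition is_join :: "('a, 'm) sgrp_scheme \<Rightarrow> 'a set \<Rightarrow> 'a \<Rightarrow> bool" where
  "is_join S A x \<longleftrightarrow> least (natural_order S) x (Upper (natural_order S) A)"

definition downset :: "('a, 'm) sgrp_scheme \<Rightarrow> 'a set \<Rightarrow> 'a set" where
  "downset S A = {y \<in> carrier S. \<exists>a\<in>A. sle S y a}"

definition upset :: "('a, 'm) sgrp_scheme \<Rightarrow> 'a set \<Rightarrow> 'a set" where
  "upset S A = {y \<in> carrier S. \<exists>a\<in>A. sle S a y}"

definition setprod :: "('a, 'm) sgrp_scheme \<Rightarrow> 'a set \<Rightarrow> 'a set \<Rightarrow> 'a set" where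
  "setprod S A B = {a \<otimes>\<^bsub>S\<^esub> b | a b. a \<in> A \<and> b \<in> B}"

definition compatible :: "('a, 'm) sgrp_scheme \<Rightarrow> 'a \<Rightarrow> 'a \<Rightarrow> bool" where
  "compatible S s t \<longleftrightarrow> sinv S s \<otimes>\<^bsub>S\<^esub> t \<in> idempotents S \<and> s \<otimes>\<^bsub>S\<^esub> sinv S t \<in> idempotents S"

definition compatible_set :: "('a, 'm) sgrp_scheme \<Rightarrow> 'a set \<Rightarrow> bool" where
  "compatible_set S A \<longleftrightarrow> A \<subseteq> carrier S \<and> (\<forall>s\<in>A. \<forall>t\<in>A. compatible S s t)"

locale distributive_inverse_semigroup = inverse_semigroup_with_zero +
  assumes join_exists: "\<lbrakk>finite A; compatible_set S A\<rbrakk> \<Longrightarrow> \<exists>x. is_join S A x"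
    and distrib_left: "\<lbrakk>finite A; compatible_set S A; is_join S A x; c \<in> carrier S\<rbrakk>
        \<Longrightarrow> is_join S ((\<lambda>a. c \<otimes> a) ` A) (c \<otimes> x)"
    and distrib_right: "\<lbrakk>finite A; compatible_set S A; is_join S A x; c \<in> carrier S\<rbrakk>
        \<Longrightarrow> is_join S ((\<lambda>a. a \<otimes> c) ` A) (x \<otimes> c)"

definition inverse_meet_semigroup :: "('a, 'm) sgrp_scheme \<Rightarrow> bool" where
  "inverse_meet_semigroup S \<longleftrightarrow> inverse_semigroup S \<and> lower_semilattice (natural_order S)"

text \<open>Boolean algebras not required to have a top: complements are relative to intervals
  below a given element.\<close>

locale generalized_boolean_algebra = lattice L + weak_partial_order_bottom L for L (structure) +
  assumes distributive: "\<lbrakk>x \<in> carrier L; y \<in> carrier L; z \<in> carrier L\<rbrakk>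
        \<Longrightarrow> x \<sqinter> (y \<squnion> z) = (x \<sqinter> y) \<squnion> (x \<sqinter> z)"
    and relative_complement: "\<lbrakk>x \<in> carrier L; y \<in> carrier L; x \<sqsubseteq> y\<rbrakk>
        \<Longrightarrow> \<exists>z\<in>carrier L. x \<sqinter> z = \<bottom> \<and> x \<squnion> z = y"

definition weakly_boolean_inverse_semigroup :: "('a, 'm) sgrp_scheme \<Rightarrow> bool" where
  "weakly_boolean_inverse_semigroup S \<longleftrightarrow>
     distributive_inverse_semigroup S \<and> generalized_boolean_algebra (idempotent_order S)"

definition weak_meet_condition :: "('a, 'm) sgrp_scheme \<Rightarrow> bool" where
  "weak_meet_condition S \<longleftrightarrow> (\<forall>a\<in>carrier S. \<forall>b\<in>carrier S.
     \<exists>F. finite F \<and> F \<subseteq> carrier S \<and> downset S {a} \<inter> downset S {b} = downset S F)"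

definition order_ideal :: "('a, 'm) sgrp_scheme \<Rightarrow> 'a set \<Rightarrow> bool" where
  "order_ideal S I \<longleftrightarrow> I \<subseteq> carrier S \<and> szero S \<in> I \<and> downset S I \<subseteq> I"

definition fg_compatible_ideals :: "('a, 'm) sgrp_scheme \<Rightarrow> 'a set sgrp" (\<open>\<D>\<close>) where
  "\<D> S = \<lparr>carrier = {I. order_ideal S I \<and> compatible_set S I \<and>
                     (\<exists>A. finite A \<and> A \<subseteq> carrier S \<and> I = downset S A)},
          mult = setprod S\<rparr>"

section \<open>Topological groupoids\<close>

text \<open>A groupoid is given by its set of arrows, with objects identified with identity arrows;
  the product \<open>x y\<close> is meaningful only if \<open>d x = r y\<close>, and then \<open>d (x y) = d y\<close>.\<close>

record 'g tgroupoid = "'g partial_object" +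
  gdom :: "'g \<Rightarrow> 'g"
  gran :: "'g \<Rightarrow> 'g"
  gcomp :: "'g \<Rightarrow> 'g \<Rightarrow> 'g"
  gtop :: "'g topology"

definition is_ginverse :: "('g, 'm) tgroupoid_scheme \<Rightarrow> 'g \<Rightarrow> 'g \<Rightarrow> bool" where
  "is_ginverse G x y \<longleftrightarrow> y \<in> carrier G \<and> gdom G y = gran G x \<and> gran G y = gdom G x \<and>
     gcomp G y x = gdom G x \<and> gcomp G x y = gran G x"

definition ginv :: "('g, 'm) tgroupoid_scheme \<Rightarrow> 'g \<Rightarrow> 'g" where
  "ginv G x = (THE y. is_ginverse G x y)"

definition composable_pairs :: "('g, 'm) tgroupoid_scheme \<Rightarrow> ('g \<times> 'g) set" where
  "composable_pairs G = {(x, y). x \<in> carrier G \<and> y \<in> carrier G \<and> gdom G x = gran G y}"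

definition identities :: "('g, 'm) tgroupoid_scheme \<Rightarrow> 'g set" where
  "identities G = {x \<in> carrier G. gdom G x = x}"

locale groupoid =
  fixes G :: "('g, 'm) tgroupoid_scheme"
  assumes gdom_closed: "x \<in> carrier G \<Longrightarrow> gdom G x \<in> carrier G"
    and gran_closed: "x \<in> carrier G \<Longrightarrow> gran G x \<in> carrier G"
    and gdom_gdom: "x \<in> carrier G \<Longrightarrow> gdom G (gdom G x) = gdom G x"
    and gran_gdom: "x \<in> carrier G \<Longrightarrow> gran G (gdom G x) = gdom G x"
    and gdom_gran: "x \<in> carrier G \<Longrightarrow> gdom G (gran G x) = gran G x"
    and gran_gran: "x \<in> carrier G \<Longrightarrow> gran G (gran G x) = gran G x"
    and gcomp_closed: "(x, y) \<in> composable_pairs G \<Longrightarrow> gcomp G x y \<in> carrier G"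
    and gdom_gcomp: "(x, y) \<in> composable_pairs G \<Longrightarrow> gdom G (gcomp G x y) = gdom G y"
    and gran_gcomp: "(x, y) \<in> composable_pairs G \<Longrightarrow> gran G (gcomp G x y) = gran G x"
    and gcomp_assoc: "\<lbrakk>(x, y) \<in> composable_pairs G; (y, z) \<in> composable_pairs G\<rbrakk>
        \<Longrightarrow> gcomp G (gcomp G x y) z = gcomp G x (gcomp G y z)"
    and gcomp_gdom: "x \<in> carrier G \<Longrightarrow> gcomp G x (gdom G x) = x"
    and gcomp_gran: "x \<in> carrier G \<Longrightarrow> gcomp G (gran G x) x = x"
    and ginverse_exists: "x \<in> carrier G \<Longrightarrow> \<exists>y. is_ginverse G x y"

locale topological_groupoid = groupoid +
  assumes topspace_carrier: "topspace (gtop G) = carrier G"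
    and continuous_gcomp:
      "continuous_map (subtopology (prod_topology (gtop G) (gtop G)) (composable_pairs G)) (gtop G)
         (\<lambda>(x, y). gcomp G x y)"
    and continuous_ginv: "continuous_map (gtop G) (gtop G) (ginv G)"

locale etale_groupoid = topological_groupoid +
  assumes gdom_local_homeomorphism: "x \<in> carrier G \<Longrightarrow>
     \<exists>U. x \<in> U \<and> openin (gtop G) U \<and>
         openin (subtopology (gtop G) (identities G)) (gdom G ` U) \<and>
         homeomorphic_map (subtopology (gtop G) U)
           (subtopology (gtop G) (gdom G ` U)) (gdom G)"

text \<open>A bijection preserving domains and ranges also reflects composability, so the inverse of
  the map below is again a continuous functor.\<close>

definition groupoid_homeomorphic ::
    "('g, 'm) tgroupoid_scheme \<Rightarrow> ('h, 'n) tgroupoid_scheme \<Rightarrow> bool" where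
  "groupoid_homeomorphic G H \<longleftrightarrow> topological_groupoid G \<and> topological_groupoid H \<and>
     (\<exists>f. homeomorphic_map (gtop G) (gtop H) f \<and>
       (\<forall>x\<in>carrier G. f (gdom G x) = gdom H (f x) \<and> f (gran G x) = gran H (f x)) \<and>
       (\<forall>(x, y)\<in>composable_pairs G. f (gcomp G x y) = gcomp H (f x) (f y)))"

definition gsetprod :: "('g, 'm) tgroupoid_scheme \<Rightarrow> 'g set \<Rightarrow> 'g set \<Rightarrow> 'g set" where
  "gsetprod G A B = {gcomp G a b | a b. a \<in> A \<and> b \<in> B \<and> (a, b) \<in> composable_pairs G}"

definition bisection :: "('g, 'm) tgroupoid_scheme \<Rightarrow> 'g set \<Rightarrow> bool" where
  "bisection G A \<longleftrightarrow> A \<subseteq> carrier G \<and>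
     gsetprod G (ginv G ` A) A \<subseteq> identities G \<and> gsetprod G A (ginv G ` A) \<subseteq> identities G"

definition compact_open_bisections :: "('g, 'm) tgroupoid_scheme \<Rightarrow> 'g set sgrp" (\<open>KB\<close>) where
  "KB G = \<lparr>carrier = {A. openin (gtop G) A \<and> compactin (gtop G) A \<and> bisection G A},
           mult = gsetprod G\<rparr>"

section \<open>Groupoids of filters\<close>

definition is_filter :: "('a, 'm) sgrp_scheme \<Rightarrow> 'a set \<Rightarrow> bool" where
  "is_filter S F \<longleftrightarrow> F \<subseteq> carrier S \<and> F \<noteq> {} \<and> szero S \<notin> F \<and> upset S F \<subseteq> F \<and>
     (\<forall>a\<in>F. \<forall>b\<in>F. \<exists>c\<in>F. sle S c a \<and> sle S c b)"

definition is_prime_filter :: "('a, 'm) sgrp_scheme \<Rightarrow> 'a set \<Rightarrow> bool" where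
  "is_prime_filter D F \<longleftrightarrow> is_filter D F \<and>
     (\<forall>a\<in>carrier D. \<forall>b\<in>carrier D. \<forall>x\<in>F. is_join D {a, b} x \<longrightarrow> a \<in> F \<or> b \<in> F)"

definition filter_groupoid ::
    "('a, 'm) sgrp_scheme \<Rightarrow> 'a set set \<Rightarrow> 'a set topology \<Rightarrow> 'a set tgroupoid" where
  "filter_groupoid S \<F> T =
     \<lparr>carrier = \<F>,
      gdom = (\<lambda>A. upset S (setprod S (sinv S ` A) A)),
      gran = (\<lambda>A. upset S (setprod S A (sinv S ` A))),
      gcomp = (\<lambda>A B. upset S (setprod S A B)),
      gtop = T\<rparr>"

definition U_set :: "('a, 'm) sgrp_scheme \<Rightarrow> 'a \<Rightarrow> 'a set set" where
  "U_set S x = {F. is_filter S F \<and> x \<in> F}"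

definition Y_set :: "('a, 'm) sgrp_scheme \<Rightarrow> 'a \<Rightarrow> 'a set set" where
  "Y_set D s = {F. is_prime_filter D F \<and> s \<in> F}"

text \<open>The families below are in fact bases, so the topologies they generate as subbases are
  the intended ones.\<close>

definition universal_groupoid :: "('a, 'm) sgrp_scheme \<Rightarrow> 'a set tgroupoid" (\<open>G\<^sub>u\<close>) where
  "G\<^sub>u S = filter_groupoid S {F. is_filter S F}
     (topology_generated_by {U_set S x - (\<Union>y\<in>X. U_set S y) | x X.
        x \<in> carrier S \<and> finite X \<and> X \<subseteq> downset S {x}})"

definition prime_filter_groupoid :: "('a, 'm) sgrp_scheme \<Rightarrow> 'a set tgroupoid" (\<open>G\<^sub>P\<close>) where
  "G\<^sub>P D = filter_groupoid D {F. is_prime_filter D F}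
     (topology_generated_by {Y_set D s | s. s \<in> carrier D})"

definition weak_booleanization :: "('a, 'm) sgrp_scheme \<Rightarrow> 'a set tgroupoid" where
  "weak_booleanization D = filter_groupoid D {F. is_prime_filter D F}
     (topology_generated_by {Y_set D s - Y_set D t | s t.
        s \<in> carrier D \<and> t \<in> downset D {s}})"

text \<open>The term \<open>booleanization\<close> applies to the same groupoid, but only when the distributive
  inverse semigroup has all binary meets.\<close>

definition is_booleanization :: "('a, 'm) sgrp_scheme \<Rightarrow> 'a set tgroupoid \<Rightarrow> bool" where
  "is_booleanization D H \<longleftrightarrow> distributive_inverse_semigroup D \<and> inverse_meet_semigroup D \<and>
     H = weak_booleanization D"

end

theory Submission
  imports Defs "HOL-Analysis.Abstract_Topological_Spaces"
begin

text \<open>Both homeomorphisms are explicit bijections onto prime filters. A filter \<open>F\<close> of \<open>S\<close> corresponds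
  to the set of finitely generated compatible ideals that meet \<open>F\<close>; since joins of such ideals are
  unions, a prime filter of ideals is determined by the principal ideals in it, and these come from a
  filter of \<open>S\<close>. A point \<open>g\<close> of \<open>G\<^sub>u S\<close> corresponds to the set of compact-open bisections that
  contain \<open>g\<close>, which works for every etale groupoid with Hausdorff unit space and a base of
  compact-open bisections. The sets \<open>U_set S x\<close> are such bisections, compact by Alexander's subbase
  theorem. Groupoid structures are transported along the bijections, so that only \<open>G\<^sub>u S\<close> has to be
  checked to be a topological groupoid.\<close>

section \<open>Inverse semigroups\<close>

text \<open>Two obstacles shape the proof. First, \<open>S\<close> need not have binary meets.
  Elements with a common upper bound are compatible, and for compatible \<open>a\<close>,
  \<open>b\<close> the product \<open>a \<otimes> (\<iota> b \<otimes> b)\<close> is their meet;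
  this is why a basic open set removes only elements below its centre \<open>x\<close>. Such a set
  can be recentred at any smaller member \<open>z\<close> of a filter by replacing each removed
  \<open>u\<close> with its meet with \<open>z\<close>, and most local arguments in the patch
  topology use this move. Second, \<open>G\<^sub>u S\<close> need not be Hausdorff, so two
  compact-open bisections may intersect in a set that is not compact. Questions inside a bisection
  are therefore moved to the Hausdorff unit space along the injective domain map, and complements
  \<open>A - B\<close> of general bisections are formed only for \<open>B \<subseteq> A\<close>. In
  both \<open>\<D> S\<close> and \<open>KB G\<close> the natural order is inclusion, so primeness
  becomes a condition on binary unions. The weak meet condition makes intersections of principal
  ideals finitely generated, which is what closes \<open>\<D> S\<close> under intersection.\<close>

context inverse_semigroup
begin

abbreviation sinv_S :: "'a \<Rightarrow> 'a" (\<open>\<iota>\<close>) where "\<iota> \<equiv> sinv S"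
abbreviation sle_S :: "'a \<Rightarrow> 'a \<Rightarrow> bool" (infix \<open>\<preceq>\<close> 50) where "a \<preceq> b \<equiv> sle S a b"
abbreviation idempotents_S :: "'a set" (\<open>E\<close>) where "E \<equiv> idempotents S"

declare m_closed [simp] m_assoc [simp]

section \<open>Inverses and commuting idempotents\<close>

lemma is_inverse_sinv: "a \<in> carrier S \<Longrightarrow> is_inverse S a (\<iota> a)"
  unfolding sinv_def using unique_inverse by (rule theI')

lemma sinv_closed [simp]: "a \<in> carrier S \<Longrightarrow> \<iota> a \<in> carrier S"
  using is_inverse_sinv by (simp add: is_inverse_def)

lemma mult_sinv_mult [simp]: "a \<in> carrier S \<Longrightarrow> a \<otimes> (\<iota> a \<otimes> a) = a"
  using is_inverse_sinv[of a] by (simp add: is_inverse_def)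

lemma sinv_mult_sinv [simp]: "a \<in> carrier S \<Longrightarrow> \<iota> a \<otimes> (a \<otimes> \<iota> a) = \<iota> a"
  using is_inverse_sinv[of a] by (simp add: is_inverse_def)

lemma mult_sinv_mult_left [simp]:
  "a \<in> carrier S \<Longrightarrow> x \<in> carrier S \<Longrightarrow> a \<otimes> (\<iota> a \<otimes> (a \<otimes> x)) = a \<otimes> x"
  by (metis m_assoc m_closed mult_sinv_mult sinv_closed)

lemma sinv_mult_sinv_left [simp]:
  "a \<in> carrier S \<Longrightarrow> x \<in> carrier S \<Longrightarrow> \<iota> a \<otimes> (a \<otimes> (\<iota> a \<otimes> x)) = \<iota> a \<otimes> x"
  by (metis m_assoc m_closed sinv_mult_sinv sinv_closed)

lemma sinv_eqI:
  assumes "a \<in> carrier S" "b \<in> carrier S" "a \<otimes> (b \<otimes> a) = a" "b \<otimes> (a \<otimes> b) = b"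
  shows "\<iota> a = b"
proof -
  have "is_inverse S a b"
    using assms by (simp add: is_inverse_def)
  then show ?thesis
    using unique_inverse[OF assms(1)] is_inverse_sinv[OF assms(1)] by blast
qed

lemma sinv_sinv [simp]: "a \<in> carrier S \<Longrightarrow> \<iota> (\<iota> a) = a"
  by (rule sinv_eqI) auto

lemma idem_closed [simp]: "e \<in> E \<Longrightarrow> e \<in> carrier S"
  by (simp add: idempotents_def)

lemma idem_mult_idem [simp]: "e \<in> E \<Longrightarrow> e \<otimes> e = e"
  unfolding idempotents_def by blast

lemma idem_mult_left [simp]: "e \<in> E \<Longrightarrow> x \<in> carrier S \<Longrightarrow> e \<otimes> (e \<otimes> x) = e \<otimes> x"
  by (simp flip: m_assoc)

lemma idemI: "e \<in> carrier S \<Longrightarrow> e \<otimes> e = e \<Longrightarrow> e \<in> E"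
  unfolding idempotents_def by blast

lemma sinv_idem [simp]: "e \<in> E \<Longrightarrow> \<iota> e = e"
  by (rule sinv_eqI) auto

text \<open>If \<open>x\<close> is the inverse of \<open>e \<otimes> f\<close>, then so is
  \<open>f \<otimes> (x \<otimes> e)\<close>; uniqueness identifies the two, and the second form is
  visibly idempotent. An idempotent is its own inverse, so \<open>e \<otimes> f\<close> equals
  \<open>x\<close>.\<close>

lemma idem_mult_closed [simp]:
  assumes "e \<in> E" "f \<in> E"
  shows "e \<otimes> f \<in> E"
proof -
  define x where "x = \<iota> (e \<otimes> f)"
  have ef [simp]: "e \<in> carrier S" "f \<in> carrier S" "e \<otimes> f \<in> carrier S" using assms by auto
  have x [simp]: "x \<in> carrier S" by (simp add: x_def del: m_assoc)
  have 1: "(e \<otimes> f) \<otimes> x \<otimes> (e \<otimes> f) = e \<otimes> f" "x \<otimes> (e \<otimes> f) \<otimes> x = x"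
    using is_inverse_sinv[OF ef(3)] by (simp_all add: x_def is_inverse_def del: m_assoc)
  have 2: "x \<otimes> (e \<otimes> (f \<otimes> x)) = x"
    using 1(2) by simp
  have 3: "x \<otimes> (e \<otimes> (f \<otimes> (x \<otimes> e))) = x \<otimes> e"
    using arg_cong[OF 2, of "\<lambda>z. z \<otimes> e"] by simp
  have fxe: "x = f \<otimes> (x \<otimes> e)"
    unfolding x_def
  proof (rule sinv_eqI)
    show "e \<otimes> f \<otimes> (f \<otimes> (\<iota> (e \<otimes> f) \<otimes> e) \<otimes> (e \<otimes> f)) = e \<otimes> f"
      using 1(1) assms unfolding x_def[symmetric] by simp
    show "f \<otimes> (\<iota> (e \<otimes> f) \<otimes> e) \<otimes> (e \<otimes> f \<otimes> (f \<otimes> (\<iota> (e \<otimes> f) \<otimes> e))) = f \<otimes> (\<iota> (e \<otimes> f) \<otimes> e)"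
      using 3 assms unfolding x_def[symmetric] by simp
  qed (use assms x in \<open>auto simp flip: x_def\<close>)
  have "x \<otimes> x = (f \<otimes> (x \<otimes> e)) \<otimes> (f \<otimes> (x \<otimes> e))" using fxe by simp
  also have "\<dots> = f \<otimes> (x \<otimes> e)" using 3 by simp
  finally have "x \<in> E" using fxe by (simp add: idemI)
  then have "\<iota> x = x" by simp
  moreover have "\<iota> x = e \<otimes> f" unfolding x_def by (rule sinv_sinv) simp
  ultimately show ?thesis using \<open>x \<in> E\<close> by simp
qed

text \<open>Since \<open>e \<otimes> f\<close> and \<open>f \<otimes> e\<close> are idempotent, they
  are inverse to each other, while an idempotent is its own inverse.\<close>

lemma idem_comm:
  assumes "e \<in> E" "f \<in> E"
  shows "e \<otimes> f = f \<otimes> e"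
proof -
  have *: "e \<otimes> (f \<otimes> (e \<otimes> f)) = e \<otimes> f" if "e \<in> E" "f \<in> E" for e f
    using idem_mult_idem[OF idem_mult_closed[OF that]] that by (simp del: idem_mult_idem)
  have "\<iota> (e \<otimes> f) = f \<otimes> e"
    by (rule sinv_eqI) (use assms * in auto)
  then show ?thesis using assms by simp
qed

lemma idem_comm_left: "e \<in> E \<Longrightarrow> f \<in> E \<Longrightarrow> x \<in> carrier S \<Longrightarrow> e \<otimes> (f \<otimes> x) = f \<otimes> (e \<otimes> x)"
  by (metis idem_closed idem_comm m_assoc)

lemma sinv_mult_idem [simp]: "a \<in> carrier S \<Longrightarrow> \<iota> a \<otimes> a \<in> E"
  and mult_sinv_idem [simp]: "a \<in> carrier S \<Longrightarrow> a \<otimes> \<iota> a \<in> E"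
  by (auto intro!: idemI)

lemma sinv_mult [simp]:
  assumes "a \<in> carrier S" "b \<in> carrier S"
  shows "\<iota> (a \<otimes> b) = \<iota> b \<otimes> \<iota> a"
proof -
  \<comment> \<open>The idempotents \<open>b \<otimes> \<iota> b\<close> and
    \<open>\<iota> a \<otimes> a\<close> commute; the tail \<open>x\<close> puts this into the
    right-nested form that associativity produces.\<close>
  have 1: "b \<otimes> (\<iota> b \<otimes> (\<iota> a \<otimes> (a \<otimes> x))) = \<iota> a \<otimes> (a \<otimes> (b \<otimes> (\<iota> b \<otimes> x)))" if "x \<in> carrier S" for x
    using idem_comm_left[of "b \<otimes> \<iota> b" "\<iota> a \<otimes> a" x] that assms by simp
  have 2: "\<iota> a \<otimes> (a \<otimes> (b \<otimes> (\<iota> b \<otimes> x))) = b \<otimes> (\<iota> b \<otimes> (\<iota> a \<otimes> (a \<otimes> x)))" if "x \<in> carrier S" for x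
    using 1 that by simp
  show ?thesis
    by (rule sinv_eqI) (use assms 1 2[of "\<iota> a"] in auto)
qed

lemma conj_idem [simp]:
  assumes "a \<in> carrier S" "e \<in> E"
  shows "a \<otimes> (e \<otimes> \<iota> a) \<in> E"
proof (rule idemI)
  have "a \<otimes> (e \<otimes> (\<iota> a \<otimes> (a \<otimes> (e \<otimes> \<iota> a)))) = a \<otimes> (\<iota> a \<otimes> (a \<otimes> (e \<otimes> (e \<otimes> \<iota> a))))"
    using idem_comm_left[of e "\<iota> a \<otimes> a" "e \<otimes> \<iota> a"] assms by simp
  then show "a \<otimes> (e \<otimes> \<iota> a) \<otimes> (a \<otimes> (e \<otimes> \<iota> a)) = a \<otimes> (e \<otimes> \<iota> a)"
    using assms by simp
qed (use assms in simp)

lemma conj_idem' [simp]: "a \<in> carrier S \<Longrightarrow> e \<in> E \<Longrightarrow> \<iota> a \<otimes> (e \<otimes> a) \<in> E"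
  using conj_idem[of "\<iota> a" e] by simp

section \<open>The natural partial order\<close>

lemma sleI_right: "e \<in> E \<Longrightarrow> a = b \<otimes> e \<Longrightarrow> a \<preceq> b"
  by (auto simp: sle_def)

text \<open>The idempotent witnessing the order can always be taken to be the domain idempotent of
  the smaller element, which removes the existential quantifier.\<close>

lemma sle_right_iff:
  assumes "a \<in> carrier S" "b \<in> carrier S"
  shows "a \<preceq> b \<longleftrightarrow> a = b \<otimes> (\<iota> a \<otimes> a)"
proof
  assume "a \<preceq> b"
  then obtain e where e: "e \<in> E" "a = b \<otimes> e" by (auto simp: sle_def)
  then have "b \<otimes> (\<iota> a \<otimes> a) = b \<otimes> (e \<otimes> ((\<iota> b \<otimes> b) \<otimes> e))" using assms by simp
  also have "\<dots> = b \<otimes> ((\<iota> b \<otimes> b) \<otimes> (e \<otimes> e))"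
    using idem_comm_left[of e "\<iota> b \<otimes> b" e] e assms by simp
  also have "\<dots> = a" using e assms by simp
  finally show "a = b \<otimes> (\<iota> a \<otimes> a)" by simp
qed (use assms in \<open>auto intro: sleI_right[of "\<iota> a \<otimes> a"]\<close>)

text \<open>Conjugation by \<open>b\<close> moves an idempotent factor from the left of
  \<open>b\<close> to its right.\<close>

lemma sleI_left:
  assumes "b \<in> carrier S" "f \<in> E" "a = f \<otimes> b"
  shows "a \<preceq> b"
proof (rule sleI_right)
  show "\<iota> b \<otimes> (f \<otimes> b) \<in> E" using assms by simp
  show "a = b \<otimes> (\<iota> b \<otimes> (f \<otimes> b))"
    using idem_comm_left[of f "b \<otimes> \<iota> b" b] assms by simp
qed

lemma sle_left_iff:
  assumes "a \<in> carrier S" "b \<in> carrier S"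
  shows "a \<preceq> b \<longleftrightarrow> a = a \<otimes> (\<iota> a \<otimes> b)"
proof
  assume "a \<preceq> b"
  then obtain e where e: "e \<in> E" "a = b \<otimes> e" by (auto simp: sle_def)
  then have "a \<otimes> (\<iota> a \<otimes> b) = b \<otimes> (e \<otimes> ((\<iota> b \<otimes> b)))" using assms by simp
  also have "\<dots> = b \<otimes> ((\<iota> b \<otimes> b) \<otimes> e)"
    using idem_comm[of e "\<iota> b \<otimes> b"] e assms by simp
  also have "\<dots> = a" using e assms by simp
  finally show "a = a \<otimes> (\<iota> a \<otimes> b)" by simp
next
  assume "a = a \<otimes> (\<iota> a \<otimes> b)"
  then show "a \<preceq> b" using assms by (intro sleI_left[of b "a \<otimes> \<iota> a"]) auto
qed

lemma sle_refl [simp]: "a \<in> carrier S \<Longrightarrow> a \<preceq> a"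
  by (auto simp: sle_right_iff)

lemma sle_trans:
  assumes "a \<preceq> b" "b \<preceq> c" "c \<in> carrier S"
  shows "a \<preceq> c"
proof -
  obtain e f where "e \<in> E" "a = b \<otimes> e" "f \<in> E" "b = c \<otimes> f"
    using assms by (auto simp: sle_def)
  then show ?thesis using assms by (intro sleI_right[of "f \<otimes> e"]) auto
qed

lemma sle_closed: "a \<preceq> b \<Longrightarrow> b \<in> carrier S \<Longrightarrow> a \<in> carrier S"
  by (auto simp: sle_def)

lemma sleE_left:
  assumes "a \<preceq> b" "b \<in> carrier S"
  obtains f where "f \<in> E" "a = f \<otimes> b"
proof
  show "a \<otimes> \<iota> a \<in> E" using assms sle_closed by simp
  show "a = (a \<otimes> \<iota> a) \<otimes> b" using assms sle_closed sle_left_iff[of a b] by auto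
qed

lemma sle_sinv:
  assumes "a \<preceq> b" "b \<in> carrier S"
  shows "\<iota> a \<preceq> \<iota> b"
proof -
  obtain e where "e \<in> E" "a = b \<otimes> e" using assms by (auto simp: sle_def)
  then show ?thesis using assms by (intro sleI_left[of "\<iota> b" e]) auto
qed

lemma sle_sinv_iff: "a \<in> carrier S \<Longrightarrow> b \<in> carrier S \<Longrightarrow> \<iota> a \<preceq> \<iota> b \<longleftrightarrow> a \<preceq> b"
  using sle_sinv[of a b] sle_sinv[of "\<iota> a" "\<iota> b"] by auto

lemma sle_mult:
  assumes "a \<preceq> b" "c \<preceq> d" "b \<in> carrier S" "d \<in> carrier S"
  shows "a \<otimes> c \<preceq> b \<otimes> d"
proof -
  have S: "a \<in> carrier S" "c \<in> carrier S" using assms sle_closed by auto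
  obtain f where "f \<in> E" "a = f \<otimes> b" using sleE_left[OF assms(1,3)] by blast
  then have "a \<otimes> c \<preceq> b \<otimes> c" using assms S by (intro sleI_left[of "b \<otimes> c" f]) auto
  moreover have "b \<otimes> c \<preceq> b \<otimes> d"
    using assms S sle_right_iff[of c d] by (intro sleI_right[of "\<iota> c \<otimes> c"]) auto
  ultimately show ?thesis using sle_trans assms by auto
qed

lemma sle_idem:
  assumes "a \<preceq> e" "e \<in> E"
  shows "a \<in> E"
  using assms by (auto simp: sle_def)

lemma mult_idem_sle [simp]: "a \<in> carrier S \<Longrightarrow> e \<in> E \<Longrightarrow> a \<otimes> e \<preceq> a"
  by (auto intro: sleI_right)

lemma idem_mult_sle [simp]: "a \<in> carrier S \<Longrightarrow> e \<in> E \<Longrightarrow> e \<otimes> a \<preceq> a"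
  by (auto intro: sleI_left)

text \<open>An element below \<open>c\<close> is \<open>c\<close> restricted to that element's
  domain.\<close>

lemma sle_eq_if_dom:
  assumes "a \<preceq> c" "b \<preceq> c" "c \<in> carrier S" "\<iota> a \<otimes> a = \<iota> b \<otimes> b"
  shows "a = b"
  using assms sle_closed sle_right_iff by metis

section \<open>Compatibility and meets of compatible elements\<close>

lemma compatible_sle:
  assumes "compatible S a b" "a' \<preceq> a" "b' \<preceq> b" "a \<in> carrier S" "b \<in> carrier S"
  shows "compatible S a' b'"
  unfolding compatible_def
proof
  show "\<iota> a' \<otimes> b' \<in> E"
    using assms by (intro sle_idem[OF sle_mult[OF sle_sinv[of a' a], of b' b]]) (auto simp: compatible_def)
  show "a' \<otimes> \<iota> b' \<in> E"
    using assms by (intro sle_idem[OF sle_mult[OF _ sle_sinv[of b' b], of a' a]]) (auto simp: compatible_def)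
qed

lemma compatible_refl [simp]: "a \<in> carrier S \<Longrightarrow> compatible S a a"
  by (auto simp: compatible_def)

lemma compatible_bounded:
  "a \<preceq> c \<Longrightarrow> b \<preceq> c \<Longrightarrow> c \<in> carrier S \<Longrightarrow> compatible S a b"
  by (rule compatible_sle[of c c]) auto

lemma compatible_sinv: "compatible S a b \<Longrightarrow> a \<in> carrier S \<Longrightarrow> b \<in> carrier S \<Longrightarrow> compatible S (\<iota> a) (\<iota> b)"
  by (auto simp: compatible_def)

text \<open>The inner factor \<open>\<iota> a \<otimes> b\<close> is idempotent, so the quotient of
  the products lies below the idempotent \<open>\<iota> c \<otimes> d\<close>, and anything below an
  idempotent is idempotent. The other quotient is symmetric.\<close>

lemma compatible_mult:
  assumes "compatible S a b" "compatible S c d"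
    "a \<in> carrier S" "b \<in> carrier S" "c \<in> carrier S" "d \<in> carrier S"
  shows "compatible S (a \<otimes> c) (b \<otimes> d)"
  unfolding compatible_def
proof
  have "\<iota> c \<otimes> ((\<iota> a \<otimes> b) \<otimes> d) \<preceq> \<iota> c \<otimes> d"
    using assms by (intro sle_mult) (auto simp: compatible_def simp del: m_assoc)
  then have "\<iota> c \<otimes> ((\<iota> a \<otimes> b) \<otimes> d) \<in> E"
    using assms by (auto simp: compatible_def intro: sle_idem)
  then show "\<iota> (a \<otimes> c) \<otimes> (b \<otimes> d) \<in> E" using assms by simp
  have "a \<otimes> ((c \<otimes> \<iota> d) \<otimes> \<iota> b) \<preceq> a \<otimes> \<iota> b"
    using assms by (intro sle_mult) (auto simp: compatible_def simp del: m_assoc)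
  then have "a \<otimes> ((c \<otimes> \<iota> d) \<otimes> \<iota> b) \<in> E"
    using assms by (auto simp: compatible_def intro: sle_idem)
  then show "(a \<otimes> c) \<otimes> \<iota> (b \<otimes> d) \<in> E" using assms by simp
qed

text \<open>With the next two lemmas this shows that
  \<open>a \<otimes> (\<iota> b \<otimes> b)\<close> is the meet of compatible elements. It replaces
  general binary meets, which \<open>S\<close> need not have.\<close>

lemma compatible_meet_sle1: "compatible S a b \<Longrightarrow> a \<in> carrier S \<Longrightarrow> b \<in> carrier S \<Longrightarrow> a \<otimes> (\<iota> b \<otimes> b) \<preceq> a"
  by (rule mult_idem_sle) auto

lemma compatible_meet_sle2:
  assumes "compatible S a b" "a \<in> carrier S" "b \<in> carrier S"
  shows "a \<otimes> (\<iota> b \<otimes> b) \<preceq> b"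
  using assms by (intro sleI_left[of b "a \<otimes> \<iota> b"]) (auto simp: compatible_def)

lemma sle_meetI:
  assumes "c \<preceq> a" "c \<preceq> b" "a \<in> carrier S" "b \<in> carrier S"
  shows "c \<preceq> a \<otimes> (\<iota> b \<otimes> b)"
proof -
  have c: "c \<in> carrier S" using assms sle_closed by auto
  have "c \<otimes> (\<iota> c \<otimes> c) \<preceq> a \<otimes> (\<iota> b \<otimes> b)"
    using assms c by (intro sle_mult sle_sinv) auto
  then show ?thesis using c by simp
qed

text \<open>The condition on domains makes \<open>a\<close> equal to the meet
  \<open>a \<otimes> (\<iota> b \<otimes> b)\<close>, which lies below \<open>b\<close>.\<close>

lemma compatible_sle_if_dom:
  assumes "compatible S a b" "a \<in> carrier S" "b \<in> carrier S" "\<iota> a \<otimes> a \<preceq> \<iota> b \<otimes> b"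
  shows "a \<preceq> b"
proof -
  have "\<iota> a \<otimes> a = (\<iota> a \<otimes> a) \<otimes> (\<iota> b \<otimes> b)"
    using sle_left_iff[of "\<iota> a \<otimes> a" "\<iota> b \<otimes> b"] assms by simp
  then have "a \<otimes> (\<iota> a \<otimes> a) = a \<otimes> ((\<iota> a \<otimes> a) \<otimes> (\<iota> b \<otimes> b))"
    by (rule arg_cong)
  then have "a = a \<otimes> (\<iota> b \<otimes> b)"
    using assms by simp
  then show ?thesis using compatible_meet_sle2 assms by metis
qed

lemma compatible_sle_if_ran:
  assumes "compatible S a b" "a \<in> carrier S" "b \<in> carrier S" "a \<otimes> \<iota> a \<preceq> b \<otimes> \<iota> b"
  shows "a \<preceq> b"
  using compatible_sle_if_dom[of "\<iota> a" "\<iota> b"] compatible_sinv assms sle_sinv_iff by simp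

lemma dom_mult_sle:
  assumes "a \<in> carrier S" "b \<in> carrier S"
  shows "\<iota> (a \<otimes> b) \<otimes> (a \<otimes> b) \<preceq> \<iota> b \<otimes> b"
proof -
  have "\<iota> b \<otimes> ((\<iota> a \<otimes> a) \<otimes> b) \<preceq> \<iota> b \<otimes> b"
    by (intro sle_mult idem_mult_sle sle_refl) (use assms in auto)
  then show ?thesis using assms by simp
qed

lemma ran_mult_sle:
  assumes "a \<in> carrier S" "b \<in> carrier S"
  shows "(a \<otimes> b) \<otimes> \<iota> (a \<otimes> b) \<preceq> a \<otimes> \<iota> a"
  using dom_mult_sle[of "\<iota> b" "\<iota> a"] assms by simp

lemma downset_iff: "y \<in> downset S A \<longleftrightarrow> y \<in> carrier S \<and> (\<exists>a\<in>A. y \<preceq> a)"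
  by (simp add: downset_def)

lemma downsetI: "a \<in> A \<Longrightarrow> y \<preceq> a \<Longrightarrow> y \<in> carrier S \<Longrightarrow> y \<in> downset S A"
  by (auto simp: downset_def)

lemma downsetE:
  assumes "y \<in> downset S A"
  obtains a where "a \<in> A" "y \<preceq> a" "y \<in> carrier S"
  using assms by (auto simp: downset_def)

lemma upsetI: "a \<in> A \<Longrightarrow> a \<preceq> y \<Longrightarrow> y \<in> carrier S \<Longrightarrow> y \<in> upset S A"
  by (auto simp: upset_def)

lemma upsetE:
  assumes "y \<in> upset S A"
  obtains a where "a \<in> A" "a \<preceq> y" "y \<in> carrier S"
  using assms by (auto simp: upset_def)

lemma setprodI: "a \<in> A \<Longrightarrow> b \<in> B \<Longrightarrow> a \<otimes> b \<in> setprod S A B"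
  by (auto simp: setprod_def)

lemma setprodE:
  assumes "y \<in> setprod S A B"
  obtains a b where "a \<in> A" "b \<in> B" "y = a \<otimes> b"
  using assms by (auto simp: setprod_def)

end

text \<open>Regularity with commuting idempotents is the criterion by which ideals and bisections
  are recognised as inverse semigroups: in both cases the idempotents are sets of idempotents or
  identities, whose products commute visibly. Given inverses \<open>b\<close> and \<open>c\<close>
  of \<open>a\<close>, commuting \<open>a \<otimes> b\<close> with \<open>a \<otimes> c\<close> and
  \<open>b \<otimes> a\<close> with \<open>c \<otimes> a\<close> turns \<open>b\<close> into
  \<open>c\<close>.\<close>

lemma inverse_semigroupI:
  fixes S (structure)
  assumes closed: "\<And>a b. \<lbrakk>a \<in> carrier S; b \<in> carrier S\<rbrakk> \<Longrightarrow> a \<otimes> b \<in> carrier S"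
    and assoc: "\<And>a b c. \<lbrakk>a \<in> carrier S; b \<in> carrier S; c \<in> carrier S\<rbrakk> \<Longrightarrow> (a \<otimes> b) \<otimes> c = a \<otimes> (b \<otimes> c)"
    and regular: "\<And>a. a \<in> carrier S \<Longrightarrow> \<exists>b. is_inverse S a b"
    and comm: "\<And>e f. \<lbrakk>e \<in> idempotents S; f \<in> idempotents S\<rbrakk> \<Longrightarrow> e \<otimes> f = f \<otimes> e"
  shows "inverse_semigroup S"
proof
  fix a assume a: "a \<in> carrier S"
  have "b = c" if b: "is_inverse S a b" and c: "is_inverse S a c" for b c
  proof -
    have bc: "b \<in> carrier S" "c \<in> carrier S" and *: "a \<otimes> b \<otimes> a = a" "b \<otimes> a \<otimes> b = b"
        "a \<otimes> c \<otimes> a = a" "c \<otimes> a \<otimes> c = c"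
      using b c by (auto simp: is_inverse_def)
    have id: "a \<otimes> b \<in> idempotents S" "b \<otimes> a \<in> idempotents S"
      "a \<otimes> c \<in> idempotents S" "c \<otimes> a \<in> idempotents S"
      using * a bc by (simp_all add: idempotents_def closed flip: assoc)
    have "b = b \<otimes> (a \<otimes> b)" using * a bc by (simp add: assoc)
    also have "\<dots> = b \<otimes> (a \<otimes> c \<otimes> (a \<otimes> b))" using * a bc by (simp add: closed flip: assoc)
    also have "\<dots> = b \<otimes> (a \<otimes> b \<otimes> (a \<otimes> c))" using comm[OF id(1) id(3)] by simp
    also have "\<dots> = b \<otimes> a \<otimes> c" using * a bc by (simp add: closed flip: assoc)
    also have "\<dots> = (b \<otimes> a) \<otimes> (c \<otimes> a) \<otimes> c" using * a bc by (simp add: closed assoc)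
    also have "\<dots> = (c \<otimes> a) \<otimes> (b \<otimes> a) \<otimes> c" using comm[OF id(2) id(4)] by simp
    also have "\<dots> = c \<otimes> (a \<otimes> b \<otimes> a) \<otimes> c" using a bc by (simp add: closed assoc)
    also have "\<dots> = c" using * by simp
    finally show ?thesis .
  qed
  then show "\<exists>!b. is_inverse S a b" using regular[OF a] by blast
qed (use closed assoc in auto)

context inverse_semigroup_with_zero
begin

abbreviation zero_S :: "'a" (\<open>\<zero>\<close>) where "\<zero> \<equiv> szero S"

lemma is_zero_szero: "is_zero S \<zero>"
proof -
  have "\<exists>!z. is_zero S z" using zero_exists by (auto simp: is_zero_def; metis)
  then show ?thesis unfolding szero_def by (rule theI')
qed

lemma zero_closed [simp]: "\<zero> \<in> carrier S"
  and zero_mult [simp]: "a \<in> carrier S \<Longrightarrow> \<zero> \<otimes> a = \<zero>"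
  and mult_zero [simp]: "a \<in> carrier S \<Longrightarrow> a \<otimes> \<zero> = \<zero>"
  using is_zero_szero by (auto simp: is_zero_def)

lemma zero_idem [simp]: "\<zero> \<in> E"
  by (auto intro: idemI)

lemma zero_sle [simp]: "a \<in> carrier S \<Longrightarrow> \<zero> \<preceq> a"
  by (auto intro: sleI_right[of \<zero>])

lemma sle_zero: "a \<preceq> \<zero> \<Longrightarrow> a = \<zero>"
  by (auto simp: sle_def)

lemma szero_eqI: "is_zero S z \<Longrightarrow> \<zero> = z"
  using is_zero_szero by (metis is_zero_def)

lemma dom_eq_zero: "a \<in> carrier S \<Longrightarrow> \<iota> a \<otimes> a = \<zero> \<Longrightarrow> a = \<zero>"
  by (metis mult_sinv_mult mult_zero)

end

section \<open>Inverse semigroups of sets ordered by inclusion\<close>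

text \<open>The common setting of \<open>\<D> S\<close>, where the bottom \<open>Z\<close> is the
  zero ideal, and of \<open>KB G\<close>, where it is empty. Writing joins as
  \<open>Z \<union> \<Union>\<A>\<close> gives the empty family the correct join.\<close>

locale set_inverse_semigroup = inverse_semigroup M for M :: "'a set sgrp" (structure) +
  fixes Z :: "'a set"
  assumes bottom_closed: "Z \<in> carrier M"
    and bottom_subset: "A \<in> carrier M \<Longrightarrow> Z \<subseteq> A"
    and sle_iff_subset: "\<lbrakk>A \<in> carrier M; B \<in> carrier M\<rbrakk> \<Longrightarrow> sle M A B \<longleftrightarrow> A \<subseteq> B"
    and union_closed: "\<lbrakk>finite \<A>; compatible_set M \<A>\<rbrakk> \<Longrightarrow> Z \<union> \<Union>\<A> \<in> carrier M"
    and mult_union: "\<lbrakk>finite \<A>; compatible_set M \<A>; C \<in> carrier M\<rbrakk>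
        \<Longrightarrow> C \<otimes> (Z \<union> \<Union>\<A>) = Z \<union> \<Union>((\<lambda>A. C \<otimes> A) ` \<A>)"
    and union_mult: "\<lbrakk>finite \<A>; compatible_set M \<A>; C \<in> carrier M\<rbrakk>
        \<Longrightarrow> (Z \<union> \<Union>\<A>) \<otimes> C = Z \<union> \<Union>((\<lambda>A. A \<otimes> C) ` \<A>)"
begin

lemma is_join_iff_union:
  assumes "finite \<A>" "compatible_set M \<A>"
  shows "is_join M \<A> X \<longleftrightarrow> X = Z \<union> \<Union>\<A>"
proof -
  have sub: "\<A> \<subseteq> carrier M" using assms by (simp add: compatible_set_def)
  have U: "Upper (natural_order M) \<A> = {Y \<in> carrier M. \<forall>A\<in>\<A>. A \<subseteq> Y}"
    using sub sle_iff_subset by (auto simp: Upper_def natural_order_def)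
  have *: "is_join M \<A> X \<longleftrightarrow> X \<in> carrier M \<and> (\<forall>A\<in>\<A>. A \<subseteq> X) \<and>
      (\<forall>Y\<in>carrier M. (\<forall>A\<in>\<A>. A \<subseteq> Y) \<longrightarrow> X \<subseteq> Y)"
  proof -
    have "is_join M \<A> X \<longleftrightarrow> (X \<in> carrier M \<and> (\<forall>A\<in>\<A>. A \<subseteq> X)) \<and>
        (\<forall>Y. Y \<in> carrier M \<and> (\<forall>A\<in>\<A>. A \<subseteq> Y) \<longrightarrow> sle M X Y)"
      unfolding is_join_def least_def U by (simp add: natural_order_def Ball_def conj_ac)
    then show ?thesis using sle_iff_subset by metis
  qed
  have Uc: "Z \<union> \<Union>\<A> \<in> carrier M" by (rule union_closed[OF assms])
  show ?thesis
  proof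
    assume X: "is_join M \<A> X"
    then have "\<forall>Y\<in>carrier M. (\<forall>A\<in>\<A>. A \<subseteq> Y) \<longrightarrow> X \<subseteq> Y" "X \<in> carrier M" "\<forall>A\<in>\<A>. A \<subseteq> X"
      unfolding * by simp_all
    from this(1)[rule_format, OF Uc] this(2,3)
    have "X \<subseteq> Z \<union> \<Union>\<A>" "Z \<union> \<Union>\<A> \<subseteq> X" using bottom_subset by auto
    then show "X = Z \<union> \<Union>\<A>" by blast
  next
    assume "X = Z \<union> \<Union>\<A>"
    then show "is_join M \<A> X" unfolding * using Uc bottom_subset by blast
  qed
qed

lemma is_zero_bottom: "is_zero M Z"
  unfolding is_zero_def
  using mult_union[of "{}"] union_mult[of "{}"] bottom_closed by (simp add: compatible_set_def)

lemma compatible_set_mult: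
  assumes "compatible_set M \<A>" "C \<in> carrier M"
  shows "compatible_set M ((\<lambda>A. C \<otimes> A) ` \<A>)" "compatible_set M ((\<lambda>A. A \<otimes> C) ` \<A>)"
  using assms by (auto simp: compatible_set_def intro!: compatible_mult)

lemma distributive_inverse_semigroup: "distributive_inverse_semigroup M"
proof (unfold_locales, goal_cases)
  case 1 show ?case using is_zero_bottom by blast
next
  case (2 A) then show ?case by (auto simp: is_join_iff_union)
next
  case (3 A x c) then show ?case
    by (simp add: is_join_iff_union mult_union compatible_set_mult)
next
  case (4 A x c) then show ?case
    by (simp add: is_join_iff_union union_mult compatible_set_mult)
qed

lemma szero_bottom: "szero M = Z"
proof -
  interpret distributive_inverse_semigroup M by (rule distributive_inverse_semigroup)
  show ?thesis by (rule szero_eqI[OF is_zero_bottom])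
qed

text \<open>A pair that has a join is bounded above and hence compatible, so its join is the union.
  This matters because the definition of a prime filter quantifies over all pairs with a
  join.\<close>

lemma is_join_pair:
  assumes "A \<in> carrier M" "B \<in> carrier M" "X \<in> carrier M"
  shows "is_join M {A, B} X \<longleftrightarrow> X = A \<union> B"
proof -
  have c: "compatible_set M {A, B}" if "A \<subseteq> X" "B \<subseteq> X"
    using that assms by (auto simp: compatible_set_def sle_iff_subset intro!: compatible_bounded[of _ X])
  have "A \<subseteq> X" "B \<subseteq> X" if "is_join M {A, B} X"
    using that assms
    by (auto simp: is_join_def least_def Upper_def natural_order_def sle_iff_subset)
  then show ?thesis
    using c is_join_iff_union[of "{A, B}" X] bottom_subset[OF assms(1)] by auto
qed

text \<open>Serves both semigroups of sets: the natural order and joins disappear in favour of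
  inclusion and binary unions.\<close>

lemma is_prime_filter_iff:
  "is_prime_filter M F \<longleftrightarrow> F \<subseteq> carrier M \<and> F \<noteq> {} \<and> Z \<notin> F \<and>
     (\<forall>A\<in>F. \<forall>B\<in>carrier M. A \<subseteq> B \<longrightarrow> B \<in> F) \<and>
     (\<forall>A\<in>F. \<forall>B\<in>F. \<exists>C\<in>F. C \<subseteq> A \<and> C \<subseteq> B) \<and>
     (\<forall>A\<in>carrier M. \<forall>B\<in>carrier M. A \<union> B \<in> F \<longrightarrow> A \<in> F \<or> B \<in> F)" (is "?l \<longleftrightarrow> ?r")
proof -
  have 1: "is_filter M F \<longleftrightarrow> F \<subseteq> carrier M \<and> F \<noteq> {} \<and> Z \<notin> F \<and>
     (\<forall>A\<in>F. \<forall>B\<in>carrier M. A \<subseteq> B \<longrightarrow> B \<in> F) \<and>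
     (\<forall>A\<in>F. \<forall>B\<in>F. \<exists>C\<in>F. C \<subseteq> A \<and> C \<subseteq> B)" (is "_ \<longleftrightarrow> ?f")
  proof -
    have "upset M F \<subseteq> F \<longleftrightarrow> (\<forall>A\<in>F. \<forall>B\<in>carrier M. A \<subseteq> B \<longrightarrow> B \<in> F)" if "F \<subseteq> carrier M"
      using that sle_iff_subset unfolding upset_def by blast
    moreover have "(\<forall>A\<in>F. \<forall>B\<in>F. \<exists>C\<in>F. sle M C A \<and> sle M C B) \<longleftrightarrow>
        (\<forall>A\<in>F. \<forall>B\<in>F. \<exists>C\<in>F. C \<subseteq> A \<and> C \<subseteq> B)" if "F \<subseteq> carrier M"
      using that sle_iff_subset by (meson subsetD)
    ultimately show ?thesis
      unfolding is_filter_def szero_bottom by (cases "F \<subseteq> carrier M") simp_all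
  qed
  have 2: "(\<forall>X\<in>F. is_join M {A, B} X \<longrightarrow> A \<in> F \<or> B \<in> F) \<longleftrightarrow> (A \<union> B \<in> F \<longrightarrow> A \<in> F \<or> B \<in> F)"
    if "A \<in> carrier M" "B \<in> carrier M" "F \<subseteq> carrier M" for A B
    using that is_join_pair[of A B] by blast
  show ?thesis
  proof (cases "F \<subseteq> carrier M")
    case True
    then show ?thesis
      unfolding is_prime_filter_def 1 using 2 by (simp cong: ball_cong)
  qed (simp add: is_prime_filter_def 1)
qed

lemma mem_upset_iff:
  assumes "\<X> \<subseteq> carrier M"
  shows "C \<in> upset M \<X> \<longleftrightarrow> C \<in> carrier M \<and> (\<exists>X\<in>\<X>. X \<subseteq> C)"
  using assms sle_iff_subset unfolding upset_def by blast

end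

section \<open>Finitely generated compatible order ideals\<close>

lemma fg_compatible_ideals_simps:
  "mult (\<D> S) = setprod S"
  "carrier (\<D> S) = {I. order_ideal S I \<and> compatible_set S I \<and> (\<exists>A. finite A \<and> A \<subseteq> carrier S \<and> I = downset S A)}"
  by (simp_all add: fg_compatible_ideals_def)

context inverse_semigroup_with_zero
begin

lemma downset_subset: "downset S A \<subseteq> carrier S"
  by (auto simp: downset_iff)

lemma downset_downset: "A \<subseteq> carrier S \<Longrightarrow> downset S (downset S A) \<subseteq> downset S A"
  by (intro subsetI, elim downsetE) (rule downsetI, assumption, auto intro: sle_trans)

lemma subset_downset: "A \<subseteq> carrier S \<Longrightarrow> A \<subseteq> downset S A"
  unfolding downset_iff subset_iff by (metis sle_refl)

lemma compatible_set_downset: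
  assumes "compatible_set S A"
  shows "compatible_set S (downset S A)"
  unfolding compatible_set_def
proof (intro conjI ballI downset_subset)
  fix s t assume "s \<in> downset S A" "t \<in> downset S A"
  then obtain a b where "a \<in> A" "s \<preceq> a" "b \<in> A" "t \<preceq> b" by (auto elim!: downsetE)
  then show "compatible S s t"
    using assms compatible_sle[of a b s t] unfolding compatible_set_def by blast
qed

text \<open>Compatibility passes from the generators to everything below them, and a nonempty
  generating set has the zero below it, so all conditions can be checked on generators.\<close>

lemma ideal_iff:
  "I \<in> carrier (\<D> S) \<longleftrightarrow> (\<exists>A. finite A \<and> A \<noteq> {} \<and> compatible_set S A \<and> I = downset S A)" (is "?l \<longleftrightarrow> ?r")
proof
  assume ?l
  then obtain A where A: "finite A" "A \<subseteq> carrier S" "I = downset S A" and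
    I: "order_ideal S I" "compatible_set S I"
    by (auto simp: fg_compatible_ideals_simps)
  moreover have "A \<noteq> {}" using I A by (auto simp: order_ideal_def downset_def)
  moreover have "compatible_set S A"
    using subset_downset[OF A(2)] A I unfolding compatible_set_def subset_iff by blast
  ultimately show ?r by blast
next
  assume ?r
  then obtain A where A: "finite A" "A \<noteq> {}" "compatible_set S A" "I = downset S A" by blast
  then have sub: "A \<subseteq> carrier S" by (auto simp: compatible_set_def)
  then have "order_ideal S I"
    using A downset_downset[of A] downset_subset by (auto simp: order_ideal_def downset_iff subset_iff)
  then show ?l
    using A sub compatible_set_downset[of A] by (auto simp: fg_compatible_ideals_simps)
qed

lemma ideal_subset: "I \<in> carrier (\<D> S) \<Longrightarrow> I \<subseteq> carrier S"
  unfolding fg_compatible_ideals_simps order_ideal_def by blast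

lemma ideal_closed: "I \<in> carrier (\<D> S) \<Longrightarrow> a \<in> I \<Longrightarrow> a \<in> carrier S"
  using ideal_subset by blast

lemma ideal_zero: "I \<in> carrier (\<D> S) \<Longrightarrow> \<zero> \<in> I"
  unfolding fg_compatible_ideals_simps order_ideal_def by blast

lemma ideal_down: "I \<in> carrier (\<D> S) \<Longrightarrow> a \<in> I \<Longrightarrow> b \<preceq> a \<Longrightarrow> b \<in> I"
  using sle_closed[of b a] downsetI[of a I b]
  unfolding fg_compatible_ideals_simps order_ideal_def by blast

lemma ideal_compatible: "I \<in> carrier (\<D> S) \<Longrightarrow> a \<in> I \<Longrightarrow> b \<in> I \<Longrightarrow> compatible S a b"
  unfolding fg_compatible_ideals_simps compatible_set_def by blast

lemma principal_ideal: "a \<in> carrier S \<Longrightarrow> downset S {a} \<in> carrier (\<D> S)"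
  unfolding ideal_iff by (rule exI[of _ "{a}"]) (auto simp: compatible_set_def)

lemma setprod_downset:
  assumes "A \<subseteq> carrier S" "B \<subseteq> carrier S"
  shows "setprod S (downset S A) (downset S B) = downset S (setprod S A B)"
proof (intro equalityI subsetI)
  fix x assume "x \<in> setprod S (downset S A) (downset S B)"
  then obtain a b a' b' where *: "x = a' \<otimes> b'" "a' \<preceq> a" "b' \<preceq> b" "a \<in> A" "b \<in> B"
      "a' \<in> carrier S" "b' \<in> carrier S"
    by (auto elim!: setprodE downsetE)
  then show "x \<in> downset S (setprod S A B)"
    using assms by (auto intro!: downsetI[of "a \<otimes> b"] setprodI sle_mult)
next
  fix x assume "x \<in> downset S (setprod S A B)"
  then obtain a b where ab: "x \<in> carrier S" "a \<in> A" "b \<in> B" "x \<preceq> a \<otimes> b"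
    by (auto elim!: setprodE downsetE)
  \<comment> \<open>The idempotent that cuts \<open>a \<otimes> b\<close> down to \<open>x\<close>
    is absorbed into the right factor.\<close>
  then obtain e where "e \<in> E" "x = (a \<otimes> b) \<otimes> e" by (auto simp: sle_def)
  moreover have "a \<in> carrier S" "b \<in> carrier S" using ab assms by auto
  ultimately have "x = a \<otimes> (b \<otimes> e)" "a \<in> downset S A" "b \<otimes> e \<in> downset S B"
    using ab by (auto intro: downsetI)
  then show "x \<in> setprod S (downset S A) (downset S B)"
    using setprodI by blast
qed

lemma sinv_image_downset:
  assumes "A \<subseteq> carrier S"
  shows "\<iota> ` downset S A = downset S (\<iota> ` A)"
proof (intro equalityI subsetI)
  fix x assume "x \<in> \<iota> ` downset S A"
  then obtain a b where "x = \<iota> b" "b \<preceq> a" "a \<in> A" "b \<in> carrier S" by (auto elim!: downsetE)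
  moreover from this have "\<iota> b \<preceq> \<iota> a" using assms sle_sinv by blast
  ultimately show "x \<in> downset S (\<iota> ` A)" by (auto intro: downsetI)
next
  fix x assume "x \<in> downset S (\<iota> ` A)"
  then obtain a where a: "x \<in> carrier S" "a \<in> A" "x \<preceq> \<iota> a" by (auto elim: downsetE)
  then have "a \<in> carrier S" using assms by blast
  then have "\<iota> x \<preceq> a" using a sle_sinv[of x "\<iota> a"] by simp
  then have "\<iota> x \<in> downset S A" "x = \<iota> (\<iota> x)" using a by (auto intro: downsetI)
  then show "x \<in> \<iota> ` downset S A" by blast
qed

lemma ideal_mult_closed:
  assumes "I \<in> carrier (\<D> S)" "J \<in> carrier (\<D> S)"
  shows "setprod S I J \<in> carrier (\<D> S)"
proof -
  obtain A B where A: "finite A" "A \<noteq> {}" "compatible_set S A" "I = downset S A"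
    and B: "finite B" "B \<noteq> {}" "compatible_set S B" "J = downset S B"
    using assms unfolding ideal_iff by blast
  have "setprod S A B = (\<lambda>(a, b). a \<otimes> b) ` (A \<times> B)" by (auto simp: setprod_def)
  then have "finite (setprod S A B)" "setprod S A B \<noteq> {}" using A B by auto
  moreover have "compatible_set S (setprod S A B)"
    unfolding compatible_set_def
  proof (intro conjI subsetI ballI; elim setprodE; hypsubst)
    fix a b a' b' assume *: "a \<in> A" "b \<in> B" "a' \<in> A" "b' \<in> B"
    then have "a \<in> carrier S" "b \<in> carrier S" "a' \<in> carrier S" "b' \<in> carrier S"
      "compatible S a a'" "compatible S b b'"
      using A(3) B(3) by (auto simp: compatible_set_def)
    then show "compatible S (a \<otimes> b) (a' \<otimes> b')" by (intro compatible_mult)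
  next
    fix a b assume *: "a \<in> A" "b \<in> B"
    then have "a \<in> carrier S" "b \<in> carrier S" using A(3) B(3) by (auto simp: compatible_set_def)
    then show "a \<otimes> b \<in> carrier S" by simp
  qed
  moreover have "setprod S I J = downset S (setprod S A B)"
    using A B setprod_downset[of A B] by (simp add: compatible_set_def)
  ultimately show ?thesis unfolding ideal_iff by blast
qed

lemma ideal_sinv_closed:
  assumes "I \<in> carrier (\<D> S)"
  shows "\<iota> ` I \<in> carrier (\<D> S)"
proof -
  obtain A where A: "finite A" "A \<noteq> {}" "compatible_set S A" "I = downset S A"
    using assms unfolding ideal_iff by blast
  moreover have "compatible_set S (\<iota> ` A)"
    using A(3) unfolding compatible_set_def by (auto intro: compatible_sinv)
  moreover have "\<iota> ` I = downset S (\<iota> ` A)"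
    using A sinv_image_downset[of A] by (simp add: compatible_set_def)
  ultimately show ?thesis unfolding ideal_iff by blast
qed

lemma setprod_assoc:
  assumes "A \<subseteq> carrier S" "B \<subseteq> carrier S" "C \<subseteq> carrier S"
  shows "setprod S (setprod S A B) C = setprod S A (setprod S B C)"
proof -
  have abc: "(a \<otimes> b) \<otimes> c = a \<otimes> (b \<otimes> c)" if "a \<in> A" "b \<in> B" "c \<in> C" for a b c
    using that assms by (auto intro: m_assoc)
  show ?thesis
  proof (intro equalityI subsetI; elim setprodE; hypsubst)
    fix a b c assume *: "a \<in> A" "b \<in> B" "c \<in> C"
    show "(a \<otimes> b) \<otimes> c \<in> setprod S A (setprod S B C)"
      unfolding abc[OF *] using * by (intro setprodI)
    show "a \<otimes> (b \<otimes> c) \<in> setprod S (setprod S A B) C"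
      unfolding abc[OF *, symmetric] using * by (intro setprodI)
  qed
qed

text \<open>In \<open>a \<otimes> (\<iota> b \<otimes> c)\<close> compatibility of \<open>b\<close>
  and \<open>c\<close> makes the second factor idempotent, so the product stays below
  \<open>a\<close>. Hence elementwise inversion provides inverses in \<open>\<D> S\<close>.\<close>

lemma setprod_sinv_setprod:
  assumes I: "I \<in> carrier (\<D> S)"
  shows "setprod S I (setprod S (\<iota> ` I) I) = I"
proof (intro equalityI subsetI)
  fix x assume "x \<in> setprod S I (setprod S (\<iota> ` I) I)"
  then obtain a b c where abc: "a \<in> I" "b \<in> I" "c \<in> I" "x = a \<otimes> (\<iota> b \<otimes> c)"
    by (auto elim!: setprodE)
  then have "\<iota> b \<otimes> c \<in> E" using ideal_compatible[OF I, of b c] by (simp add: compatible_def)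
  then have "x \<preceq> a" using abc ideal_closed[OF I] by simp
  then show "x \<in> I" using ideal_down[OF I] abc by simp
next
  fix x assume x: "x \<in> I"
  then have "x = x \<otimes> (\<iota> x \<otimes> x)" using ideal_closed[OF I] by simp
  then show "x \<in> setprod S I (setprod S (\<iota> ` I) I)"
    using x by (metis setprodI imageI)
qed

text \<open>Write \<open>a = b \<otimes> c\<close> inside the ideal. Comparing domains and ranges of
  compatible elements gives \<open>a \<preceq> c\<close> and \<open>a \<preceq> b\<close>, and then
  also \<open>a \<otimes> \<iota> a \<preceq> b\<close>. Thus \<open>a\<close> and its range
  idempotent lie below the same element and have the same range, so they coincide.\<close>

lemma idempotent_ideal_subset:
  assumes "I \<in> idempotents (\<D> S)"
  shows "I \<subseteq> E"
proof
  have I: "I \<in> carrier (\<D> S)" and II: "setprod S I I = I"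
    using assms by (auto simp: idempotents_def fg_compatible_ideals_simps(1))
  fix a assume a: "a \<in> I"
  then obtain b c where bc: "b \<in> I" "c \<in> I" "a = b \<otimes> c" using II by (metis setprodE)
  have S [simp]: "a \<in> carrier S" "b \<in> carrier S" "c \<in> carrier S" using a bc ideal_closed[OF I] by auto
  have "a \<preceq> c"
  proof (rule compatible_sle_if_dom)
    show "compatible S a c" using ideal_compatible[OF I] a bc by blast
    show "\<iota> a \<otimes> a \<preceq> \<iota> c \<otimes> c" unfolding bc(3) by (rule dom_mult_sle) auto
  qed auto
  then have ac: "c \<otimes> (\<iota> a \<otimes> a) = a" using sle_right_iff S by metis
  have "b \<otimes> a = (b \<otimes> c) \<otimes> (\<iota> a \<otimes> a)" using arg_cong[OF ac, of "\<lambda>x. b \<otimes> x"] by simp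
  also have "\<dots> = a" unfolding bc(3)[symmetric] by simp
  finally have "b \<otimes> (a \<otimes> \<iota> a) = a \<otimes> \<iota> a" by (simp flip: m_assoc)
  then have "a \<otimes> \<iota> a \<preceq> b" by (intro sleI_right[of "a \<otimes> \<iota> a"]) auto
  moreover have "a \<preceq> b"
  proof (rule compatible_sle_if_ran)
    show "compatible S a b" using ideal_compatible[OF I] a bc by blast
    show "a \<otimes> \<iota> a \<preceq> b \<otimes> \<iota> b" unfolding bc(3) by (rule ran_mult_sle) auto
  qed auto
  \<comment> \<open>Inversion turns the common range into a common domain, the form that
    \<open>sle_eq_if_dom\<close> uses.\<close>
  ultimately have "\<iota> a \<preceq> \<iota> b" "a \<otimes> \<iota> a \<preceq> \<iota> b"
    using sle_sinv[of "a \<otimes> \<iota> a" b] sle_sinv[of a b] by simp_all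
  then have "\<iota> a = a \<otimes> \<iota> a" by (rule sle_eq_if_dom[OF _ _ sinv_closed]) simp_all
  then have "\<iota> a \<in> E" by (metis mult_sinv_idem S(1))
  then show "a \<in> E" by (metis sinv_idem sinv_sinv S(1))
qed

lemma inverse_semigroup_ideals: "inverse_semigroup (\<D> S)"
proof (rule inverse_semigroupI)
  fix I assume I: "I \<in> carrier (\<D> S)"
  have ii: "\<iota> ` \<iota> ` I = I" using ideal_closed[OF I] by (force simp: image_image)
  have "is_inverse (\<D> S) I (\<iota> ` I)"
    using setprod_sinv_setprod[OF I] setprod_sinv_setprod[OF ideal_sinv_closed[OF I]]
      ideal_subset[OF I] ideal_subset[OF ideal_sinv_closed[OF I]] ideal_sinv_closed[OF I]
    by (simp add: is_inverse_def fg_compatible_ideals_simps(1) setprod_assoc ii)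
  then show "\<exists>b. is_inverse (\<D> S) I b" by blast
next
  fix I J assume "I \<in> idempotents (\<D> S)" "J \<in> idempotents (\<D> S)"
  then have "I \<subseteq> E" "J \<subseteq> E" using idempotent_ideal_subset by auto
  then show "mult (\<D> S) I J = mult (\<D> S) J I"
    by (auto simp: fg_compatible_ideals_simps(1) setprod_def) (metis subset_iff idem_comm)+
qed (use ideal_mult_closed setprod_assoc ideal_subset in \<open>auto simp: fg_compatible_ideals_simps(1)\<close>)

lemma sinv_ideal:
  assumes I: "I \<in> carrier (\<D> S)"
  shows "sinv (\<D> S) I = \<iota> ` I"
proof -
  interpret D: inverse_semigroup "\<D> S" by (rule inverse_semigroup_ideals)
  have ii: "\<iota> ` \<iota> ` I = I" using ideal_closed[OF I] by (force simp: image_image)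
  show ?thesis
    using setprod_sinv_setprod[OF I] setprod_sinv_setprod[OF ideal_sinv_closed[OF I]]
    by (intro D.sinv_eqI) (auto simp: fg_compatible_ideals_simps(1) I ideal_sinv_closed ii)
qed

text \<open>Multiplying by an ideal of idempotents only moves down. Conversely, if
  \<open>I \<subseteq> J\<close>, compatibility within \<open>J\<close> makes
  \<open>a \<otimes> \<iota> b\<close> idempotent for \<open>a\<close> in \<open>J\<close> and
  \<open>b\<close> in \<open>I\<close>, so \<open>J\<close> times the domain ideal of
  \<open>I\<close> is no larger than \<open>I\<close>.\<close>

lemma sle_ideal_iff:
  assumes I: "I \<in> carrier (\<D> S)" and J: "J \<in> carrier (\<D> S)"
  shows "sle (\<D> S) I J \<longleftrightarrow> I \<subseteq> J"
proof
  assume "sle (\<D> S) I J"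
  then obtain K where K: "K \<in> idempotents (\<D> S)" "I = setprod S J K"
    by (auto simp: sle_def fg_compatible_ideals_simps(1))
  then have "K \<subseteq> E" using idempotent_ideal_subset by auto
  then show "I \<subseteq> J"
    using K ideal_down[OF J] ideal_closed[OF J] mult_idem_sle by (auto elim!: setprodE)
next
  interpret D: inverse_semigroup "\<D> S" by (rule inverse_semigroup_ideals)
  assume IJ: "I \<subseteq> J"
  have "I = setprod S J (setprod S (\<iota> ` I) I)"
  proof (intro equalityI subsetI)
    fix x assume "x \<in> setprod S J (setprod S (\<iota> ` I) I)"
    then obtain a b c where abc: "a \<in> J" "b \<in> I" "c \<in> I" "x = a \<otimes> (\<iota> b \<otimes> c)"
      by (auto elim!: setprodE)
    then have "a \<otimes> \<iota> b \<in> E" using ideal_compatible[OF J, of a b] IJ by (auto simp add: compatible_def)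
    then have "(a \<otimes> \<iota> b) \<otimes> c \<preceq> c" using abc ideal_closed[OF I] idem_mult_sle by blast
    then have "x \<preceq> c" using abc ideal_closed[OF I] ideal_closed[OF J] by simp
    then show "x \<in> I" using ideal_down[OF I] abc by simp
  next
    fix x assume x: "x \<in> I"
    then have "x = x \<otimes> (\<iota> x \<otimes> x)" using ideal_closed[OF I] by simp
    then show "x \<in> setprod S J (setprod S (\<iota> ` I) I)"
      using x IJ setprodI[of x J "\<iota> x \<otimes> x" "setprod S (\<iota> ` I) I"]
        setprodI[of "\<iota> x" "\<iota> ` I" x I] by auto
  qed
  then show "sle (\<D> S) I J"
    using D.sle_right_iff[OF I J] by (simp add: sinv_ideal[OF I] fg_compatible_ideals_simps(1))
qed

lemma set_inverse_semigroup_ideals: "set_inverse_semigroup (\<D> S) {\<zero>}"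
proof -
  interpret D: inverse_semigroup "\<D> S" by (rule inverse_semigroup_ideals)
  show ?thesis
  proof (unfold_locales, goal_cases)
    case 1
    have "downset S {\<zero>} = {\<zero>}" using sle_zero by (auto simp: downset_iff)
    then show ?case using principal_ideal[of \<zero>] by simp
  next
    case (2 A) then show ?case using ideal_zero by simp
  next
    case (3 A B) then show ?case by (rule sle_ideal_iff)
  next
    case (4 \<A>)
    have A: "\<A> \<subseteq> carrier (\<D> S)" using 4 by (simp add: compatible_set_def)
    then obtain f where f: "\<And>I. I \<in> \<A> \<Longrightarrow> finite (f I) \<and> compatible_set S (f I) \<and> I = downset S (f I)"
      using ideal_iff by (metis subset_iff)
    then have fI: "f I \<subseteq> I" "f I \<subseteq> carrier S" if "I \<in> \<A>" for I
      using that subset_downset[of "f I"] by (auto simp: compatible_set_def)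
    \<comment> \<open>Compatibility of two ideals says that all quotients of an element of one by an
      element of the other are idempotent, which is compatibility across the ideals.\<close>
    have comp: "compatible S a b" if "I \<in> \<A>" "J \<in> \<A>" "a \<in> I" "b \<in> J" for I J a b
    proof -
      have "compatible (\<D> S) I J" using that 4 by (simp add: compatible_set_def)
      then have "setprod S (\<iota> ` I) J \<subseteq> E" "setprod S I (\<iota> ` J) \<subseteq> E"
        using that A sinv_ideal[of I] sinv_ideal[of J] idempotent_ideal_subset
        unfolding compatible_def fg_compatible_ideals_simps(1) by (metis subsetD)+
      then show ?thesis
        using that setprodI unfolding compatible_def by blast
    qed
    \<comment> \<open>The zero keeps the generating set nonempty even when the family of ideals is
      empty.\<close>
    have "compatible_set S ({\<zero>} \<union> \<Union>(f ` \<A>))"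
      using fI comp unfolding compatible_set_def
      by (auto simp: subset_iff compatible_def dest: ideal_closed)
    moreover have "{\<zero>} \<union> \<Union>\<A> = downset S ({\<zero>} \<union> \<Union>(f ` \<A>))"
    proof -
      have "downset S ({\<zero>} \<union> \<Union>(f ` \<A>)) = {\<zero>} \<union> (\<Union>I\<in>\<A>. downset S (f I))"
        using sle_zero by (auto simp: downset_iff)
      also have "(\<Union>I\<in>\<A>. downset S (f I)) = \<Union>\<A>" using f by auto
      finally show ?thesis by simp
    qed
    ultimately show ?case unfolding ideal_iff using 4 f by (intro exI[of _ "{\<zero>} \<union> \<Union>(f ` \<A>)"]) auto
  next
    case (5 \<A> C)
    then have "\<zero> \<in> C" "C \<subseteq> carrier S" "\<zero> \<in> setprod S C {\<zero>}" "\<Union>\<A> \<subseteq> carrier S"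
      using ideal_zero ideal_subset by (force simp: compatible_set_def setprod_def)+
    then show ?case
      by (auto simp: fg_compatible_ideals_simps(1) setprod_def)
  next
    case (6 \<A> C)
    then have "\<zero> \<in> C" "C \<subseteq> carrier S" "\<zero> \<in> setprod S {\<zero>} C" "\<Union>\<A> \<subseteq> carrier S"
      using ideal_zero ideal_subset by (force simp: compatible_set_def setprod_def)+
    then show ?case
      by (auto simp: fg_compatible_ideals_simps(1) setprod_def)
  qed
qed

text \<open>The meet is the intersection. Intersection distributes over the principal ideals of the
  generators, and the weak meet condition supplies finitely many generators for each intersection of
  two principal ideals.\<close>

lemma inverse_meet_semigroup_ideals:
  assumes "weak_meet_condition S"
  shows "inverse_meet_semigroup (\<D> S)"
proof -
  interpret D: inverse_semigroup "\<D> S" by (rule inverse_semigroup_ideals)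
  have Int: "I \<inter> J \<in> carrier (\<D> S)" if I: "I \<in> carrier (\<D> S)" and J: "J \<in> carrier (\<D> S)" for I J
  proof -
    obtain A B where A: "finite A" "A \<noteq> {}" "compatible_set S A" "I = downset S A"
      and B: "finite B" "B \<noteq> {}" "compatible_set S B" "J = downset S B"
      using I J unfolding ideal_iff by blast
    then have sub: "A \<subseteq> carrier S" "B \<subseteq> carrier S" by (auto simp: compatible_set_def)
    have "\<forall>a\<in>A. \<forall>b\<in>B. \<exists>F. finite F \<and> F \<subseteq> carrier S \<and> downset S {a} \<inter> downset S {b} = downset S F"
      using assms sub unfolding weak_meet_condition_def by blast
    then obtain f where f: "\<And>a b. a \<in> A \<Longrightarrow> b \<in> B \<Longrightarrow> finite (f a b) \<and> f a b \<subseteq> carrier S \<and>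
        downset S {a} \<inter> downset S {b} = downset S (f a b)"
      by metis
    have "I \<inter> J = (\<Union>a\<in>A. \<Union>b\<in>B. downset S {a} \<inter> downset S {b})"
      using A B by (auto simp: downset_iff)
    also have "\<dots> = (\<Union>a\<in>A. \<Union>b\<in>B. downset S (f a b))"
      using f by auto
    also have "\<dots> = downset S (\<Union>a\<in>A. \<Union>b\<in>B. f a b)"
      unfolding downset_def by blast
    finally have "I \<inter> J = downset S (\<Union>a\<in>A. \<Union>b\<in>B. f a b)" .
    moreover have "finite (\<Union>a\<in>A. \<Union>b\<in>B. f a b)" "(\<Union>a\<in>A. \<Union>b\<in>B. f a b) \<subseteq> carrier S"
      using f A B by auto
    moreover have "order_ideal S (I \<inter> J)"
      using ideal_subset[OF I] ideal_zero[OF I] ideal_zero[OF J] ideal_down[OF I] ideal_down[OF J]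
      unfolding order_ideal_def downset_def by blast
    moreover have "compatible_set S (I \<inter> J)"
      using ideal_subset[OF I] ideal_compatible[OF I] unfolding compatible_set_def by blast
    ultimately show ?thesis unfolding fg_compatible_ideals_simps by blast
  qed
  have "lower_semilattice (natural_order (\<D> S))"
  proof unfold_locales
    fix I J assume "I \<in> carrier (natural_order (\<D> S))" "J \<in> carrier (natural_order (\<D> S))"
    then have IJ: "I \<in> carrier (\<D> S)" "J \<in> carrier (\<D> S)" by (auto simp: natural_order_def)
    show "\<exists>K. greatest (natural_order (\<D> S)) K (Lower (natural_order (\<D> S)) {I, J})"
    proof
      have "Lower (natural_order (\<D> S)) {I, J} = {K \<in> carrier (\<D> S). K \<subseteq> I \<and> K \<subseteq> J}"
        using IJ sle_ideal_iff unfolding Lower_def natural_order_def gorder.simps partial_object.simps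
        by blast
      then show "greatest (natural_order (\<D> S)) (I \<inter> J) (Lower (natural_order (\<D> S)) {I, J})"
        using Int[OF IJ] by (simp add: greatest_def natural_order_def sle_ideal_iff)
    qed
  qed (auto simp: natural_order_def sle_ideal_iff)
  then show ?thesis by (simp add: inverse_meet_semigroup_def D.inverse_semigroup_axioms)
qed

end

section \<open>Groupoids\<close>

lemma composable_pairs_iff:
  "(x, y) \<in> composable_pairs G \<longleftrightarrow> x \<in> carrier G \<and> y \<in> carrier G \<and> gdom G x = gran G y"
  by (simp add: composable_pairs_def)

context groupoid
begin

declare gdom_closed [simp] gran_closed [simp] gdom_gdom [simp] gran_gdom [simp]
  gdom_gran [simp] gran_gran [simp] gcomp_gdom [simp] gcomp_gran [simp]

lemma gcomp_simps [simp]: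
  assumes "x \<in> carrier G" "y \<in> carrier G" "gdom G x = gran G y"
  shows "gcomp G x y \<in> carrier G" "gdom G (gcomp G x y) = gdom G y" "gran G (gcomp G x y) = gran G x"
  using gcomp_closed gdom_gcomp gran_gcomp assms by (auto simp: composable_pairs_iff)

lemma gcomp_assoc':
  assumes "x \<in> carrier G" "y \<in> carrier G" "z \<in> carrier G" "gdom G x = gran G y" "gdom G y = gran G z"
  shows "gcomp G (gcomp G x y) z = gcomp G x (gcomp G y z)"
  using gcomp_assoc assms by (auto simp: composable_pairs_iff)

lemma is_ginverse_unique:
  assumes "x \<in> carrier G" "is_ginverse G x y" "is_ginverse G x z"
  shows "y = z"
proof -
  have "y = gcomp G y (gcomp G x z)" using assms gcomp_gdom[of y] by (simp add: is_ginverse_def)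
  also have "\<dots> = gcomp G (gcomp G y x) z"
    using assms by (intro gcomp_assoc'[symmetric]) (auto simp: is_ginverse_def)
  also have "\<dots> = z" using assms gcomp_gran[of z] by (simp add: is_ginverse_def)
  finally show ?thesis .
qed

lemma ginv_eqI: "x \<in> carrier G \<Longrightarrow> is_ginverse G x y \<Longrightarrow> ginv G x = y"
  unfolding ginv_def using is_ginverse_unique by (intro the_equality) auto

lemma is_ginverse_ginv: "x \<in> carrier G \<Longrightarrow> is_ginverse G x (ginv G x)"
  using ginverse_exists ginv_eqI by metis

lemma ginv_simps [simp]:
  assumes "x \<in> carrier G"
  shows "ginv G x \<in> carrier G" "gdom G (ginv G x) = gran G x" "gran G (ginv G x) = gdom G x"
    "gcomp G (ginv G x) x = gdom G x" "gcomp G x (ginv G x) = gran G x"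
  using is_ginverse_ginv[OF assms] by (auto simp: is_ginverse_def)

lemma ginv_ginv [simp]: "x \<in> carrier G \<Longrightarrow> ginv G (ginv G x) = x"
  by (rule ginv_eqI) (auto simp: is_ginverse_def)

lemma ginv_gcomp_cancel [simp]:
  assumes "x \<in> carrier G" "y \<in> carrier G" "gdom G x = gran G y"
  shows "gcomp G (ginv G x) (gcomp G x y) = y"
  using gcomp_assoc'[of "ginv G x" x y] assms by simp

lemma gcomp_ginv_cancel [simp]:
  assumes "x \<in> carrier G" "y \<in> carrier G" "gran G x = gran G y"
  shows "gcomp G x (gcomp G (ginv G x) y) = y"
  using gcomp_assoc'[of x "ginv G x" y] assms by simp

lemma identities_iff: "e \<in> identities G \<longleftrightarrow> e \<in> carrier G \<and> gdom G e = e \<and> gran G e = e"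
proof -
  have "gran G e = e" if "e \<in> carrier G" "gdom G e = e" using gran_gdom[OF that(1)] that by simp
  then show ?thesis by (auto simp: identities_def)
qed

lemma gdom_identities [simp]: "x \<in> carrier G \<Longrightarrow> gdom G x \<in> identities G"
  and gran_identities [simp]: "x \<in> carrier G \<Longrightarrow> gran G x \<in> identities G"
  by (auto simp: identities_iff)

end

context topological_groupoid
begin

lemma continuous_map_gcomp:
  assumes "continuous_map X (gtop G) f" "continuous_map X (gtop G) g"
    and "\<And>x. x \<in> topspace X \<Longrightarrow> gdom G (f x) = gran G (g x)"
  shows "continuous_map X (gtop G) (\<lambda>x. gcomp G (f x) (g x))"
proof -
  have "continuous_map X (subtopology (prod_topology (gtop G) (gtop G)) (composable_pairs G)) (\<lambda>x. (f x, g x))"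
    using assms continuous_map_image_subset_topspace[OF assms(1)] continuous_map_image_subset_topspace[OF assms(2)]
    by (auto simp: continuous_map_in_subtopology composable_pairs_iff continuous_map_pairedI image_subset_iff
        topspace_carrier)
  from continuous_map_compose[OF this continuous_gcomp] show ?thesis
    by (simp add: o_def)
qed

text \<open>The domain of \<open>x\<close> is the composite of its inverse with \<open>x\<close>, so
  continuity follows from that of composition and inversion.\<close>

lemma continuous_gdom: "continuous_map (gtop G) (gtop G) (gdom G)"
proof (rule continuous_map_eq)
  show "continuous_map (gtop G) (gtop G) (\<lambda>x. gcomp G (ginv G x) x)"
    by (intro continuous_map_gcomp continuous_ginv) (auto simp: topspace_carrier)
qed (auto simp: topspace_carrier)

lemma continuous_gran: "continuous_map (gtop G) (gtop G) (gran G)"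
proof (rule continuous_map_eq)
  show "continuous_map (gtop G) (gtop G) (\<lambda>x. gcomp G x (ginv G x))"
    by (intro continuous_map_gcomp continuous_ginv) (auto simp: topspace_carrier)
qed (auto simp: topspace_carrier)

end

locale boolean_groupoid = etale_groupoid G for G :: "('g, 'm) tgroupoid_scheme" +
  assumes hausdorff_identities: "Hausdorff_space (subtopology (gtop G) (identities G))"
    and KB_base: "\<lbrakk>openin (gtop G) V; x \<in> V\<rbrakk> \<Longrightarrow> \<exists>A\<in>carrier (KB G). x \<in> A \<and> A \<subseteq> V"

section \<open>The groupoid of filters\<close>

context inverse_semigroup_with_zero
begin

abbreviation fdom :: "'a set \<Rightarrow> 'a set" where "fdom A \<equiv> upset S (setprod S (\<iota> ` A) A)"
abbreviation fran :: "'a set \<Rightarrow> 'a set" where "fran A \<equiv> upset S (setprod S A (\<iota> ` A))"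
abbreviation fmult :: "'a set \<Rightarrow> 'a set \<Rightarrow> 'a set" (infixl \<open>\<diamondop>\<close> 70) where "A \<diamondop> B \<equiv> upset S (setprod S A B)"

section \<open>Elementary properties of filters\<close>

lemma filter_closed: "is_filter S F \<Longrightarrow> a \<in> F \<Longrightarrow> a \<in> carrier S"
  unfolding is_filter_def by blast

lemma filter_subset: "is_filter S F \<Longrightarrow> F \<subseteq> carrier S"
  unfolding is_filter_def by blast

lemma filter_up: "is_filter S F \<Longrightarrow> a \<in> F \<Longrightarrow> a \<preceq> b \<Longrightarrow> b \<in> carrier S \<Longrightarrow> b \<in> F"
  unfolding is_filter_def using upsetI[of a F b] by blast

lemma filter_zero: "is_filter S F \<Longrightarrow> \<zero> \<notin> F"
  unfolding is_filter_def by blast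

lemma filter_directed:
  assumes "is_filter S F" "a \<in> F" "b \<in> F"
  obtains c where "c \<in> F" "c \<preceq> a" "c \<preceq> b"
  using assms unfolding is_filter_def by blast

lemma filter_nonempty:
  assumes "is_filter S F"
  obtains a where "a \<in> F" "a \<in> carrier S"
  using assms unfolding is_filter_def by blast

lemma is_filterI:
  assumes "F \<subseteq> carrier S" "a \<in> F" "\<zero> \<notin> F"
    and "\<And>a b. a \<in> F \<Longrightarrow> a \<preceq> b \<Longrightarrow> b \<in> carrier S \<Longrightarrow> b \<in> F"
    and "\<And>a b. a \<in> F \<Longrightarrow> b \<in> F \<Longrightarrow> \<exists>c\<in>F. c \<preceq> a \<and> c \<preceq> b"
  shows "is_filter S F"
  unfolding is_filter_def using assms by (auto elim!: upsetE)

text \<open>A common lower bound of \<open>a\<close> and \<open>b\<close> in the filter lies below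
  this product.\<close>

lemma filter_meet:
  assumes "is_filter S F" "a \<in> F" "b \<in> F"
  shows "a \<otimes> (\<iota> b \<otimes> b) \<in> F"
proof -
  obtain c where "c \<in> F" "c \<preceq> a" "c \<preceq> b" using filter_directed[OF assms] .
  moreover have "a \<in> carrier S" "b \<in> carrier S" using assms filter_closed by auto
  ultimately show ?thesis using filter_up[OF assms(1) _ sle_meetI] by simp
qed

text \<open>A filter is closed under \<open>a \<otimes> (\<iota> b \<otimes> c)\<close> because a
  common lower bound \<open>y\<close> of the three elements satisfies
  \<open>y \<otimes> (\<iota> y \<otimes> y) = y\<close>. This coset property underlies the groupoid
  laws.\<close>

lemma filter_triple:
  assumes "is_filter S F" "a \<in> F" "b \<in> F" "c \<in> F"
  shows "a \<otimes> (\<iota> b \<otimes> c) \<in> F"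
proof -
  obtain x where x: "x \<in> F" "x \<preceq> a" "x \<preceq> b" using filter_directed assms by metis
  obtain y where y: "y \<in> F" "y \<preceq> x" "y \<preceq> c" using filter_directed assms x by metis
  have S: "a \<in> carrier S" "b \<in> carrier S" "c \<in> carrier S" "x \<in> carrier S" "y \<in> carrier S"
    using assms x y filter_closed by auto
  have "y \<preceq> a" "y \<preceq> b" using x y S sle_trans by blast+
  then have "y \<otimes> (\<iota> y \<otimes> y) \<preceq> a \<otimes> (\<iota> b \<otimes> c)"
    using y S by (intro sle_mult sle_sinv) auto
  then show ?thesis using filter_up[OF assms(1) y(1)] S by simp
qed

section \<open>Product, domain and range of filters\<close>

lemma mem_fmult:
  "y \<in> A \<diamondop> B \<longleftrightarrow> y \<in> carrier S \<and> (\<exists>a\<in>A. \<exists>b\<in>B. a \<otimes> b \<preceq> y)"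
  by (auto elim!: upsetE setprodE intro: upsetI setprodI)

lemma fmultE:
  assumes "y \<in> A \<diamondop> B"
  obtains a b where "a \<in> A" "b \<in> B" "a \<otimes> b \<preceq> y" "y \<in> carrier S"
  using assms unfolding mem_fmult by blast

text \<open>Directedness replaces the two elements in \<open>\<iota> a \<otimes> b\<close> by one
  common lower bound.\<close>

lemma mem_fdom:
  assumes "is_filter S A"
  shows "y \<in> fdom A \<longleftrightarrow> y \<in> carrier S \<and> (\<exists>a\<in>A. \<iota> a \<otimes> a \<preceq> y)"
proof -
  have "\<exists>c\<in>A. \<iota> c \<otimes> c \<preceq> y" if y: "a \<in> A" "b \<in> A" "\<iota> a \<otimes> b \<preceq> y" "y \<in> carrier S" for a b
  proof -
    obtain c where c: "c \<in> A" "c \<preceq> a" "c \<preceq> b" using filter_directed[OF assms] y by metis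
    have "a \<in> carrier S" "b \<in> carrier S" using assms y filter_closed by auto
    then have "\<iota> c \<otimes> c \<preceq> \<iota> a \<otimes> b" using c by (intro sle_mult sle_sinv) auto
    then show ?thesis using c y sle_trans by blast
  qed
  then show ?thesis by (auto simp: mem_fmult)
qed

lemma sinv_sinv_image [simp]: "A \<subseteq> carrier S \<Longrightarrow> \<iota> ` \<iota> ` A = A"
  by (force simp: image_image)

lemma mem_sinv_image: "A \<subseteq> carrier S \<Longrightarrow> y \<in> \<iota> ` A \<longleftrightarrow> y \<in> carrier S \<and> \<iota> y \<in> A"
proof
  assume A: "A \<subseteq> carrier S" and "y \<in> \<iota> ` A"
  then obtain a where "a \<in> A" "y = \<iota> a" by blast
  then show "y \<in> carrier S \<and> \<iota> y \<in> A" using A by auto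
next
  assume "A \<subseteq> carrier S" "y \<in> carrier S \<and> \<iota> y \<in> A"
  then show "y \<in> \<iota> ` A" using imageI[of "\<iota> y" A \<iota>] by simp
qed

lemma filter_sinv:
  assumes A: "is_filter S A"
  shows "is_filter S (\<iota> ` A)"
proof -
  have sub: "A \<subseteq> carrier S" by (rule filter_subset[OF A])
  have zero: "\<iota> \<zero> = \<zero>" by simp
  obtain a where a: "a \<in> A" "a \<in> carrier S" using filter_nonempty[OF A] .
  show ?thesis
  proof (rule is_filterI)
    show "\<iota> a \<in> \<iota> ` A" using a by blast
    show "\<iota> ` A \<subseteq> carrier S" using sub by auto
    show "\<zero> \<notin> \<iota> ` A" unfolding mem_sinv_image[OF sub] using zero filter_zero[OF A] by metis
  next
    fix x y assume "x \<in> \<iota> ` A" "x \<preceq> y" "y \<in> carrier S"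
    then show "y \<in> \<iota> ` A" unfolding mem_sinv_image[OF sub]
      using filter_up[OF A, of "\<iota> x" "\<iota> y"] sle_sinv by simp
  next
    fix x y assume xy: "x \<in> \<iota> ` A" "y \<in> \<iota> ` A"
    then obtain c where "c \<in> A" "c \<preceq> \<iota> x" "c \<preceq> \<iota> y"
      unfolding mem_sinv_image[OF sub] using filter_directed[OF A] by metis
    then show "\<exists>c\<in>\<iota> ` A. c \<preceq> x \<and> c \<preceq> y"
      using xy sle_sinv[of c "\<iota> x"] sle_sinv[of c "\<iota> y"] unfolding mem_sinv_image[OF sub] by auto
  qed
qed

lemma mem_fran:
  assumes "is_filter S A"
  shows "y \<in> fran A \<longleftrightarrow> y \<in> carrier S \<and> (\<exists>a\<in>A. a \<otimes> \<iota> a \<preceq> y)"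
proof -
  have "A \<subseteq> carrier S" using filter_subset[OF assms] .
  moreover from this have "\<iota> (\<iota> a) = a" if "a \<in> A" for a using that by auto
  ultimately show ?thesis using mem_fdom[OF filter_sinv[OF assms]] by simp
qed

lemma dom_mem_fdom:
  assumes "is_filter S A" "a \<in> A" shows "\<iota> a \<otimes> a \<in> fdom A"
proof -
  have "a \<in> carrier S" using assms filter_closed by blast
  then have "\<iota> a \<otimes> a \<in> carrier S" "\<iota> a \<otimes> a \<preceq> \<iota> a \<otimes> a" by simp_all
  then show ?thesis unfolding mem_fdom[OF assms(1)] using assms(2) by blast
qed

lemma ran_mem_fran:
  assumes "is_filter S A" "a \<in> A" shows "a \<otimes> \<iota> a \<in> fran A"
proof -
  have "a \<in> carrier S" using assms filter_closed by blast
  then have "a \<otimes> \<iota> a \<in> carrier S" "a \<otimes> \<iota> a \<preceq> a \<otimes> \<iota> a" by simp_all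
  then show ?thesis unfolding mem_fran[OF assms(1)] using assms(2) by blast
qed

lemma filter_fdom:
  assumes A: "is_filter S A"
  shows "is_filter S (fdom A)"
proof -
  obtain a where a: "a \<in> A" "a \<in> carrier S" using filter_nonempty[OF A] .
  show ?thesis
  proof (rule is_filterI)
    show "\<iota> a \<otimes> a \<in> fdom A" by (rule dom_mem_fdom[OF A a(1)])
    show "fdom A \<subseteq> carrier S" by (auto simp: mem_fdom[OF A])
    show "\<zero> \<notin> fdom A"
      unfolding mem_fdom[OF A] using filter_zero[OF A] filter_closed[OF A] sle_zero dom_eq_zero by metis
  next
    fix x y assume "x \<in> fdom A" "x \<preceq> y" "y \<in> carrier S"
    then show "y \<in> fdom A" unfolding mem_fdom[OF A] using sle_trans by blast
  next
    fix x y assume "x \<in> fdom A" "y \<in> fdom A"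
    then obtain a b where ab: "a \<in> A" "b \<in> A" "\<iota> a \<otimes> a \<preceq> x" "\<iota> b \<otimes> b \<preceq> y" "x \<in> carrier S" "y \<in> carrier S"
      unfolding mem_fdom[OF A] by blast
    obtain c where c: "c \<in> A" "c \<preceq> a" "c \<preceq> b" using filter_directed[OF A ab(1,2)] .
    have S: "a \<in> carrier S" "b \<in> carrier S" "c \<in> carrier S" using ab c filter_closed[OF A] by auto
    have "\<iota> c \<otimes> c \<preceq> \<iota> a \<otimes> a" "\<iota> c \<otimes> c \<preceq> \<iota> b \<otimes> b"
      using c S by (auto intro!: sle_mult sle_sinv)
    then have "\<iota> c \<otimes> c \<preceq> x" "\<iota> c \<otimes> c \<preceq> y" using ab sle_trans by blast+
    moreover have "\<iota> c \<otimes> c \<in> fdom A" by (rule dom_mem_fdom[OF A c(1)])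
    ultimately show "\<exists>c\<in>fdom A. c \<preceq> x \<and> c \<preceq> y" by blast
  qed
qed

lemma fdom_sinv: "is_filter S A \<Longrightarrow> fdom (\<iota> ` A) = fran A"
  and fran_sinv: "is_filter S A \<Longrightarrow> fran (\<iota> ` A) = fdom A"
  using filter_subset by simp_all

lemma filter_fran:
  assumes A: "is_filter S A"
  shows "is_filter S (fran A)"
  using filter_fdom[OF filter_sinv[OF A]] fdom_sinv[OF A] by simp

text \<open>A filter containing one idempotent is generated by its idempotents, since everything
  below \<open>e\<close> is idempotent. Such filters turn out to be the identities of the
  groupoid.\<close>

lemma idem_filter_refine:
  assumes F: "is_filter S F" "e \<in> F" "e \<in> E" "y \<in> F"
  obtains z where "z \<in> F" "z \<in> E" "z \<preceq> y" "z \<preceq> e"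
proof -
  obtain z where "z \<in> F" "z \<preceq> y" "z \<preceq> e" using filter_directed[OF F(1) F(4) F(2)] .
  then show thesis using that sle_idem F by blast
qed

lemma sinv_idem_filter:
  assumes F: "is_filter S F" "e \<in> F" "e \<in> E"
  shows "\<iota> ` F = F"
proof -
  have "\<iota> y \<in> F" if "y \<in> F" for y
  proof -
    obtain z where z: "z \<in> F" "z \<in> E" "z \<preceq> y" "z \<preceq> e" using F \<open>y \<in> F\<close> by (rule idem_filter_refine)
    have "y \<in> carrier S" using that F filter_closed by auto
    then have "z \<preceq> \<iota> y" using sle_sinv[OF z(3)] z by simp
    then show ?thesis using filter_up[OF F(1) z(1)] \<open>y \<in> carrier S\<close> by simp
  qed
  then show ?thesis using mem_sinv_image[OF filter_subset[OF F(1)]] filter_closed[OF F(1)]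
    by (metis sinv_sinv subsetI subset_antisym)
qed

lemma fdom_idem_filter:
  assumes F: "is_filter S F" "e \<in> F" "e \<in> E"
  shows "fdom F = F"
proof (intro equalityI subsetI)
  fix y assume y: "y \<in> F"
  obtain z where z: "z \<in> F" "z \<in> E" "z \<preceq> y" "z \<preceq> e" using idem_filter_refine[OF F y] .
  have "y \<in> carrier S" using y F filter_closed by auto
  moreover have "\<iota> z \<otimes> z \<preceq> y" using z by simp
  ultimately show "y \<in> fdom F" unfolding mem_fdom[OF F(1)] using z by blast
next
  fix y assume "y \<in> fdom F"
  then obtain a where a: "a \<in> F" "\<iota> a \<otimes> a \<preceq> y" "y \<in> carrier S" unfolding mem_fdom[OF F(1)] by blast
  obtain z where z: "z \<in> F" "z \<in> E" "z \<preceq> a" "z \<preceq> e" using idem_filter_refine[OF F a(1)] .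
  have aS: "a \<in> carrier S" using a F filter_closed by auto
  have "\<iota> z \<otimes> z \<preceq> \<iota> a \<otimes> a" using z aS by (intro sle_mult sle_sinv) auto
  then have "z \<preceq> \<iota> a \<otimes> a" using z(2) by simp
  then have "z \<preceq> y" using a sle_trans by blast
  then show "y \<in> F" using filter_up[OF F(1) z(1)] a by simp
qed

lemma fran_idem_filter:
  assumes F: "is_filter S F" "e \<in> F" "e \<in> E"
  shows "fran F = F"
  using fdom_idem_filter[OF F] fdom_sinv[OF F(1)] sinv_idem_filter[OF F] by simp

lemma fdom_fran_simps:
  assumes A: "is_filter S A"
  shows "fdom (fdom A) = fdom A" "fran (fdom A) = fdom A" "fdom (fran A) = fran A" "fran (fran A) = fran A"
proof -
  obtain a where a: "a \<in> A" "a \<in> carrier S" using filter_nonempty[OF A] .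
  show "fdom (fdom A) = fdom A" "fran (fdom A) = fdom A"
    using fdom_idem_filter[OF filter_fdom[OF A] dom_mem_fdom[OF A a(1)]]
      fran_idem_filter[OF filter_fdom[OF A] dom_mem_fdom[OF A a(1)]] a by simp_all
  show "fdom (fran A) = fran A" "fran (fran A) = fran A"
    using fdom_idem_filter[OF filter_fran[OF A] ran_mem_fran[OF A a(1)]]
      fran_idem_filter[OF filter_fran[OF A] ran_mem_fran[OF A a(1)]] a by simp_all
qed

lemma fmult_assoc:
  assumes "A \<subseteq> carrier S" "B \<subseteq> carrier S" "C \<subseteq> carrier S"
  shows "(A \<diamondop> B) \<diamondop> C = A \<diamondop> (B \<diamondop> C)"
proof (intro equalityI subsetI)
  fix y assume "y \<in> (A \<diamondop> B) \<diamondop> C"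
  then obtain a b c x where *: "a \<in> A" "b \<in> B" "c \<in> C" "a \<otimes> b \<preceq> x" "x \<otimes> c \<preceq> y" "x \<in> carrier S" "y \<in> carrier S"
    by (auto elim!: fmultE)
  then have S: "a \<in> carrier S" "b \<in> carrier S" "c \<in> carrier S" using assms by auto
  have "(a \<otimes> b) \<otimes> c \<preceq> x \<otimes> c" using * S by (intro sle_mult) auto
  then have "a \<otimes> (b \<otimes> c) \<preceq> y" using * S sle_trans by simp
  moreover have "b \<otimes> c \<in> B \<diamondop> C" unfolding mem_fmult using * S by force
  ultimately show "y \<in> A \<diamondop> (B \<diamondop> C)" unfolding mem_fmult[of y] using * by blast
next
  fix y assume "y \<in> A \<diamondop> (B \<diamondop> C)"
  then obtain a b c x where *: "a \<in> A" "b \<in> B" "c \<in> C" "b \<otimes> c \<preceq> x" "a \<otimes> x \<preceq> y" "x \<in> carrier S" "y \<in> carrier S"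
    by (auto elim!: fmultE)
  then have S: "a \<in> carrier S" "b \<in> carrier S" "c \<in> carrier S" using assms by auto
  have "a \<otimes> (b \<otimes> c) \<preceq> a \<otimes> x" using * S by (intro sle_mult) auto
  then have "(a \<otimes> b) \<otimes> c \<preceq> y" using * S sle_trans by simp
  moreover have "a \<otimes> b \<in> A \<diamondop> B" unfolding mem_fmult using * S by force
  ultimately show "y \<in> (A \<diamondop> B) \<diamondop> C" unfolding mem_fmult[of y] using * by blast
qed

text \<open>That the product is no larger than \<open>A\<close> is the closure of filters under
  triple products; the converse uses
  \<open>y \<otimes> (\<iota> y \<otimes> y) \<preceq> y\<close>.\<close>

lemma fmult_fdom:
  assumes A: "is_filter S A"
  shows "A \<diamondop> fdom A = A"
proof (intro equalityI subsetI)
  fix y assume "y \<in> A \<diamondop> fdom A"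
  then obtain a x where *: "a \<in> A" "x \<in> fdom A" "a \<otimes> x \<preceq> y" "y \<in> carrier S"
    unfolding mem_fmult[of y] by blast
  then obtain c where c: "c \<in> A" "\<iota> c \<otimes> c \<preceq> x" "x \<in> carrier S" unfolding mem_fdom[OF A] by blast
  have S: "a \<in> carrier S" "c \<in> carrier S" using * c filter_closed[OF A] by auto
  have "a \<otimes> (\<iota> c \<otimes> c) \<preceq> a \<otimes> x" using c S by (intro sle_mult) auto
  then have "a \<otimes> (\<iota> c \<otimes> c) \<preceq> y" using * sle_trans by blast
  then show "y \<in> A" using filter_up[OF A filter_triple[OF A, of a c c]] * c by blast
next
  fix y assume y: "y \<in> A"
  then have "y \<otimes> (\<iota> y \<otimes> y) \<preceq> y" using filter_closed[OF A] by simp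
  then show "y \<in> A \<diamondop> fdom A" unfolding mem_fmult[of y] using y filter_closed[OF A] dom_mem_fdom[OF A y] by blast
qed

lemma sinv_fmult:
  assumes "A \<subseteq> carrier S" "B \<subseteq> carrier S"
  shows "\<iota> ` (A \<diamondop> B) = (\<iota> ` B) \<diamondop> (\<iota> ` A)"
proof (rule Set.set_eqI)
  fix y
  have "y \<in> \<iota> ` (A \<diamondop> B) \<longleftrightarrow> y \<in> carrier S \<and> (\<exists>a\<in>A. \<exists>b\<in>B. a \<otimes> b \<preceq> \<iota> y)"
  proof -
    have sub: "A \<diamondop> B \<subseteq> carrier S" by (auto simp: mem_fmult)
    show ?thesis unfolding mem_sinv_image[OF sub] mem_fmult by auto
  qed
  also have "\<dots> \<longleftrightarrow> y \<in> carrier S \<and> (\<exists>a\<in>A. \<exists>b\<in>B. \<iota> b \<otimes> \<iota> a \<preceq> y)"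
  proof -
    have "a \<otimes> b \<preceq> \<iota> y \<longleftrightarrow> \<iota> b \<otimes> \<iota> a \<preceq> y" if "a \<in> A" "b \<in> B" "y \<in> carrier S" for a b
    proof -
      have "a \<in> carrier S" "b \<in> carrier S" using that assms by auto
      then show ?thesis using sle_sinv_iff[of "a \<otimes> b" "\<iota> y"] that by simp
    qed
    then show ?thesis by blast
  qed
  also have "\<dots> \<longleftrightarrow> y \<in> (\<iota> ` B) \<diamondop> (\<iota> ` A)" unfolding mem_fmult by blast
  finally show "y \<in> \<iota> ` (A \<diamondop> B) \<longleftrightarrow> y \<in> (\<iota> ` B) \<diamondop> (\<iota> ` A)" .
qed

text \<open>Inversion reverses products and exchanges domain with range, so this is the mirror image
  of \<open>fmult_fdom\<close>.\<close>

lemma fran_fmult: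
  assumes A: "is_filter S A"
  shows "fran A \<diamondop> A = A"
proof -
  have sub: "A \<subseteq> carrier S" "fran A \<subseteq> carrier S"
    using filter_subset[OF A] filter_subset[OF filter_fran[OF A]] .
  obtain a where a: "a \<in> A" "a \<in> carrier S" using filter_nonempty[OF A] .
  have "\<iota> ` fran A = fran A"
    using sinv_idem_filter[OF filter_fran[OF A] ran_mem_fran[OF A a(1)]] a by simp
  then have "\<iota> ` (fran A \<diamondop> A) = (\<iota> ` A) \<diamondop> fdom (\<iota> ` A)"
    using sinv_fmult[OF sub(2,1)] sub by simp
  also have "\<dots> = \<iota> ` A" by (rule fmult_fdom[OF filter_sinv[OF A]])
  finally have "\<iota> ` \<iota> ` (fran A \<diamondop> A) = \<iota> ` \<iota> ` A" by simp
  moreover have "fran A \<diamondop> A \<subseteq> carrier S" by (auto simp: mem_fmult)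
  ultimately show ?thesis using sub by simp
qed

text \<open>Composability allows \<open>b\<close> to be shrunk until its range lies under the domain
  of \<open>a\<close>. Left multiplication by \<open>a\<close> can then be undone, which keeps
  products away from zero and preserves domains.\<close>

lemma composable_refine:
  assumes A: "is_filter S A" and B: "is_filter S B" and AB: "fdom A = fran B" and ab: "a \<in> A" "b \<in> B"
  obtains c where "c \<in> B" "c \<preceq> b" "c \<otimes> \<iota> c \<preceq> \<iota> a \<otimes> a" "\<iota> a \<otimes> (a \<otimes> c) = c"
proof -
  have "\<iota> a \<otimes> a \<in> fran B" using dom_mem_fdom[OF A ab(1)] AB by simp
  then obtain x where x: "x \<in> B" "x \<otimes> \<iota> x \<preceq> \<iota> a \<otimes> a" unfolding mem_fran[OF B] by blast
  obtain c where c: "c \<in> B" "c \<preceq> b" "c \<preceq> x" using filter_directed[OF B ab(2) x(1)] .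
  have S: "a \<in> carrier S" "b \<in> carrier S" "c \<in> carrier S" "x \<in> carrier S"
    using ab c x filter_closed A B by auto
  have "c \<otimes> \<iota> c \<preceq> x \<otimes> \<iota> x" using c S by (intro sle_mult sle_sinv) auto
  then have le: "c \<otimes> \<iota> c \<preceq> \<iota> a \<otimes> a" using sle_trans[OF _ x(2)] S by simp
  then have *: "c \<otimes> \<iota> c = (\<iota> a \<otimes> a) \<otimes> (c \<otimes> \<iota> c)"
    using S sle_right_iff[of "c \<otimes> \<iota> c" "\<iota> a \<otimes> a"] by simp
  have "c = c \<otimes> \<iota> c \<otimes> c" using S by simp
  also have "\<dots> = (\<iota> a \<otimes> a) \<otimes> (c \<otimes> \<iota> c) \<otimes> c" using * by simp
  also have "\<dots> = \<iota> a \<otimes> (a \<otimes> c)" using S by simp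
  finally show thesis using that c le by simp
qed

lemma filter_fmult:
  assumes A: "is_filter S A" and B: "is_filter S B" and AB: "fdom A = fran B"
  shows "is_filter S (A \<diamondop> B)"
proof -
  obtain a b where ab: "a \<in> A" "b \<in> B" "a \<in> carrier S" "b \<in> carrier S"
    using filter_nonempty A B by metis
  show ?thesis
  proof (rule is_filterI)
    show "a \<otimes> b \<in> A \<diamondop> B" unfolding mem_fmult using ab by force
    show "A \<diamondop> B \<subseteq> carrier S" by (auto simp: mem_fmult)
    show "\<zero> \<notin> A \<diamondop> B"
    proof
      assume "\<zero> \<in> A \<diamondop> B"
      then obtain a b where ab: "a \<in> A" "b \<in> B" "a \<otimes> b = \<zero>" unfolding mem_fmult using sle_zero by blast
      \<comment> \<open>Below a vanishing product the shrunk element would satisfy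
        \<open>c = \<iota> a \<otimes> (a \<otimes> c) = \<zero>\<close>.\<close>
      obtain c where c: "c \<in> B" "c \<preceq> b" "\<iota> a \<otimes> (a \<otimes> c) = c" using composable_refine[OF A B AB ab(1,2)] .
      have S: "a \<in> carrier S" "b \<in> carrier S" "c \<in> carrier S" using ab c filter_closed A B by auto
      have "a \<otimes> c \<preceq> a \<otimes> b" using c S by (intro sle_mult) auto
      then have "a \<otimes> c = \<zero>" using ab sle_zero by simp
      then have "c = \<zero>" using c S by simp
      then show False using c filter_zero[OF B] by simp
    qed
  next
    fix x y assume "x \<in> A \<diamondop> B" "x \<preceq> y" "y \<in> carrier S"
    then show "y \<in> A \<diamondop> B" unfolding mem_fmult using sle_trans by blast
  next
    fix x y assume "x \<in> A \<diamondop> B" "y \<in> A \<diamondop> B"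
    then obtain a b a' b' where *: "a \<in> A" "b \<in> B" "a \<otimes> b \<preceq> x" "a' \<in> A" "b' \<in> B" "a' \<otimes> b' \<preceq> y"
        "x \<in> carrier S" "y \<in> carrier S"
      unfolding mem_fmult by blast
    obtain a'' where a'': "a'' \<in> A" "a'' \<preceq> a" "a'' \<preceq> a'" using filter_directed[OF A] * by metis
    obtain b'' where b'': "b'' \<in> B" "b'' \<preceq> b" "b'' \<preceq> b'" using filter_directed[OF B] * by metis
    have S: "a \<in> carrier S" "b \<in> carrier S" "a' \<in> carrier S" "b' \<in> carrier S"
      "a'' \<in> carrier S" "b'' \<in> carrier S"
      using * a'' b'' filter_closed A B by auto
    have "a'' \<otimes> b'' \<preceq> a \<otimes> b" "a'' \<otimes> b'' \<preceq> a' \<otimes> b'"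
      using a'' b'' S by (auto intro!: sle_mult)
    then have "a'' \<otimes> b'' \<preceq> x" "a'' \<otimes> b'' \<preceq> y" using * sle_trans by blast+
    moreover have "a'' \<otimes> b'' \<in> A \<diamondop> B" unfolding mem_fmult using a'' b'' S by force
    ultimately show "\<exists>c\<in>A \<diamondop> B. c \<preceq> x \<and> c \<preceq> y" by blast
  qed
qed

text \<open>For an element \<open>c\<close> as in \<open>composable_refine\<close>, the product
  \<open>a \<otimes> c\<close> has the same domain idempotent as \<open>c\<close>. The other
  inclusion is \<open>dom_mult_sle\<close>.\<close>

lemma fdom_fmult:
  assumes A: "is_filter S A" and B: "is_filter S B" and AB: "fdom A = fran B"
  shows "fdom (A \<diamondop> B) = fdom B"
proof (intro equalityI subsetI)
  fix y assume "y \<in> fdom (A \<diamondop> B)"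
  then obtain x where x: "x \<in> A \<diamondop> B" "\<iota> x \<otimes> x \<preceq> y" and y: "y \<in> carrier S"
    unfolding mem_fdom[OF filter_fmult[OF A B AB]] by blast
  then obtain a b where ab: "a \<in> A" "b \<in> B" "a \<otimes> b \<preceq> x" "x \<in> carrier S" unfolding mem_fmult by blast
  obtain c where c: "c \<in> B" "c \<preceq> b" "\<iota> a \<otimes> (a \<otimes> c) = c" using composable_refine[OF A B AB ab(1,2)] .
  have S: "a \<in> carrier S" "b \<in> carrier S" "c \<in> carrier S" using ab c filter_closed A B by auto
  have "a \<otimes> c \<preceq> a \<otimes> b" using c S by (intro sle_mult) auto
  then have le: "a \<otimes> c \<preceq> x" using ab sle_trans by blast
  have "\<iota> (a \<otimes> c) \<otimes> (a \<otimes> c) \<preceq> \<iota> x \<otimes> x" by (rule sle_mult[OF sle_sinv[OF le] le]) (use ab in auto)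
  moreover have "\<iota> (a \<otimes> c) \<otimes> (a \<otimes> c) = \<iota> c \<otimes> c" using c S by simp
  ultimately have "\<iota> c \<otimes> c \<preceq> y" using x y sle_trans by metis
  then show "y \<in> fdom B" unfolding mem_fdom[OF B] using c y by blast
next
  fix y assume "y \<in> fdom B"
  then obtain b where b: "b \<in> B" "\<iota> b \<otimes> b \<preceq> y" and y: "y \<in> carrier S"
    unfolding mem_fdom[OF B] by blast
  obtain a where a: "a \<in> A" "a \<in> carrier S" using filter_nonempty[OF A] .
  have "b \<in> carrier S" using b filter_closed B by auto
  then have "\<iota> (a \<otimes> b) \<otimes> (a \<otimes> b) \<preceq> y" using dom_mult_sle[of a b] b y a sle_trans by blast
  moreover have "a \<otimes> b \<in> A \<diamondop> B" unfolding mem_fmult using a b \<open>b \<in> carrier S\<close> by force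
  ultimately show "y \<in> fdom (A \<diamondop> B)" unfolding mem_fdom[OF filter_fmult[OF A B AB]] using y by blast
qed

lemma fran_fmult':
  assumes A: "is_filter S A" and B: "is_filter S B" and AB: "fdom A = fran B"
  shows "fran (A \<diamondop> B) = fran A"
proof -
  have "fdom (\<iota> ` B) = fran (\<iota> ` A)" using A B AB fdom_sinv fran_sinv by simp
  from fdom_fmult[OF filter_sinv[OF B] filter_sinv[OF A] this]
  show ?thesis
    using sinv_fmult[OF filter_subset[OF A] filter_subset[OF B]] fdom_sinv[OF A]
      fdom_sinv[OF filter_fmult[OF A B AB]] by simp
qed

text \<open>Once \<open>a\<close> and \<open>b\<close> are fixed, an element \<open>c\<close> below
  \<open>a \<otimes> b\<close> is decided by its domain, and domains of the product are domains of
  \<open>B\<close>. In the continuity proof, conditions on the product thereby become conditions on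
  the right factor alone.\<close>

lemma mem_fmult_iff_below:
  assumes A: "is_filter S A" and B: "is_filter S B" and AB: "fdom A = fran B"
    and ab: "a \<in> A" "b \<in> B" and c: "c \<preceq> a \<otimes> b"
  shows "c \<in> A \<diamondop> B \<longleftrightarrow> b \<otimes> (\<iota> c \<otimes> c) \<in> B"
proof
  have S: "a \<in> carrier S" "b \<in> carrier S" using ab filter_closed A B by auto
  then have cS: "c \<in> carrier S" using c sle_closed by auto
  {
    assume "c \<in> A \<diamondop> B"
    then have "\<iota> c \<otimes> c \<in> fdom B"
      using dom_mem_fdom[OF filter_fmult[OF A B AB]] fdom_fmult[OF A B AB] by blast
    then have "b \<otimes> (\<iota> c \<otimes> c) \<in> B \<diamondop> fdom B" unfolding mem_fmult[of _ B] using ab S cS by force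
    then show "b \<otimes> (\<iota> c \<otimes> c) \<in> B" using fmult_fdom[OF B] by simp
  next
    assume "b \<otimes> (\<iota> c \<otimes> c) \<in> B"
    moreover have "a \<otimes> (b \<otimes> (\<iota> c \<otimes> c)) \<preceq> c"
      using c S cS sle_right_iff[of c "a \<otimes> b"] by simp
    ultimately show "c \<in> A \<diamondop> B" unfolding mem_fmult using ab cS by blast
  }
qed

text \<open>The upward closure of \<open>b\<close> times \<open>F\<close> is the required filter.
  The lemma makes the domain map carry \<open>U_set S b\<close> onto the set of filters containing
  \<open>\<iota> b \<otimes> b\<close>.\<close>

lemma filter_with_dom:
  assumes F: "is_filter S F" and b: "b \<in> carrier S" "\<iota> b \<otimes> b \<in> F"
  obtains A where "is_filter S A" "b \<in> A" "fdom A = F"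
proof -
  define A where "A = {b} \<diamondop> F"
  \<comment> \<open>The right factor can be taken idempotent and below
    \<open>\<iota> b \<otimes> b\<close>.\<close>
  have mem: "y \<in> A \<longleftrightarrow> y \<in> carrier S \<and> (\<exists>z\<in>F. z \<in> E \<and> z \<preceq> \<iota> b \<otimes> b \<and> b \<otimes> z \<preceq> y)" for y
  proof -
    have "\<exists>z\<in>F. z \<in> E \<and> z \<preceq> \<iota> b \<otimes> b \<and> b \<otimes> z \<preceq> y" if x: "x \<in> F" "b \<otimes> x \<preceq> y" "y \<in> carrier S" for x
    proof -
      have xS: "x \<in> carrier S" using x filter_closed[OF F] by auto
      obtain z where z: "z \<in> F" "z \<in> E" "z \<preceq> x" "z \<preceq> \<iota> b \<otimes> b"
        using idem_filter_refine[OF F b(2) _ x(1)] b by auto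
      have "b \<otimes> z \<preceq> b \<otimes> x" using z b xS by (intro sle_mult) auto
      then have "b \<otimes> z \<preceq> y" using x sle_trans by blast
      then show ?thesis using z by blast
    qed
    then show ?thesis unfolding A_def mem_fmult by blast
  qed
  \<comment> \<open>Such a \<open>z\<close> is recovered from \<open>b \<otimes> z\<close> as its
    domain idempotent; this yields both properness of \<open>A\<close> and its domain.\<close>
  have dom: "\<iota> (b \<otimes> z) \<otimes> (b \<otimes> z) = z" if z: "z \<in> E" "z \<preceq> \<iota> b \<otimes> b" for z
  proof -
    have "z = (\<iota> b \<otimes> b) \<otimes> z" using sle_right_iff[of z "\<iota> b \<otimes> b"] z b by simp
    then have *: "\<iota> b \<otimes> (b \<otimes> z) = z" using z b by simp
    show ?thesis using z b * by simp
  qed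
  have A: "is_filter S A"
  proof (rule is_filterI)
    show "A \<subseteq> carrier S" using mem by blast
    have "b \<otimes> (\<iota> b \<otimes> b) \<preceq> b" using b by simp
    then show "b \<in> A" unfolding A_def mem_fmult using b by blast
    show "\<zero> \<notin> A"
    proof
      assume "\<zero> \<in> A"
      then obtain z where z: "z \<in> F" "z \<in> E" "z \<preceq> \<iota> b \<otimes> b" "b \<otimes> z = \<zero>"
        unfolding mem using sle_zero by blast
      then have "z = \<zero>" using dom[OF z(2,3)] by simp
      then show False using z filter_zero[OF F] by simp
    qed
  next
    fix x y assume "x \<in> A" "x \<preceq> y" "y \<in> carrier S"
    then show "y \<in> A" unfolding mem using sle_trans by blast
  next
    fix x y assume "x \<in> A" "y \<in> A"
    then obtain u v where *: "u \<in> F" "v \<in> F" "b \<otimes> u \<preceq> x" "b \<otimes> v \<preceq> y" "x \<in> carrier S" "y \<in> carrier S"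
      unfolding mem by blast
    obtain w where w: "w \<in> F" "w \<preceq> u" "w \<preceq> v" using filter_directed[OF F *(1,2)] .
    have S: "u \<in> carrier S" "v \<in> carrier S" "w \<in> carrier S" using * w filter_closed[OF F] by auto
    have "b \<otimes> w \<preceq> b \<otimes> u" "b \<otimes> w \<preceq> b \<otimes> v" using w b S by (auto intro!: sle_mult)
    then have "b \<otimes> w \<preceq> x" "b \<otimes> w \<preceq> y" using * sle_trans by blast+
    moreover have "b \<otimes> w \<in> A" unfolding A_def mem_fmult using w b S by force
    ultimately show "\<exists>c\<in>A. c \<preceq> x \<and> c \<preceq> y" by blast
  qed
  have "fdom A = F"
  proof (intro equalityI subsetI)
    fix y assume "y \<in> fdom A"
    then obtain a where a: "a \<in> A" "\<iota> a \<otimes> a \<preceq> y" "y \<in> carrier S" unfolding mem_fdom[OF A] by blast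
    then obtain z where z: "z \<in> F" "z \<in> E" "z \<preceq> \<iota> b \<otimes> b" "b \<otimes> z \<preceq> a" "a \<in> carrier S" unfolding mem by blast
    have "\<iota> (b \<otimes> z) \<otimes> (b \<otimes> z) \<preceq> \<iota> a \<otimes> a" by (rule sle_mult[OF sle_sinv[OF z(4)] z(4)]) (use z in auto)
    then have "z \<preceq> y" using dom[OF z(2,3)] a sle_trans by metis
    then show "y \<in> F" using filter_up[OF F z(1)] a by blast
  next
    fix y assume y: "y \<in> F"
    obtain z where z: "z \<in> F" "z \<in> E" "z \<preceq> y" "z \<preceq> \<iota> b \<otimes> b"
      using idem_filter_refine[OF F b(2) _ y] b by auto
    have "b \<otimes> z \<preceq> b \<otimes> z" using b z by simp
    moreover have "b \<otimes> z \<in> carrier S" using b z by simp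
    ultimately have "b \<otimes> z \<in> A" unfolding mem using z b by blast
    then show "y \<in> fdom A" unfolding mem_fdom[OF A] using dom[OF z(2,4)] z y filter_closed[OF F] by metis
  qed
  moreover have "b \<otimes> (\<iota> b \<otimes> b) \<preceq> b" using b by simp
  then have "b \<in> A" unfolding A_def mem_fmult using b by blast
  ultimately show thesis using that A by blast
qed

text \<open>Members of \<open>A\<close> below \<open>a\<close> are restrictions of \<open>a\<close>
  to domain idempotents of \<open>A\<close>, so one common member and a common domain determine a
  filter. This is injectivity of the domain map on \<open>U_set S a\<close>.\<close>

lemma filter_eq_if_fdom:
  assumes A: "is_filter S A" and B: "is_filter S B" and "a \<in> A" "a \<in> B" "fdom A = fdom B"
  shows "A = B"
proof -
  have "A \<subseteq> B" if A: "is_filter S A" and B: "is_filter S B" and "a \<in> A" "a \<in> B" "fdom A = fdom B" for A B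
  proof
    fix x assume x: "x \<in> A"
    obtain c where c: "c \<in> A" "c \<preceq> a" "c \<preceq> x" using filter_directed[OF A \<open>a \<in> A\<close> x] .
    have S: "a \<in> carrier S" "c \<in> carrier S" "x \<in> carrier S" using that x c filter_closed[OF A] by auto
    have "\<iota> c \<otimes> c \<in> fdom B" using dom_mem_fdom[OF A c(1)] that by simp
    then have "a \<otimes> (\<iota> c \<otimes> c) \<in> B \<diamondop> fdom B" unfolding mem_fmult[of _ B] using that S by force
    then have "c \<in> B" using fmult_fdom[OF B] c S sle_right_iff[of c a] by simp
    then show "x \<in> B" using filter_up[OF B] c S by blast
  qed
  then show ?thesis using assms by blast
qed

text \<open>Since \<open>c\<close> is \<open>a\<close> restricted to the domain of \<open>c\<close>,
  it belongs to \<open>A\<close> as soon as that domain belongs to \<open>fdom A\<close>. Excluded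
  elements of a basic open set are transferred to the unit space in this way.\<close>

lemma mem_iff_dom_mem_fdom:
  assumes A: "is_filter S A" and a: "a \<in> A" "c \<preceq> a"
  shows "c \<in> A \<longleftrightarrow> \<iota> c \<otimes> c \<in> fdom A"
proof
  assume "\<iota> c \<otimes> c \<in> fdom A"
  moreover have S: "a \<in> carrier S" "c \<in> carrier S" using a filter_closed[OF A] sle_closed by auto
  ultimately have "a \<otimes> (\<iota> c \<otimes> c) \<in> A \<diamondop> fdom A" unfolding mem_fmult[of _ A] using a by force
  then show "c \<in> A" using fmult_fdom[OF A] a S sle_right_iff[of c a] by simp
qed (rule dom_mem_fdom[OF A])

lemma carrier_universal [simp]: "carrier (G\<^sub>u S) = {F. is_filter S F}"
  and gdom_universal [simp]: "gdom (G\<^sub>u S) A = fdom A"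
  and gran_universal [simp]: "gran (G\<^sub>u S) A = fran A"
  and gcomp_universal [simp]: "gcomp (G\<^sub>u S) A B = A \<diamondop> B"
  by (simp_all add: universal_groupoid_def filter_groupoid_def)

lemma is_ginverse_universal:
  assumes A: "is_filter S A"
  shows "is_ginverse (G\<^sub>u S) A (\<iota> ` A)"
  using filter_sinv[OF A] fdom_sinv[OF A] fran_sinv[OF A] by (simp add: is_ginverse_def)

lemma groupoid_universal: "groupoid (G\<^sub>u S)"
proof (unfold_locales; (unfold composable_pairs_iff)?, simp_all)
qed (auto simp: filter_fdom filter_fran fdom_fran_simps filter_fmult fdom_fmult fran_fmult' fmult_assoc
    filter_subset fmult_fdom fran_fmult intro: is_ginverse_universal)

lemma ginv_universal: "is_filter S A \<Longrightarrow> ginv (G\<^sub>u S) A = \<iota> ` A"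
  by (rule groupoid.ginv_eqI[OF groupoid_universal _ is_ginverse_universal]) auto

end

section \<open>The patch topology\<close>

text \<open>The topology is written as \<open>Alexander_subbase\<close> expects it, so that the
  compactness proof can work with it directly.\<close>

lemma subbase_openin:
  assumes "B \<in> \<B>" "B \<subseteq> U"
  shows "openin (topology (arbitrary union_of (finite intersection_of (\<lambda>x. x \<in> \<B>) relative_to U))) B"
proof -
  have "(finite intersection_of (\<lambda>x. x \<in> \<B>)) B" using assms(1) by (intro finite_intersection_of_inc)
  then have "(finite intersection_of (\<lambda>x. x \<in> \<B>) relative_to U) (U \<inter> B)" by (rule relative_to_inc)
  moreover have "U \<inter> B = B" using assms by blast
  ultimately show ?thesis unfolding openin_subbase by (metis arbitrary_union_of_inc)
qed

context inverse_semigroup_with_zero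
begin

section \<open>A neighbourhood base of the patch topology\<close>

definition basic_open :: "'a \<Rightarrow> 'a set \<Rightarrow> 'a set set" where
  "basic_open x X = U_set S x - (\<Union>y\<in>X. U_set S y)"

abbreviation patch :: "'a set topology" where "patch \<equiv> gtop (G\<^sub>u S)"

lemma patch_eq:
  "patch = topology_generated_by {basic_open x X | x X. x \<in> carrier S \<and> finite X \<and> X \<subseteq> downset S {x}}"
  by (simp add: universal_groupoid_def filter_groupoid_def basic_open_def)

lemma mem_basic_open: "F \<in> basic_open x X \<longleftrightarrow> is_filter S F \<and> x \<in> F \<and> X \<inter> F = {}"
  by (auto simp: U_set_def basic_open_def)

lemma basic_open_empty [simp]: "basic_open x {} = U_set S x"
  by (simp add: basic_open_def)

lemma topspace_patch: "topspace patch = {F. is_filter S F}"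
proof
  show "topspace patch \<subseteq> {F. is_filter S F}" unfolding patch_eq by (auto simp: mem_basic_open)
  show "{F. is_filter S F} \<subseteq> topspace patch"
  proof
    fix F assume "F \<in> {F. is_filter S F}"
    then have F: "is_filter S F" by simp
    obtain a where a: "a \<in> F" "a \<in> carrier S" using filter_nonempty[OF F] .
    then have "F \<in> basic_open a {}" using F by (simp add: U_set_def)
    then show "F \<in> topspace patch" unfolding patch_eq topology_generated_by_topspace using a by blast
  qed
qed

lemma openin_basic_open: "x \<in> carrier S \<Longrightarrow> finite X \<Longrightarrow> X \<subseteq> downset S {x} \<Longrightarrow> openin patch (basic_open x X)"
  unfolding patch_eq by (rule topology_generated_by_Basis) blast

lemma openin_U_set: "x \<in> carrier S \<Longrightarrow> openin patch (U_set S x)"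
  using openin_basic_open[of x "{}"] by simp

lemma downset_singletonD: "X \<subseteq> downset S {x} \<Longrightarrow> y \<in> X \<Longrightarrow> y \<preceq> x \<and> y \<in> carrier S"
  by (auto elim!: downsetE dest!: subsetD)

lemma downset_singletonI: "(\<And>y. y \<in> X \<Longrightarrow> y \<preceq> x \<and> y \<in> carrier S) \<Longrightarrow> X \<subseteq> downset S {x}"
  by (auto intro: downsetI)

text \<open>Both \<open>z\<close> and each removed \<open>u\<close> lie below \<open>x\<close>, so
  they are compatible. A filter containing \<open>z\<close> contains \<open>u\<close> exactly when
  it contains their meet, which lies below the new centre \<open>z\<close>.\<close>

lemma basic_open_shrink:
  assumes x: "x \<in> carrier S" and X: "finite X" "X \<subseteq> downset S {x}"
    and F: "F \<in> basic_open x X" and z: "z \<in> F" "z \<preceq> x"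
  obtains Z where "finite Z" "Z \<subseteq> downset S {z}" "F \<in> basic_open z Z" "basic_open z Z \<subseteq> basic_open x X"
proof
  define Z where "Z = (\<lambda>u. z \<otimes> (\<iota> u \<otimes> u)) ` X"
  have XS: "u \<in> carrier S" "u \<preceq> x" if "u \<in> X" for u using downset_singletonD[OF X(2) that] by auto
  have zS: "z \<in> carrier S" using z(2) x sle_closed by blast
  have comp: "compatible S z u" if "u \<in> X" for u
    using compatible_bounded[OF z(2) XS(2)[OF that] x] .
  show "finite Z" using X unfolding Z_def by simp
  show "Z \<subseteq> downset S {z}"
    using zS XS compatible_meet_sle1[OF comp] unfolding Z_def by (auto intro: downset_singletonI downsetI)
  have "u \<in> F'" if "is_filter S F'" "z \<otimes> (\<iota> u \<otimes> u) \<in> F'" "u \<in> X" for F' u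
    using filter_up[OF that(1,2) compatible_meet_sle2[OF comp[OF that(3)] zS XS(1)[OF that(3)]]] XS that by blast
  then show "F \<in> basic_open z Z" using F z unfolding mem_basic_open Z_def by blast
  show "basic_open z Z \<subseteq> basic_open x X"
  proof
    fix F' assume "F' \<in> basic_open z Z"
    then have F': "is_filter S F'" "z \<in> F'" "Z \<inter> F' = {}" unfolding mem_basic_open by auto
    then have "x \<in> F'" using filter_up z x by blast
    moreover have "u \<notin> F'" if "u \<in> X" for u
      using filter_meet[OF F'(1,2), of u] F' that unfolding Z_def by blast
    ultimately show "F' \<in> basic_open x X" unfolding mem_basic_open using F' by blast
  qed
qed

lemma basic_open_Int: "basic_open z Z \<inter> basic_open z Z' = basic_open z (Z \<union> Z')"
  by (auto simp: basic_open_def)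

text \<open>For intersections, the two centres have a common lower bound in the filter, and both
  sets are recentred there before their exclusions are united. The clause
  \<open>x \<preceq> a\<close> lets the compactness proof stay inside one
  \<open>U_set\<close>.\<close>

lemma patch_nbhd:
  assumes "openin patch V" "F \<in> V" "a \<in> F"
  obtains x X where "x \<in> F" "x \<in> carrier S" "x \<preceq> a" "finite X" "X \<subseteq> downset S {x}"
    "F \<in> basic_open x X" "basic_open x X \<subseteq> V"
proof -
  define P where "P = (\<lambda>V. \<forall>F\<in>V. \<forall>a\<in>F. \<exists>x X. x \<in> carrier S \<and> x \<preceq> a \<and> finite X \<and> X \<subseteq> downset S {x} \<and>
     F \<in> basic_open x X \<and> basic_open x X \<subseteq> V)"
  have "generate_topology_on {basic_open x X | x X. x \<in> carrier S \<and> finite X \<and> X \<subseteq> downset S {x}} V"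
    using assms(1) unfolding patch_eq openin_topology_generated_by_iff .
  then have "P V"
  proof induction
    case Empty
    then show ?case by (simp add: P_def)
  next
    case (Int V V')
    show ?case unfolding P_def
    proof (intro ballI)
      fix F a assume F: "F \<in> V \<inter> V'" and a: "a \<in> F"
      obtain x X where x: "x \<in> carrier S" "x \<preceq> a" "finite X" "X \<subseteq> downset S {x}"
          "F \<in> basic_open x X" "basic_open x X \<subseteq> V"
        using Int.IH(1) F a unfolding P_def by blast
      obtain y Y where y: "y \<in> carrier S" "y \<preceq> a" "finite Y" "Y \<subseteq> downset S {y}"
          "F \<in> basic_open y Y" "basic_open y Y \<subseteq> V'"
        using Int.IH(2) F a unfolding P_def by blast
      have Ff: "is_filter S F" "x \<in> F" "y \<in> F" using x(5) y(5) unfolding mem_basic_open by auto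
      obtain z where z: "z \<in> F" "z \<preceq> x" "z \<preceq> y" using filter_directed[OF Ff] .
      obtain Z where Z: "finite Z" "Z \<subseteq> downset S {z}" "F \<in> basic_open z Z" "basic_open z Z \<subseteq> basic_open x X"
        using basic_open_shrink[OF x(1,3,4,5) z(1,2)] .
      obtain Z' where Z': "finite Z'" "Z' \<subseteq> downset S {z}" "F \<in> basic_open z Z'" "basic_open z Z' \<subseteq> basic_open y Y"
        using basic_open_shrink[OF y(1,3,4,5) z(1,3)] .
      have "z \<in> carrier S" "z \<preceq> a" using z x a filter_closed[OF Ff(1)] sle_trans by blast+
      moreover have "finite (Z \<union> Z')" "Z \<union> Z' \<subseteq> downset S {z}" using Z Z' by auto
      moreover have "F \<in> basic_open z (Z \<union> Z')" "basic_open z (Z \<union> Z') \<subseteq> V \<inter> V'"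
        using Z Z' x y unfolding basic_open_Int[symmetric] by blast+
      ultimately show "\<exists>x X. x \<in> carrier S \<and> x \<preceq> a \<and> finite X \<and> X \<subseteq> downset S {x} \<and>
          F \<in> basic_open x X \<and> basic_open x X \<subseteq> V \<inter> V'" by blast
    qed
  next
    case (UN K)
    show ?case unfolding P_def
    proof (intro ballI)
      fix F a assume F: "F \<in> \<Union>K" and a: "a \<in> F"
      then obtain V where V: "V \<in> K" "F \<in> V" by blast
      then obtain x X where "x \<in> carrier S" "x \<preceq> a" "finite X" "X \<subseteq> downset S {x}"
          "F \<in> basic_open x X" "basic_open x X \<subseteq> V"
        using UN.IH[OF V(1)] a unfolding P_def by blast
      then show "\<exists>x X. x \<in> carrier S \<and> x \<preceq> a \<and> finite X \<and> X \<subseteq> downset S {x} \<and>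
          F \<in> basic_open x X \<and> basic_open x X \<subseteq> \<Union>K" using V by blast
    qed
  next
    case (Basis V)
    then obtain x X where x: "V = basic_open x X" "x \<in> carrier S" "finite X" "X \<subseteq> downset S {x}" by blast
    show ?case unfolding P_def
    proof (intro ballI)
      fix F a assume F: "F \<in> V" and a: "a \<in> F"
      then have Ff: "is_filter S F" "x \<in> F" unfolding x(1) mem_basic_open by auto
      obtain z where z: "z \<in> F" "z \<preceq> x" "z \<preceq> a" using filter_directed[OF Ff a] .
      obtain Z where Z: "finite Z" "Z \<subseteq> downset S {z}" "F \<in> basic_open z Z" "basic_open z Z \<subseteq> basic_open x X"
        using basic_open_shrink[OF x(2,3,4) F[unfolded x(1)] z(1,2)] .
      then show "\<exists>x X. x \<in> carrier S \<and> x \<preceq> a \<and> finite X \<and> X \<subseteq> downset S {x} \<and>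
          F \<in> basic_open x X \<and> basic_open x X \<subseteq> V"
        using z filter_closed[OF Ff(1)] unfolding x(1) by blast
    qed
  qed
  then obtain x X where x: "x \<in> carrier S" "x \<preceq> a" "finite X" "X \<subseteq> downset S {x}"
      "F \<in> basic_open x X" "basic_open x X \<subseteq> V"
    using assms unfolding P_def by blast
  moreover have "x \<in> F" using x(5) unfolding mem_basic_open by blast
  ultimately show thesis using that by blast
qed

lemma patch_openinI:
  assumes "\<And>F. F \<in> V \<Longrightarrow> \<exists>x X. x \<in> carrier S \<and> finite X \<and> X \<subseteq> downset S {x} \<and>
      F \<in> basic_open x X \<and> basic_open x X \<subseteq> V"
  shows "openin patch V"
  unfolding openin_subopen[of _ V]
proof
  fix F assume "F \<in> V"
  then obtain x X where "x \<in> carrier S" "finite X" "X \<subseteq> downset S {x}"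
      "F \<in> basic_open x X" "basic_open x X \<subseteq> V" using assms by blast
  then show "\<exists>T. openin patch T \<and> F \<in> T \<and> T \<subseteq> V"
    by (intro exI[of _ "basic_open x X"] conjI openin_basic_open)
qed

interpretation Gu: groupoid "G\<^sub>u S"
  by (rule groupoid_universal)

lemma composable_universal:
  "(A, B) \<in> composable_pairs (G\<^sub>u S) \<longleftrightarrow> is_filter S A \<and> is_filter S B \<and> fdom A = fran B"
  by (simp add: composable_pairs_iff)

section \<open>Continuity of composition and inversion\<close>

lemma continuous_fmult:
  "continuous_map (subtopology (prod_topology patch patch) (composable_pairs (G\<^sub>u S))) patch
     (\<lambda>(A, B). gcomp (G\<^sub>u S) A B)"
proof -
  let ?T = "subtopology (prod_topology patch patch) (composable_pairs (G\<^sub>u S))"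
  let ?m = "\<lambda>(A, B). gcomp (G\<^sub>u S) A B"
  have ts: "topspace ?T = composable_pairs (G\<^sub>u S)"
    by (auto simp: topspace_patch composable_universal)
  have "openin ?T (?m -` basic_open x X \<inter> topspace ?T)"
    if x: "x \<in> carrier S" "finite X" "X \<subseteq> downset S {x}" for x X
    unfolding openin_subopen[of _ "?m -` basic_open x X \<inter> topspace ?T"]
  proof
    fix p assume "p \<in> ?m -` basic_open x X \<inter> topspace ?T"
    then obtain A B where p: "p = (A, B)" and A: "is_filter S A" and B: "is_filter S B"
      and AB: "fdom A = fran B" and mem: "A \<diamondop> B \<in> basic_open x X"
      unfolding ts by (cases p) (auto simp: composable_universal)
    then have "x \<in> A \<diamondop> B" unfolding mem_basic_open by blast
    then obtain a b where ab: "a \<in> A" "b \<in> B" "a \<otimes> b \<preceq> x" by (rule fmultE)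
    have S: "a \<in> carrier S" "b \<in> carrier S" "a \<otimes> b \<in> carrier S" using ab filter_closed A B by auto
    have "a \<otimes> b \<in> A \<diamondop> B" unfolding mem_fmult using ab S by force
    \<comment> \<open>Recentring at \<open>a \<otimes> b\<close> puts every excluded element below
      it, as \<open>mem_fmult_iff_below\<close> requires.\<close>
    then obtain Z where Z: "finite Z" "Z \<subseteq> downset S {a \<otimes> b}" "A \<diamondop> B \<in> basic_open (a \<otimes> b) Z"
        "basic_open (a \<otimes> b) Z \<subseteq> basic_open x X"
      using basic_open_shrink[OF x mem _ ab(3)] by blast
    \<comment> \<open>The exclusions on the product are translated into exclusions on the right
      factor; the left factor only has to contain \<open>a\<close>.\<close>
    define Y where "Y = (\<lambda>c. b \<otimes> (\<iota> c \<otimes> c)) ` Z"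
    have Y: "finite Y" "Y \<subseteq> downset S {b}"
    proof -
      show "finite Y" using Z unfolding Y_def by simp
      have "c \<in> carrier S" if "c \<in> Z" for c using downset_singletonD[OF Z(2) that] by simp
      then show "Y \<subseteq> downset S {b}" using S unfolding Y_def by (intro downset_singletonI) auto
    qed
    have iff: "A' \<diamondop> B' \<in> basic_open (a \<otimes> b) Z \<longleftrightarrow> B' \<in> basic_open b Y"
      if A': "is_filter S A'" and B': "is_filter S B'" and AB': "fdom A' = fran B'" and "a \<in> A'" "b \<in> B'" for A' B'
    proof -
      have "a \<otimes> b \<in> A' \<diamondop> B'" unfolding mem_fmult using that S by force
      moreover have "c \<in> A' \<diamondop> B' \<longleftrightarrow> b \<otimes> (\<iota> c \<otimes> c) \<in> B'" if "c \<in> Z" for c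
        using mem_fmult_iff_below[OF A' B' AB' \<open>a \<in> A'\<close> \<open>b \<in> B'\<close>] downset_singletonD[OF Z(2) that] by blast
      ultimately show ?thesis
        unfolding mem_basic_open Y_def using filter_fmult[OF A' B' AB'] that by blast
    qed
    define T where "T = (U_set S a \<times> basic_open b Y) \<inter> composable_pairs (G\<^sub>u S)"
    have "openin ?T T"
      unfolding T_def openin_subtopology
      using openin_prod_Times_iff[of patch patch "U_set S a" "basic_open b Y"] openin_U_set[OF S(1)] openin_basic_open[OF S(2) Y] by blast
    moreover have "p \<in> T"
      unfolding T_def p using iff[OF A B AB ab(1,2)] Z(3) A B AB ab by (auto simp: composable_universal U_set_def)
    moreover have "T \<subseteq> ?m -` basic_open x X \<inter> topspace ?T"
    proof
      fix q assume "q \<in> T"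
      then obtain A' B' where q: "q = (A', B')" "A' \<in> U_set S a" "B' \<in> basic_open b Y" "(A', B') \<in> composable_pairs (G\<^sub>u S)"
        unfolding T_def by blast
      then have *: "is_filter S A'" "is_filter S B'" "fdom A' = fran B'" "a \<in> A'" "b \<in> B'"
        unfolding composable_universal mem_basic_open by (auto simp: U_set_def)
      then have "A' \<diamondop> B' \<in> basic_open x X" using iff[OF *] q Z(4) by blast
      then show "q \<in> ?m -` basic_open x X \<inter> topspace ?T" unfolding ts q(1) using q by simp
    qed
    ultimately show "\<exists>T. openin ?T T \<and> p \<in> T \<and> T \<subseteq> ?m -` basic_open x X \<inter> topspace ?T" by blast
  qed
  moreover have "?m ` topspace ?T \<subseteq> topspace patch"
    unfolding ts topspace_patch by (auto simp: composable_universal filter_fmult)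
  moreover define \<S> where "\<S> = {basic_open x X | x X. x \<in> carrier S \<and> finite X \<and> X \<subseteq> downset S {x}}"
  have ps: "patch = topology_generated_by \<S>" unfolding \<S>_def by (rule patch_eq)
  then have U\<S>: "\<Union>\<S> = topspace patch" by simp
  ultimately have "continuous_map ?T (topology_generated_by \<S>) ?m"
    unfolding continuous_on_generated_topo_iff U\<S> unfolding \<S>_def by blast
  then show ?thesis unfolding ps[symmetric] .
qed

lemma continuous_ginv_universal: "continuous_map patch patch (ginv (G\<^sub>u S))"
  unfolding continuous_map_alt
proof (intro conjI allI impI)
  show "ginv (G\<^sub>u S) \<in> topspace patch \<rightarrow> topspace patch"
    using ginv_universal filter_sinv by (auto simp: topspace_patch)
  fix V assume V: "openin patch V"
  show "openin patch (ginv (G\<^sub>u S) -` V \<inter> topspace patch)"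
  proof (rule patch_openinI)
    fix F assume "F \<in> ginv (G\<^sub>u S) -` V \<inter> topspace patch"
    then have F: "is_filter S F" "\<iota> ` F \<in> V" using ginv_universal by (auto simp: topspace_patch)
    obtain a where a: "a \<in> F" "a \<in> carrier S" using filter_nonempty[OF F(1)] .
    have "\<iota> a \<in> \<iota> ` F" using a by blast
    with V F(2) obtain x X where "x \<in> \<iota> ` F" "x \<preceq> \<iota> a"
      and x: "x \<in> carrier S" "finite X" "X \<subseteq> downset S {x}"
        "\<iota> ` F \<in> basic_open x X" "basic_open x X \<subseteq> V"
      by (rule patch_nbhd)
    have XS: "y \<preceq> x" "y \<in> carrier S" if "y \<in> X" for y using downset_singletonD[OF x(3) that] by auto
    \<comment> \<open>Inversion is an order automorphism, so it exchanges this basic set with the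
      one centred at \<open>x\<close>.\<close>
    have iff: "F' \<in> basic_open (\<iota> x) (\<iota> ` X) \<longleftrightarrow> is_filter S F' \<and> \<iota> ` F' \<in> basic_open x X" for F'
    proof (cases "is_filter S F'")
      case True
      have "y \<in> \<iota> ` F' \<longleftrightarrow> \<iota> y \<in> F'" if "y \<in> carrier S" for y
        using mem_sinv_image[OF filter_subset[OF True]] that by simp
      then show ?thesis unfolding mem_basic_open using True filter_sinv[OF True] x(1) XS by blast
    qed (unfold mem_basic_open, simp)
    have "\<iota> x \<in> carrier S" "finite (\<iota> ` X)" "\<iota> ` X \<subseteq> downset S {\<iota> x}"
      using x XS sle_sinv[OF _ x(1)] by (auto intro: downsetI)
    moreover have "F \<in> basic_open (\<iota> x) (\<iota> ` X)" using iff F x by blast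
    moreover have "basic_open (\<iota> x) (\<iota> ` X) \<subseteq> ginv (G\<^sub>u S) -` V \<inter> topspace patch"
    proof
      fix F' assume "F' \<in> basic_open (\<iota> x) (\<iota> ` X)"
      then have "is_filter S F'" "\<iota> ` F' \<in> V" using iff x(5) by blast+
      then show "F' \<in> ginv (G\<^sub>u S) -` V \<inter> topspace patch" using ginv_universal topspace_patch by simp
    qed
    ultimately show "\<exists>x X. x \<in> carrier S \<and> finite X \<and> X \<subseteq> downset S {x} \<and>
        F \<in> basic_open x X \<and> basic_open x X \<subseteq> ginv (G\<^sub>u S) -` V \<inter> topspace patch" by blast
  qed
qed

lemma topological_groupoid_universal: "topological_groupoid (G\<^sub>u S)"
  by unfold_locales (simp_all only: topspace_patch carrier_universal continuous_fmult continuous_ginv_universal)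

interpretation Gu: topological_groupoid "G\<^sub>u S"
  by (rule topological_groupoid_universal)

section \<open>Etale structure and the unit space\<close>

lemma identities_universal: "F \<in> identities (G\<^sub>u S) \<longleftrightarrow> is_filter S F \<and> (\<exists>e\<in>E. e \<in> F)"
proof
  assume "F \<in> identities (G\<^sub>u S)"
  then have F: "is_filter S F" "fdom F = F" by (auto simp: identities_def)
  obtain a where "a \<in> F" "a \<in> carrier S" using filter_nonempty[OF F(1)] .
  then show "is_filter S F \<and> (\<exists>e\<in>E. e \<in> F)"
    using F dom_mem_fdom[OF F(1)] sinv_mult_idem by metis
next
  assume "is_filter S F \<and> (\<exists>e\<in>E. e \<in> F)"
  then show "F \<in> identities (G\<^sub>u S)" using fdom_idem_filter by (auto simp: identities_def)
qed

lemma fdom_image_U_set: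
  assumes a: "a \<in> carrier S"
  shows "fdom ` U_set S a = U_set S (\<iota> a \<otimes> a)"
proof (intro equalityI subsetI)
  fix F assume "F \<in> fdom ` U_set S a"
  then show "F \<in> U_set S (\<iota> a \<otimes> a)" using filter_fdom dom_mem_fdom by (auto simp: U_set_def)
next
  fix F assume "F \<in> U_set S (\<iota> a \<otimes> a)"
  then have F: "is_filter S F" "\<iota> a \<otimes> a \<in> F" by (auto simp: U_set_def)
  obtain A where "is_filter S A" "a \<in> A" "fdom A = F" using filter_with_dom[OF F(1) a F(2)] .
  then show "F \<in> fdom ` U_set S a" by (auto simp: U_set_def)
qed

text \<open>Replacing the centre \<open>b\<close> and each excluded \<open>c\<close> by their domain
  idempotents describes the image of a basic set: membership below \<open>b\<close> is decided by
  domains, and \<open>filter_with_dom\<close> lifts each filter of the new set to one containing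
  \<open>b\<close>.\<close>

lemma openin_fdom_image:
  assumes V: "openin patch V" "V \<subseteq> U_set S a"
  shows "openin patch (fdom ` V)"
proof (rule patch_openinI)
  fix F' assume "F' \<in> fdom ` V"
  then obtain F where F': "F' = fdom F" and F: "F \<in> V" by blast
  then have Ff: "is_filter S F" "a \<in> F" using V by (auto simp: U_set_def)
  obtain b X where b: "b \<in> F" "b \<in> carrier S" "finite X" "X \<subseteq> downset S {b}"
    "F \<in> basic_open b X" "basic_open b X \<subseteq> V"
    using patch_nbhd[OF V(1) F Ff(2)] .
  have XS: "c \<preceq> b" "c \<in> carrier S" if "c \<in> X" for c using downset_singletonD[OF b(4) that] by auto
  define Y where "Y = (\<lambda>c. \<iota> c \<otimes> c) ` X"
  have iff: "A \<in> basic_open b X \<longleftrightarrow> fdom A \<in> basic_open (\<iota> b \<otimes> b) Y" if A: "is_filter S A" "b \<in> A" for A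
    unfolding mem_basic_open Y_def
    using mem_iff_dom_mem_fdom[OF A XS(1)] dom_mem_fdom[OF A] A filter_fdom[OF A(1)] by blast
  have "\<iota> b \<otimes> b \<in> carrier S" "finite Y" "Y \<subseteq> downset S {\<iota> b \<otimes> b}"
    using b XS unfolding Y_def by (auto intro!: downset_singletonI sle_mult sle_sinv)
  moreover have "F' \<in> basic_open (\<iota> b \<otimes> b) Y" using iff[OF Ff(1) b(1)] b(5) F' by blast
  moreover have "basic_open (\<iota> b \<otimes> b) Y \<subseteq> fdom ` V"
  proof
    fix H assume H: "H \<in> basic_open (\<iota> b \<otimes> b) Y"
    then have "is_filter S H" "\<iota> b \<otimes> b \<in> H" unfolding mem_basic_open by auto
    then obtain A where A: "is_filter S A" "b \<in> A" "fdom A = H" using filter_with_dom[OF _ b(2)] by blast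
    then have "A \<in> V" using iff[OF A(1,2)] H b(6) by blast
    then show "H \<in> fdom ` V" using A by blast
  qed
  ultimately show "\<exists>x X. x \<in> carrier S \<and> finite X \<and> X \<subseteq> downset S {x} \<and>
        F' \<in> basic_open x X \<and> basic_open x X \<subseteq> fdom ` V" by blast
qed

lemma etale_groupoid_universal: "etale_groupoid (G\<^sub>u S)"
proof unfold_locales
  fix F assume "F \<in> carrier (G\<^sub>u S)"
  then have F: "is_filter S F" by simp
  obtain a where a: "a \<in> F" "a \<in> carrier S" using filter_nonempty[OF F] .
  let ?U = "U_set S a" and ?d = "gdom (G\<^sub>u S)"
  have d: "?d ` V = fdom ` V" for V by simp
  have sub: "?d ` ?U \<subseteq> identities (G\<^sub>u S)"
    unfolding d fdom_image_U_set[OF a(2)] using a(2) by (auto simp: U_set_def identities_universal intro!: bexI[of _ "\<iota> a \<otimes> a"])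
  have op: "openin patch (?d ` ?U)"
    unfolding d by (rule openin_fdom_image[OF openin_U_set[OF a(2)]]) blast
  have ts: "topspace (subtopology patch ?U) = ?U" "topspace (subtopology patch (?d ` ?U)) = ?d ` ?U"
    using openin_subset[OF openin_U_set[OF a(2)]] openin_subset[OF op] by auto
  have "homeomorphic_map (subtopology patch ?U) (subtopology patch (?d ` ?U)) ?d"
  proof (rule bijective_open_imp_homeomorphic_map)
    show "continuous_map (subtopology patch ?U) (subtopology patch (?d ` ?U)) ?d"
      using Gu.continuous_gdom ts(1)
      by (auto simp: continuous_map_in_subtopology intro: continuous_map_from_subtopology)
    show "open_map (subtopology patch ?U) (subtopology patch (?d ` ?U)) ?d"
      unfolding open_map_def
    proof (intro allI impI)
      fix V assume "openin (subtopology patch ?U) V"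
      then have V: "openin patch V" "V \<subseteq> ?U"
        using openin_open_subtopology[OF openin_U_set[OF a(2)]] by auto
      show "openin (subtopology patch (?d ` ?U)) (?d ` V)"
        unfolding openin_open_subtopology[OF op] using openin_fdom_image[OF V] V unfolding d by blast
    qed
    show "?d ` topspace (subtopology patch ?U) = topspace (subtopology patch (?d ` ?U))"
      unfolding ts ..
    show "inj_on ?d (topspace (subtopology patch ?U))"
      unfolding ts inj_on_def using filter_eq_if_fdom[of _ _ a] by (auto simp: U_set_def)
  qed
  moreover have "openin (subtopology patch (identities (G\<^sub>u S))) (?d ` ?U)"
    using op sub by (metis openin_subtopology inf.absorb_iff1)
  moreover have "F \<in> ?U" using F a by (simp add: U_set_def)
  ultimately show "\<exists>U. F \<in> U \<and> openin patch U \<and>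
         openin (subtopology patch (identities (G\<^sub>u S))) (?d ` U) \<and>
         homeomorphic_map (subtopology patch U) (subtopology patch (?d ` U)) ?d"
    using openin_U_set[OF a(2)] by blast
qed

lemma Hausdorff_identities_universal: "Hausdorff_space (subtopology patch (identities (G\<^sub>u S)))"
proof -
  let ?I = "identities (G\<^sub>u S)"
  have *: "\<exists>U V. openin patch U \<and> openin patch V \<and> A \<in> U \<and> B \<in> V \<and> disjnt U V"
    if AB: "A \<in> ?I" "B \<in> ?I" "\<not> A \<subseteq> B" for A B
  proof -
    obtain e f where A: "is_filter S A" "e \<in> A" "e \<in> E" and B: "is_filter S B" "f \<in> B" "f \<in> E"
      using AB unfolding identities_universal by blast
    obtain y where y: "y \<in> A" "y \<notin> B" using AB by blast
    \<comment> \<open>Passing to an idempotent below \<open>y\<close> ensures that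
      \<open>f \<otimes> z\<close> is the meet of \<open>z\<close> and \<open>f\<close>. Being below
      \<open>f\<close>, it may be excluded from a set centred at \<open>f\<close>, and this
      exclusion separates \<open>B\<close> from all filters containing \<open>z\<close>.\<close>
    obtain z where z: "z \<in> A" "z \<in> E" "z \<preceq> y" using idem_filter_refine[OF A y(1)] .
    have "z \<notin> B" using filter_up[OF B(1) _ z(3)] y filter_closed[OF A(1)] by blast
    have fz: "f \<otimes> z \<in> carrier S" "f \<otimes> z \<preceq> f" "f \<otimes> z \<preceq> z" using B z by auto
    have "{f \<otimes> z} \<subseteq> downset S {f}" using fz by (intro downset_singletonI) simp
    then have "openin patch (U_set S z)" "openin patch (basic_open f {f \<otimes> z})"
      using openin_U_set[of z] openin_basic_open[of f "{f \<otimes> z}"] B z by simp_all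
    moreover have "A \<in> U_set S z" using A z by (simp add: U_set_def)
    moreover have "B \<in> basic_open f {f \<otimes> z}"
      unfolding mem_basic_open using B \<open>z \<notin> B\<close> filter_up[OF B(1) _ fz(3)] z by auto
    moreover have "disjnt (U_set S z) (basic_open f {f \<otimes> z})"
      unfolding disjnt_iff mem_basic_open using filter_meet[of _ f z] z by (auto simp: U_set_def)
    ultimately show ?thesis by blast
  qed
  show ?thesis
    unfolding Hausdorff_space_def
  proof (intro allI impI, elim conjE)
    fix A B assume AB: "A \<in> topspace (subtopology patch ?I)" "B \<in> topspace (subtopology patch ?I)" "A \<noteq> B"
    then have "A \<in> ?I" "B \<in> ?I" by auto
    moreover have "\<not> A \<subseteq> B \<or> \<not> B \<subseteq> A" using AB by blast
    ultimately obtain U V where UV: "openin patch U" "openin patch V" "A \<in> U" "B \<in> V" "disjnt U V"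
      using *[of A B] *[of B A] disjnt_sym by metis
    then have "openin (subtopology patch ?I) (U \<inter> ?I)" "openin (subtopology patch ?I) (V \<inter> ?I)"
      "disjnt (U \<inter> ?I) (V \<inter> ?I)"
      by (auto simp: openin_subtopology disjnt_iff)
    then show "\<exists>U V. openin (subtopology patch ?I) U \<and> openin (subtopology patch ?I) V \<and> A \<in> U \<and> B \<in> V \<and> disjnt U V"
      using UV \<open>A \<in> ?I\<close> \<open>B \<in> ?I\<close> by blast
  qed
qed

section \<open>Compactness and compact-open bisections\<close>

text \<open>Elements below \<open>x\<close> are pairwise compatible, so finitely many of them have a
  greatest lower bound, built one compatible meet at a time. The empty set contributes
  \<open>x\<close> itself.\<close>

lemma finite_glb:
  assumes x: "x \<in> carrier S" and N: "finite N" "N \<subseteq> downset S {x}"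
  obtains m where "m \<in> carrier S" "m \<preceq> x" "\<forall>n\<in>N. m \<preceq> n"
    "\<forall>w. w \<preceq> x \<longrightarrow> (\<forall>n\<in>N. w \<preceq> n) \<longrightarrow> w \<preceq> m"
proof -
  have "\<exists>m\<in>carrier S. m \<preceq> x \<and> (\<forall>n\<in>N. m \<preceq> n) \<and> (\<forall>w. w \<preceq> x \<longrightarrow> (\<forall>n\<in>N. w \<preceq> n) \<longrightarrow> w \<preceq> m)"
    using N
  proof induction
    case empty
    then show ?case using x by (intro bexI[of _ x]) auto
  next
    case (insert k N)
    then obtain m where m: "m \<in> carrier S" "m \<preceq> x" "\<forall>n\<in>N. m \<preceq> n"
        "\<forall>w. w \<preceq> x \<longrightarrow> (\<forall>n\<in>N. w \<preceq> n) \<longrightarrow> w \<preceq> m" by blast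
    have k: "k \<preceq> x" "k \<in> carrier S" using downset_singletonD[OF insert.prems] by auto
    have comp: "compatible S m k" using compatible_bounded[OF m(2) k(1) x] .
    let ?m = "m \<otimes> (\<iota> k \<otimes> k)"
    have le: "?m \<preceq> m" "?m \<preceq> k" using compatible_meet_sle1[OF comp m(1) k(2)] compatible_meet_sle2[OF comp m(1) k(2)] .
    have NS: "n \<in> carrier S" if "n \<in> N" for n using downset_singletonD[of "insert k N" x n] insert.prems that by auto
    have "?m \<in> carrier S" using m k by simp
    moreover have "?m \<preceq> x" using le m x sle_trans by blast
    moreover have "\<forall>n\<in>insert k N. ?m \<preceq> n" using le m NS sle_trans by blast
    moreover have "w \<preceq> ?m" if "w \<preceq> x" "\<forall>n\<in>insert k N. w \<preceq> n" for w
      using sle_meetI[of w m k] m k that by blast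
    ultimately show ?case by blast
  qed
  then show thesis using that by blast
qed

lemma filter_lower_bound:
  assumes F: "is_filter S F" and x: "x \<in> F" and N: "finite N" "N \<subseteq> F"
  obtains c where "c \<in> F" "c \<preceq> x" "\<forall>n\<in>N. c \<preceq> n"
proof -
  have "\<exists>c\<in>F. c \<preceq> x \<and> (\<forall>n\<in>N. c \<preceq> n)"
    using N
  proof induction
    case empty
    then show ?case using x filter_closed[OF F] by (intro bexI[of _ x]) auto
  next
    case (insert k N)
    then obtain c where c: "c \<in> F" "c \<preceq> x" "\<forall>n\<in>N. c \<preceq> n" by blast
    obtain d where d: "d \<in> F" "d \<preceq> c" "d \<preceq> k" using filter_directed[OF F c(1), of k] insert.prems by blast
    have "x \<in> carrier S" "\<And>n. n \<in> N \<Longrightarrow> n \<in> carrier S" using filter_closed[OF F] x insert.prems by blast+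
    then have "d \<preceq> x" "\<forall>n\<in>N. d \<preceq> n" using c d sle_trans by blast+
    then show ?case using d by blast
  qed
  then show thesis using that by blast
qed

text \<open>Alexander's subbase theorem reduces compactness to covers by the sets \<open>U_set S y\<close> and
  \<open>U_set S x - U_set S y\<close> with \<open>y \<preceq> x\<close>. If the elements \<open>y\<close> of the second kind generate a proper
  filter, then the cover has to contain a set of the first kind around that filter.\<close>

lemma compactin_U_set:
  assumes x: "x \<in> carrier S"
  shows "compactin patch (U_set S x)"
proof -
  define \<B> where "\<B> = U_set S ` downset S {x} \<union> (\<lambda>y. U_set S x - U_set S y) ` downset S {x}"
  define X where "X = topology (arbitrary union_of (finite intersection_of (\<lambda>x. x \<in> \<B>) relative_to \<Union>\<B>))"
  have down: "y \<in> carrier S" "y \<preceq> x" if "y \<in> downset S {x}" for y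
    using that by (auto elim!: downsetE)
  have xx: "x \<in> downset S {x}" using x by (auto intro: downsetI)
  have Usub: "U_set S y \<subseteq> U_set S x" if "y \<in> downset S {x}" for y
    using down[OF that] filter_up x by (auto simp: U_set_def)
  have UB: "\<Union>\<B> = U_set S x"
    unfolding \<B>_def using Usub xx by blast
  have ts: "topspace X = U_set S x" unfolding X_def UB[symmetric] by simp
  have "compact_space X"
  proof (rule Alexander_subbase[of \<B> X])
    show "topology (arbitrary union_of (finite intersection_of (\<lambda>x. x \<in> \<B>) relative_to \<Union>\<B>)) = X"
      by (simp add: X_def)
    fix C assume C: "C \<subseteq> \<B>" "\<Union>C = topspace X"
    define N where "N = {y \<in> downset S {x}. U_set S x - U_set S y \<in> C}"
    have NS: "N0 \<subseteq> downset S {x}" if "N0 \<subseteq> N" for N0 using that unfolding N_def by blast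
    \<comment> \<open>The filter generated by \<open>x\<close> and \<open>N\<close>: everything
      above the greatest lower bound of a finite part of \<open>N\<close> below \<open>x\<close>.
      The bound is described by its universal property.\<close>
    define F where "F = {z \<in> carrier S. \<exists>N0 m. finite N0 \<and> N0 \<subseteq> N \<and> m \<in> carrier S \<and> m \<preceq> x \<and> (\<forall>n\<in>N0. m \<preceq> n) \<and>
        (\<forall>w. w \<preceq> x \<longrightarrow> (\<forall>n\<in>N0. w \<preceq> n) \<longrightarrow> w \<preceq> m) \<and> m \<preceq> z}"
    \<comment> \<open>Membership in \<open>F\<close> is finitary: it is forced in every filter that
      contains \<open>x\<close> and a suitable finite part of \<open>N\<close>.\<close>
    have FE: "\<exists>N0. finite N0 \<and> N0 \<subseteq> N \<and> (\<forall>G. is_filter S G \<longrightarrow> x \<in> G \<longrightarrow> N0 \<subseteq> G \<longrightarrow> z \<in> G)" if z: "z \<in> F" for z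
    proof -
      obtain N0 m where m: "finite N0" "N0 \<subseteq> N" "m \<in> carrier S" "\<forall>w. w \<preceq> x \<longrightarrow> (\<forall>n\<in>N0. w \<preceq> n) \<longrightarrow> w \<preceq> m" "m \<preceq> z"
        and zS: "z \<in> carrier S"
        using z unfolding F_def by blast
      have "z \<in> G" if G: "is_filter S G" "x \<in> G" "N0 \<subseteq> G" for G
      proof -
        obtain c where c: "c \<in> G" "c \<preceq> x" "\<forall>n\<in>N0. c \<preceq> n"
          using filter_lower_bound[OF G(1,2) m(1) G(3)] .
        then have "c \<preceq> m" using m(4) by blast
        then show ?thesis using filter_up[OF G(1) c(1)] sle_trans m(5) zS by blast
      qed
      then show ?thesis using m by blast
    qed
    have FI: "m \<in> F" if "finite N0" "N0 \<subseteq> N" "m \<in> carrier S" "m \<preceq> x" "\<forall>n\<in>N0. m \<preceq> n"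
      "\<forall>w. w \<preceq> x \<longrightarrow> (\<forall>n\<in>N0. w \<preceq> n) \<longrightarrow> w \<preceq> m" for N0 m
      unfolding F_def mem_Collect_eq using that sle_refl[OF that(3)] by (intro conjI exI[of _ N0] exI[of _ m]) assumption+
    \<comment> \<open>A filter that omits some \<open>n\<close> in \<open>N0\<close> lies in a set
      of the second kind, so only filters containing \<open>x\<close> and all of \<open>N0\<close>
      remain for \<open>D\<close> to cover.\<close>
    have cover: "\<exists>C'. finite C' \<and> C' \<subseteq> C \<and> \<Union>C' = topspace X"
      if N0: "finite N0" "N0 \<subseteq> N" and D: "finite D" "D \<subseteq> C"
        and all: "\<And>G. is_filter S G \<Longrightarrow> x \<in> G \<Longrightarrow> N0 \<subseteq> G \<Longrightarrow> G \<in> \<Union>D" for N0 D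
    proof (intro exI conjI)
      let ?C = "D \<union> (\<lambda>n. U_set S x - U_set S n) ` N0"
      show "finite ?C" using N0 D by simp
      show sub: "?C \<subseteq> C" using N0 D unfolding N_def by blast
      have "U_set S x \<subseteq> \<Union>?C" using all by (auto simp: U_set_def)
      moreover have "\<Union>?C \<subseteq> topspace X" unfolding C(2)[symmetric] using sub by (rule Union_mono)
      ultimately show "\<Union>?C = topspace X" unfolding ts by (rule subset_antisym[rotated])
    qed
    have xF: "x \<in> F" by (rule FI[of "{}"]) (use x in auto)
    show "\<exists>C'. finite C' \<and> C' \<subseteq> C \<and> \<Union>C' = topspace X"
    proof (cases "\<zero> \<in> F")
      case True
      \<comment> \<open>No proper filter contains \<open>x\<close> and \<open>N0\<close>, so the
        sets of the second kind for \<open>N0\<close> already cover.\<close>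
      from FE[OF this] obtain N0 where N0: "finite N0" "N0 \<subseteq> N"
        and mem: "\<forall>G. is_filter S G \<longrightarrow> x \<in> G \<longrightarrow> N0 \<subseteq> G \<longrightarrow> \<zero> \<in> G" by (elim exE conjE)
      show ?thesis
      proof (rule cover[OF N0, of "{}"])
        fix G assume "is_filter S G" "x \<in> G" "N0 \<subseteq> G"
        then show "G \<in> \<Union>{}" using mem filter_zero[of G] by simp
      qed simp_all
    next
      case False
      have F: "is_filter S F"
      proof (rule is_filterI[OF _ xF False])
        show "F \<subseteq> carrier S" unfolding F_def by blast
      next
        fix a b assume "a \<in> F" "a \<preceq> b" "b \<in> carrier S"
        then show "b \<in> F" unfolding F_def using sle_trans by blast
      next
        fix a b assume "a \<in> F" "b \<in> F"
        then obtain N1 m1 N2 m2 where m: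
          "finite N1" "N1 \<subseteq> N" "m1 \<in> carrier S" "\<forall>w. w \<preceq> x \<longrightarrow> (\<forall>n\<in>N1. w \<preceq> n) \<longrightarrow> w \<preceq> m1" "m1 \<preceq> a"
          "finite N2" "N2 \<subseteq> N" "m2 \<in> carrier S" "\<forall>w. w \<preceq> x \<longrightarrow> (\<forall>n\<in>N2. w \<preceq> n) \<longrightarrow> w \<preceq> m2" "m2 \<preceq> b"
          and S: "a \<in> carrier S" "b \<in> carrier S"
          unfolding F_def by blast
        have fin: "finite (N1 \<union> N2)" "N1 \<union> N2 \<subseteq> N" using m by auto
        obtain c where c: "c \<in> carrier S" "c \<preceq> x" "\<forall>n\<in>N1 \<union> N2. c \<preceq> n"
            "\<forall>w. w \<preceq> x \<longrightarrow> (\<forall>n\<in>N1 \<union> N2. w \<preceq> n) \<longrightarrow> w \<preceq> c"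
          using finite_glb[OF x fin(1) NS[OF fin(2)]] .
        then have "c \<in> F" using FI[OF fin] by blast
        moreover have "c \<preceq> m1" "c \<preceq> m2" using m c by blast+
        then have "c \<preceq> a" "c \<preceq> b" using m S sle_trans by blast+
        ultimately show "\<exists>c\<in>F. c \<preceq> a \<and> c \<preceq> b" by blast
      qed
      then have "F \<in> topspace X" unfolding ts using xF by (simp add: U_set_def)
      then obtain B where B: "B \<in> C" "F \<in> B" using C by blast
      \<comment> \<open>By construction \<open>F\<close> contains every element of \<open>N\<close>,
        hence lies in no set of the second kind from the cover.\<close>
      have "F \<notin> U_set S x - U_set S n" if n: "n \<in> N" for n
      proof -
        have n': "n \<in> carrier S" "n \<preceq> x" using down n unfolding N_def by auto
        have "n \<in> F" by (rule FI[of "{n}"]) (use n n' in auto)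
        then show ?thesis using F by (simp add: U_set_def)
      qed
      then obtain y where y: "B = U_set S y" using B C unfolding N_def \<B>_def by blast
      then have "y \<in> F" using B by (simp add: U_set_def)
      from FE[OF this] obtain N0 where N0: "finite N0" "N0 \<subseteq> N"
        and mem: "\<forall>G. is_filter S G \<longrightarrow> x \<in> G \<longrightarrow> N0 \<subseteq> G \<longrightarrow> y \<in> G" by (elim exE conjE)
      show ?thesis
      proof (rule cover[OF N0, of "{B}"])
        fix G assume "is_filter S G" "x \<in> G" "N0 \<subseteq> G"
        then show "G \<in> \<Union>{B}" using mem by (simp add: y U_set_def)
      qed (use B(1) in simp_all)
    qed
  qed
  then have "compactin X (U_set S x)" unfolding ts[symmetric] by (simp add: compact_space_def)
  \<comment> \<open>Traces on \<open>U_set S x\<close> of patch-open sets are open for the subbase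
    topology, so compactness transfers along the identity map.\<close>
  moreover have "continuous_map X patch id"
    unfolding continuous_map_alt
  proof (intro conjI allI impI)
    show "id \<in> topspace X \<rightarrow> topspace patch" unfolding ts topspace_patch by (auto simp: U_set_def)
    fix V assume V: "openin patch V"
    show "openin X (id -` V \<inter> topspace X)"
      unfolding openin_subopen[of X "id -` V \<inter> topspace X"]
    proof
      fix F assume F: "F \<in> id -` V \<inter> topspace X"
      then have "F \<in> V" "x \<in> F" unfolding ts by (auto simp: U_set_def)
      then obtain y Y where y: "y \<in> F" "y \<in> carrier S" "y \<preceq> x" "finite Y" "Y \<subseteq> downset S {y}"
        "F \<in> basic_open y Y" "basic_open y Y \<subseteq> V" using patch_nbhd[OF V] by blast
      have yd: "y \<in> downset S {x}" using y by (auto intro: downsetI)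
      have Yd: "u \<in> downset S {x}" if "u \<in> Y" for u
        using downset_singletonD[OF y(5) that] y(3) x sle_trans by (auto intro: downsetI)
      have 1: "openin X (U_set S y)"
        unfolding X_def UB by (rule subbase_openin) (use yd Usub \<B>_def in auto)
      have 2: "openin X (U_set S x - U_set S u)" if "u \<in> Y" for u
        unfolding X_def UB by (rule subbase_openin) (use Yd[OF that] \<B>_def in auto)
      have "openin X (U_set S y \<inter> (U_set S x \<inter> \<Inter>((\<lambda>u. U_set S x - U_set S u) ` Y)))"
      \<comment> \<open>An intersection over the empty family would be the whole type, so this case
        is separate.\<close>
      proof (cases "Y = {}")
        case True
        then show ?thesis using 1 Usub[OF yd] by (simp add: inf.absorb1)
      next
        case False
        have "openin X (\<Inter>((\<lambda>u. U_set S x - U_set S u) ` Y))"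
          using False y(4) 2 by (intro openin_Inter) auto
        then show ?thesis using 1 openin_topspace[of X] unfolding ts by blast
      qed
      moreover have "basic_open y Y = U_set S y \<inter> (U_set S x \<inter> \<Inter>((\<lambda>u. U_set S x - U_set S u) ` Y))"
        using Usub[OF yd] unfolding basic_open_def by blast
      ultimately have "openin X (basic_open y Y)" by simp
      moreover have "basic_open y Y \<subseteq> id -` V \<inter> topspace X" unfolding ts using y(7) Usub[OF yd] by (auto simp: basic_open_def)
      ultimately show "\<exists>T. openin X T \<and> F \<in> T \<and> T \<subseteq> id -` V \<inter> topspace X" using y(6) by blast
    qed
  qed
  ultimately show ?thesis using image_compactin[of X "U_set S x" patch id] by simp
qed

text \<open>Removing open sets from the compact set \<open>U_set S x\<close> leaves a compact set.
  It is a bisection because quotients of two filters containing \<open>x\<close> contain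
  \<open>\<iota> x \<otimes> x\<close> or \<open>x \<otimes> \<iota> x\<close>, and a filter with an
  idempotent is an identity.\<close>

lemma basic_open_KB:
  assumes x: "x \<in> carrier S" "finite X" "X \<subseteq> downset S {x}"
  shows "basic_open x X \<in> carrier (KB (G\<^sub>u S))"
proof -
  have "openin patch (\<Union>y\<in>X. U_set S y)"
    using downset_singletonD[OF x(3)] openin_U_set by blast
  then have "compactin patch ((topspace patch - (\<Union>y\<in>X. U_set S y)) \<inter> U_set S x)"
    by (intro closed_Int_compactin compactin_U_set x(1)) (intro closedin_diff closedin_topspace)
  moreover have "(topspace patch - (\<Union>y\<in>X. U_set S y)) \<inter> U_set S x = basic_open x X"
    using openin_subset[OF openin_U_set[OF x(1)]] unfolding basic_open_def by blast
  ultimately have 1: "compactin patch (basic_open x X)" by simp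
  have "bisection (G\<^sub>u S) (basic_open x X)"
    unfolding bisection_def gsetprod_def
  proof (intro conjI subsetI)
    fix F assume "F \<in> basic_open x X"
    then show "F \<in> carrier (G\<^sub>u S)" by (simp add: mem_basic_open)
  next
    fix F assume "F \<in> {gcomp (G\<^sub>u S) a b |a b. a \<in> ginv (G\<^sub>u S) ` basic_open x X \<and> b \<in> basic_open x X \<and>
        (a, b) \<in> composable_pairs (G\<^sub>u S)}"
    then obtain A B where F': "F = ginv (G\<^sub>u S) A \<diamondop> B" and AB': "A \<in> basic_open x X" "B \<in> basic_open x X"
        "(ginv (G\<^sub>u S) A, B) \<in> composable_pairs (G\<^sub>u S)"
      unfolding gcomp_universal by blast
    then have A: "is_filter S A" "x \<in> A" and B: "is_filter S B" "x \<in> B" unfolding mem_basic_open by auto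
    have F: "F = \<iota> ` A \<diamondop> B" and AB: "fdom (\<iota> ` A) = fran B"
      using F' AB'(3) ginv_universal[OF A(1)] ginv_universal[OF B(1)] unfolding composable_universal by simp_all
    have "\<iota> x \<otimes> x \<in> F" unfolding F mem_fmult using A B x by force
    moreover have "is_filter S F" unfolding F using filter_fmult[OF filter_sinv[OF A(1)] B(1) AB] .
    ultimately show "F \<in> identities (G\<^sub>u S)" unfolding identities_universal using x by auto
  next
    fix F assume "F \<in> {gcomp (G\<^sub>u S) a b |a b. a \<in> basic_open x X \<and> b \<in> ginv (G\<^sub>u S) ` basic_open x X \<and>
        (a, b) \<in> composable_pairs (G\<^sub>u S)}"
    then obtain A B where F': "F = A \<diamondop> ginv (G\<^sub>u S) B" and AB': "A \<in> basic_open x X" "B \<in> basic_open x X"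
        "(A, ginv (G\<^sub>u S) B) \<in> composable_pairs (G\<^sub>u S)"
      unfolding gcomp_universal by blast
    then have A: "is_filter S A" "x \<in> A" and B: "is_filter S B" "x \<in> B" unfolding mem_basic_open by auto
    have F: "F = A \<diamondop> \<iota> ` B" and AB: "fdom A = fran (\<iota> ` B)"
      using F' AB'(3) ginv_universal[OF A(1)] ginv_universal[OF B(1)] unfolding composable_universal by simp_all
    have "x \<otimes> \<iota> x \<in> F" unfolding F mem_fmult using A B x by force
    moreover have "is_filter S F" unfolding F using filter_fmult[OF A(1) filter_sinv[OF B(1)] AB] .
    ultimately show "F \<in> identities (G\<^sub>u S)" unfolding identities_universal using x by auto
  qed
  then show ?thesis
    using 1 openin_basic_open[OF x] by (simp add: compact_open_bisections_def)
qed

lemma boolean_groupoid_universal: "boolean_groupoid (G\<^sub>u S)"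
proof -
  interpret Gu: etale_groupoid "G\<^sub>u S" by (rule etale_groupoid_universal)
  show ?thesis
  proof (intro boolean_groupoid.intro boolean_groupoid_axioms.intro etale_groupoid_universal)
    show "Hausdorff_space (subtopology patch (identities (G\<^sub>u S)))" by (rule Hausdorff_identities_universal)
    fix V F assume V: "openin patch V" "F \<in> V"
    then have F: "is_filter S F" using openin_subset topspace_patch by blast
    obtain a where "a \<in> F" "a \<in> carrier S" using filter_nonempty[OF F] .
    then obtain x X where "x \<in> F" "x \<in> carrier S" "x \<preceq> a" "finite X" "X \<subseteq> downset S {x}" "F \<in> basic_open x X" "basic_open x X \<subseteq> V"
      using patch_nbhd[OF V] by metis
    then show "\<exists>A\<in>carrier (KB (G\<^sub>u S)). F \<in> A \<and> A \<subseteq> V" using basic_open_KB by blast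
  qed
qed

end

section \<open>Transport of topological groupoids\<close>

lemma groupoid_homeomorphicI:
  assumes G: "topological_groupoid G"
    and f: "homeomorphic_map (gtop G) (gtop H) f"
    and carrier: "carrier H = f ` carrier G"
    and dom: "\<And>x. x \<in> carrier G \<Longrightarrow> f (gdom G x) = gdom H (f x)"
    and ran: "\<And>x. x \<in> carrier G \<Longrightarrow> f (gran G x) = gran H (f x)"
    and comp: "\<And>x y. \<lbrakk>x \<in> carrier G; y \<in> carrier G; gdom G x = gran G y\<rbrakk>
        \<Longrightarrow> f (gcomp G x y) = gcomp H (f x) (f y)"
  shows "groupoid_homeomorphic G H"
proof -
  interpret G: topological_groupoid G by (rule G)
  obtain g where fg: "homeomorphic_maps (gtop G) (gtop H) f g"
    using f by (auto simp: homeomorphic_map_maps)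
  then have contf: "continuous_map (gtop G) (gtop H) f" and contg: "continuous_map (gtop H) (gtop G) g"
    and gf: "\<And>x. x \<in> carrier G \<Longrightarrow> g (f x) = x" and ts: "f ` carrier G = topspace (gtop H)"
    using homeomorphic_imp_surjective_map[OF f]
    by (auto simp: homeomorphic_maps_def G.topspace_carrier)
  have inj: "f x = f y \<longleftrightarrow> x = y" if "x \<in> carrier G" "y \<in> carrier G" for x y
    using gf that by metis
  \<comment> \<open>Preservation of domains and ranges together with injectivity makes
    \<open>f\<close> reflect composability.\<close>
  have composable: "(f x, f y) \<in> composable_pairs H \<longleftrightarrow> gdom G x = gran G y"
    if "x \<in> carrier G" "y \<in> carrier G" for x y
    using that by (simp add: composable_pairs_iff carrier inj flip: dom ran)
  have ginverse: "is_ginverse H (f x) (f (ginv G x))" if "x \<in> carrier G" for x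
    using that by (simp add: is_ginverse_def carrier flip: dom ran comp)
  have H: "groupoid H"
  proof (unfold_locales, goal_cases)
    case (7 u v)
    then obtain x y where "u = f x" "v = f y" "x \<in> carrier G" "y \<in> carrier G" "gdom G x = gran G y"
      using composable by (auto simp: composable_pairs_iff carrier)
    then show ?case by (simp add: carrier flip: comp)
  next
    case (8 u v)
    then obtain x y where "u = f x" "v = f y" "x \<in> carrier G" "y \<in> carrier G" "gdom G x = gran G y"
      using composable by (auto simp: composable_pairs_iff carrier)
    then show ?case by (simp flip: comp dom)
  next
    case (9 u v)
    then obtain x y where "u = f x" "v = f y" "x \<in> carrier G" "y \<in> carrier G" "gdom G x = gran G y"
      using composable by (auto simp: composable_pairs_iff carrier)
    then show ?case by (simp flip: comp ran)
  next
    case (10 u v w)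
    then obtain x y z where "u = f x" "v = f y" "w = f z"
      and S: "x \<in> carrier G" "y \<in> carrier G" "z \<in> carrier G"
      by (auto simp: composable_pairs_iff carrier)
    moreover from this have "gdom G x = gran G y" "gdom G y = gran G z"
      using 10 composable by auto
    ultimately show ?case using G.gcomp_assoc'[OF S] by (simp flip: comp)
  next
    case (13 u)
    then show ?case using ginverse by (auto simp: carrier)
  qed (auto simp: carrier simp flip: dom ran comp)
  interpret H: groupoid H by (rule H)
  have ginv: "ginv H (f x) = f (ginv G x)" if "x \<in> carrier G" for x
    using that ginverse by (intro H.ginv_eqI) (auto simp: carrier)
  let ?T = "subtopology (prod_topology (gtop H) (gtop H)) (composable_pairs H)"
  have "continuous_map ?T (gtop H) (\<lambda>(u, v). gcomp H u v)"
  proof (rule continuous_map_eq)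
    have fst: "continuous_map ?T (gtop G) (\<lambda>p. g (fst p))"
      using continuous_map_compose[OF continuous_map_from_subtopology[OF continuous_map_fst] contg]
      by (simp add: o_def)
    have snd: "continuous_map ?T (gtop G) (\<lambda>p. g (snd p))"
      using continuous_map_compose[OF continuous_map_from_subtopology[OF continuous_map_snd] contg]
      by (simp add: o_def)
    have *: "\<exists>x y. p = (f x, f y) \<and> x \<in> carrier G \<and> y \<in> carrier G \<and> gdom G x = gran G y"
      if "p \<in> topspace ?T" for p
      using that composable by (cases p) (auto simp flip: ts)
    \<comment> \<open>On composable pairs of \<open>H\<close>, composition factors through
      \<open>g\<close> on both arguments, composition in \<open>G\<close>, and
      \<open>f\<close>.\<close>
    have "continuous_map ?T (gtop G) (\<lambda>p. gcomp G (g (fst p)) (g (snd p)))"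
      using * gf by (intro G.continuous_map_gcomp fst snd) force
    from continuous_map_compose[OF this contf]
    show "continuous_map ?T (gtop H) (\<lambda>p. f (gcomp G (g (fst p)) (g (snd p))))"
      by (simp add: o_def)
    show "f (gcomp G (g (fst p)) (g (snd p))) = (case p of (u, v) \<Rightarrow> gcomp H u v)" if "p \<in> topspace ?T" for p
      using *[OF that] gf comp by auto
  qed
  moreover have "continuous_map (gtop H) (gtop H) (ginv H)"
  proof (rule continuous_map_eq)
    show "continuous_map (gtop H) (gtop H) (f \<circ> (ginv G \<circ> g))"
      using contg G.continuous_ginv contf by (intro continuous_map_compose)
    show "(f \<circ> (ginv G \<circ> g)) u = ginv H u" if "u \<in> topspace (gtop H)" for u
      using that ginv gf by (auto simp flip: ts)
  qed
  ultimately have "topological_groupoid H"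
    using ts carrier by unfold_locales auto
  then show ?thesis
    unfolding groupoid_homeomorphic_def using G f dom ran comp by (auto simp: composable_pairs_iff)
qed

section \<open>Compact-open bisections\<close>

lemma mem_gsetprod:
  "z \<in> gsetprod G A B \<longleftrightarrow> (\<exists>a\<in>A. \<exists>b\<in>B. (a, b) \<in> composable_pairs G \<and> z = gcomp G a b)"
  by (auto simp: gsetprod_def)

lemma gsetprodE:
  assumes "z \<in> gsetprod G A B"
  obtains a b where "a \<in> A" "b \<in> B" "a \<in> carrier G" "b \<in> carrier G" "gdom G a = gran G b" "z = gcomp G a b"
  using assms by (auto simp: mem_gsetprod composable_pairs_iff)

lemma gsetprodI:
  "a \<in> A \<Longrightarrow> b \<in> B \<Longrightarrow> a \<in> carrier G \<Longrightarrow> b \<in> carrier G \<Longrightarrow> gdom G a = gran G b \<Longrightarrow> gcomp G a b \<in> gsetprod G A B"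
  by (auto simp: mem_gsetprod composable_pairs_iff)

context groupoid
begin

section \<open>Algebra of bisections\<close>

lemma eq_if_right_quotient:
  assumes "x \<in> carrier G" "y \<in> carrier G" "gdom G x = gdom G y" "gcomp G x (ginv G y) \<in> identities G"
  shows "x = y"
proof -
  have e: "gcomp G x (ginv G y) = gran G y" using assms by (simp add: identities_def)
  have "x = gcomp G x (gcomp G (ginv G y) y)" using assms gcomp_gdom[of x] by simp
  also have "\<dots> = gcomp G (gcomp G x (ginv G y)) y" using assms by (simp add: gcomp_assoc' del: ginv_simps(4))
  also have "\<dots> = y" using e assms by simp
  finally show ?thesis .
qed

lemma eq_if_left_quotient:
  assumes "x \<in> carrier G" "y \<in> carrier G" "gran G x = gran G y" "gcomp G (ginv G x) y \<in> identities G"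
  shows "x = y"
proof -
  have e: "gcomp G (ginv G x) y = gdom G x" using assms by (simp add: identities_iff)
  have "y = gcomp G (gcomp G x (ginv G x)) y" using assms gcomp_gran[of y] by simp
  also have "\<dots> = gcomp G x (gcomp G (ginv G x) y)" using assms by (simp add: gcomp_assoc' del: ginv_simps(5) gcomp_ginv_cancel)
  also have "\<dots> = x" using e assms by simp
  finally show ?thesis by simp
qed

text \<open>Two arrows with equal domains have a right quotient; if it is an identity, the arrows
  are equal. Left quotients treat ranges in the same way.\<close>

lemma bisection_iff:
  "bisection G A \<longleftrightarrow> A \<subseteq> carrier G \<and> inj_on (gdom G) A \<and> inj_on (gran G) A"
proof
  assume A: "bisection G A"
  then have sub: "x \<in> carrier G" if "x \<in> A" for x using that by (auto simp: bisection_def)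
  have "x = y" if "x \<in> A" "y \<in> A" "gdom G x = gdom G y" for x y
  proof (rule eq_if_right_quotient)
    have "gcomp G x (ginv G y) \<in> gsetprod G A (ginv G ` A)"
      using that sub by (intro gsetprodI) auto
    then show "gcomp G x (ginv G y) \<in> identities G" using A by (auto simp: bisection_def)
  qed (use that sub in auto)
  moreover have "x = y" if "x \<in> A" "y \<in> A" "gran G x = gran G y" for x y
  proof (rule eq_if_left_quotient)
    have "gcomp G (ginv G x) y \<in> gsetprod G (ginv G ` A) A"
      using that sub by (intro gsetprodI) auto
    then show "gcomp G (ginv G x) y \<in> identities G" using A by (auto simp: bisection_def)
  qed (use that sub in auto)
  ultimately show "A \<subseteq> carrier G \<and> inj_on (gdom G) A \<and> inj_on (gran G) A"
    using sub by (auto simp: inj_on_def)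
next
  assume A: "A \<subseteq> carrier G \<and> inj_on (gdom G) A \<and> inj_on (gran G) A"
  show "bisection G A"
    unfolding bisection_def
  proof (intro conjI subsetI)
    fix z assume "z \<in> gsetprod G (ginv G ` A) A"
    then obtain a b where "a \<in> A" "b \<in> A" "gdom G (ginv G a) = gran G b" "z = gcomp G (ginv G a) b"
      by (auto elim!: gsetprodE)
    moreover from this have "a \<in> carrier G" using A by blast
    moreover from this calculation have "a = b" using A inj_onD[of "gran G" A a b] by simp
    ultimately show "z \<in> identities G" by simp
  next
    fix z assume "z \<in> gsetprod G A (ginv G ` A)"
    then obtain a b where "a \<in> A" "b \<in> A" "gdom G a = gran G (ginv G b)" "z = gcomp G a (ginv G b)"
      by (auto elim!: gsetprodE)
    moreover from this have "a \<in> carrier G" "b \<in> carrier G" using A by blast+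
    moreover from this calculation have "a = b" using A inj_onD[of "gdom G" A a b] by simp
    ultimately show "z \<in> identities G" by simp
  qed (use A in auto)
qed

lemma bisection_eqI:
  assumes "bisection G A" "a \<in> A" "b \<in> A"
  shows "gdom G a = gdom G b \<Longrightarrow> a = b" "gran G a = gran G b \<Longrightarrow> a = b"
  using assms by (auto simp: bisection_iff inj_on_def)

lemma gsetprod_subset: "gsetprod G A B \<subseteq> carrier G"
  by (auto elim!: gsetprodE)

lemma bisection_gsetprod:
  assumes "bisection G A" "bisection G B"
  shows "bisection G (gsetprod G A B)"
  unfolding bisection_iff
proof (intro conjI gsetprod_subset inj_onI)
  fix x y assume "x \<in> gsetprod G A B" "y \<in> gsetprod G A B"
  then obtain a b a' b' where *: "a \<in> A" "b \<in> B" "a \<in> carrier G" "b \<in> carrier G" "gdom G a = gran G b" "x = gcomp G a b"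
    "a' \<in> A" "b' \<in> B" "a' \<in> carrier G" "b' \<in> carrier G" "gdom G a' = gran G b'" "y = gcomp G a' b'"
    by (elim gsetprodE)
  note eqA = bisection_eqI[OF assms(1) *(1,7)] and eqB = bisection_eqI[OF assms(2) *(2,8)]
  {
    assume "gdom G x = gdom G y"
    then have b: "b = b'" using * by (intro eqB(1)) simp
    then have "a = a'" using * by (intro eqA(1)) simp
    then show "x = y" using * b by simp
  next
    assume "gran G x = gran G y"
    then have a: "a = a'" using * by (intro eqA(2)) simp
    then have "b = b'" using *(5,11) by (intro eqB(2)) simp
    then show "x = y" using * a by simp
  }
qed

lemma bisection_ginv:
  assumes "bisection G A"
  shows "bisection G (ginv G ` A)"
  using assms unfolding bisection_iff inj_on_def by (auto simp: subset_iff)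

lemma gsetprod_assoc:
  assumes "A \<subseteq> carrier G" "B \<subseteq> carrier G" "C \<subseteq> carrier G"
  shows "gsetprod G (gsetprod G A B) C = gsetprod G A (gsetprod G B C)"
proof (intro equalityI subsetI)
  fix x assume "x \<in> gsetprod G (gsetprod G A B) C"
  then obtain a b c where *: "a \<in> A" "b \<in> B" "c \<in> C" "a \<in> carrier G" "b \<in> carrier G" "c \<in> carrier G"
      "gdom G a = gran G b" "gdom G (gcomp G a b) = gran G c" "x = gcomp G (gcomp G a b) c"
    by (elim gsetprodE) blast
  then have "gcomp G a (gcomp G b c) \<in> gsetprod G A (gsetprod G B C)"
    by (intro gsetprodI) auto
  then show "x \<in> gsetprod G A (gsetprod G B C)" using * by (simp add: gcomp_assoc')
next
  fix x assume "x \<in> gsetprod G A (gsetprod G B C)"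
  then obtain a b c where *: "a \<in> A" "b \<in> B" "c \<in> C" "a \<in> carrier G" "b \<in> carrier G" "c \<in> carrier G"
      "gdom G b = gran G c" "gdom G a = gran G (gcomp G b c)" "x = gcomp G a (gcomp G b c)"
    by (elim gsetprodE) blast
  then have "gcomp G (gcomp G a b) c \<in> gsetprod G (gsetprod G A B) C"
    by (intro gsetprodI) auto
  then show "x \<in> gsetprod G (gsetprod G A B) C" using * by (simp add: gcomp_assoc')
qed

lemma ginv_image_ginv_image [simp]: "A \<subseteq> carrier G \<Longrightarrow> ginv G ` ginv G ` A = A"
  by (force simp: image_image)

lemma gsetprod_ginv_left:
  assumes "bisection G A"
  shows "gsetprod G (ginv G ` A) A = gdom G ` A"
proof (intro equalityI subsetI)
  fix z assume "z \<in> gsetprod G (ginv G ` A) A"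
  then obtain a b where *: "a \<in> A" "b \<in> A" "gdom G (ginv G a) = gran G b" "z = gcomp G (ginv G a) b"
    by (auto elim!: gsetprodE)
  then have "a \<in> carrier G" using assms by (auto simp: bisection_iff)
  moreover from this have "a = b" using *(3) bisection_eqI(2)[OF assms *(1,2)] by simp
  ultimately show "z \<in> gdom G ` A" using * by simp
next
  fix z assume "z \<in> gdom G ` A"
  then obtain a where a: "a \<in> A" "a \<in> carrier G" "z = gdom G a" using assms by (auto simp: bisection_iff)
  then have "gcomp G (ginv G a) a \<in> gsetprod G (ginv G ` A) A" by (intro gsetprodI) auto
  then show "z \<in> gsetprod G (ginv G ` A) A" using a by simp
qed

lemma gsetprod_identities:
  assumes "A \<subseteq> carrier G" "I \<subseteq> identities G"
  shows "gsetprod G A I = {a \<in> A. gdom G a \<in> I}"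
proof (intro equalityI subsetI)
  fix z assume "z \<in> gsetprod G A I"
  then obtain a e where *: "a \<in> A" "e \<in> I" "a \<in> carrier G" "gdom G a = gran G e" "z = gcomp G a e"
    by (elim gsetprodE)
  then have "gdom G a = e" using assms by (auto simp: identities_iff)
  then show "z \<in> {a \<in> A. gdom G a \<in> I}" using * by auto
next
  fix a assume "a \<in> {a \<in> A. gdom G a \<in> I}"
  then have a: "a \<in> A" "gdom G a \<in> I" "a \<in> carrier G" using assms by auto
  then have "gcomp G a (gdom G a) \<in> gsetprod G A I" by (intro gsetprodI) auto
  then show "a \<in> gsetprod G A I" using a by simp
qed

text \<open>The domain map is injective on \<open>A\<close>, so restricting \<open>A\<close> to the
  domains of a subset gives that subset back. This realises inclusion as the natural order.\<close>

lemma gsetprod_dom_subset: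
  assumes "bisection G A" "B \<subseteq> A"
  shows "gsetprod G A (gdom G ` B) = B"
proof -
  have "gsetprod G A (gdom G ` B) = {a \<in> A. gdom G a \<in> gdom G ` B}"
    using assms by (intro gsetprod_identities) (auto simp: bisection_iff)
  also have "\<dots> = B" using assms by (auto simp: bisection_iff dest: inj_onD)
  finally show ?thesis .
qed

text \<open>In \<open>a = gcomp G b c\<close> with all three in \<open>A\<close>, the factor
  \<open>c\<close> shares its domain with \<open>a\<close> and \<open>b\<close> shares its range
  with \<open>a\<close>, so both equal \<open>a\<close>. Cancelling in
  \<open>gcomp G a a = a\<close> leaves an identity.\<close>

lemma idempotent_bisection_subset:
  assumes A: "bisection G A" and AA: "gsetprod G A A = A"
  shows "A \<subseteq> identities G"
proof
  fix a assume a: "a \<in> A"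
  then have "a \<in> gsetprod G A A" using AA by simp
  then obtain b c where *: "b \<in> A" "c \<in> A" "b \<in> carrier G" "c \<in> carrier G" "gdom G b = gran G c" "a = gcomp G b c"
    by (elim gsetprodE)
  have c: "c = a" by (rule bisection_eqI(1)[OF A *(2) a]) (simp add: *)
  have b: "b = a" by (rule bisection_eqI(2)[OF A *(1) a]) (simp add: *)
  have "a \<in> carrier G" "gdom G a = gran G a" "gcomp G a a = a" using *(3,5,6) unfolding b c by simp_all
  then have "gdom G a = a" using ginv_gcomp_cancel[of a a] by simp
  then show "a \<in> identities G" using \<open>a \<in> carrier G\<close> by (simp add: identities_def)
qed

end

section \<open>Open sets under the groupoid operations\<close>

context topological_groupoid
begin

lemma openin_gtop_subset: "openin (gtop G) V \<Longrightarrow> V \<subseteq> carrier G"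
  using openin_subset topspace_carrier by blast

lemma openin_preimage:
  "continuous_map (gtop G) (gtop G) f \<Longrightarrow> openin (gtop G) V \<Longrightarrow> openin (gtop G) {x \<in> carrier G. f x \<in> V}"
  using openin_continuous_map_preimage[of "gtop G" "gtop G" f V] by (simp add: topspace_carrier)

lemma gcomp_nbhd:
  assumes V: "openin (gtop G) V" "gcomp G x y \<in> V" and xy: "x \<in> carrier G" "y \<in> carrier G" "gdom G x = gran G y"
  obtains A B where "openin (gtop G) A" "openin (gtop G) B" "x \<in> A" "y \<in> B" "gsetprod G A B \<subseteq> V"
proof -
  let ?P = "prod_topology (gtop G) (gtop G)"
  have "openin (subtopology ?P (composable_pairs G))
      {p \<in> topspace (subtopology ?P (composable_pairs G)). (\<lambda>(x, y). gcomp G x y) p \<in> V}"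
    by (rule openin_continuous_map_preimage[OF continuous_gcomp V(1)])
  then obtain T where T: "openin ?P T"
    "{p \<in> topspace (subtopology ?P (composable_pairs G)). (\<lambda>(x, y). gcomp G x y) p \<in> V} = T \<inter> composable_pairs G"
    unfolding openin_subtopology by blast
  have "(x, y) \<in> {p \<in> topspace (subtopology ?P (composable_pairs G)). (\<lambda>(x, y). gcomp G x y) p \<in> V}"
    using V xy by (simp add: topspace_carrier composable_pairs_iff)
  then have "(x, y) \<in> T" unfolding T(2) by blast
  then obtain A B where AB: "openin (gtop G) A" "openin (gtop G) B" "x \<in> A" "y \<in> B" "A \<times> B \<subseteq> T"
    using T(1)[unfolded openin_prod_topology_alt, rule_format, of x y] by blast
  have "gsetprod G A B \<subseteq> V"
  proof
    fix z assume "z \<in> gsetprod G A B"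
    then obtain a b where ab: "a \<in> A" "b \<in> B" "(a, b) \<in> composable_pairs G" "z = gcomp G a b"
      unfolding mem_gsetprod by blast
    then have "(a, b) \<in> T \<inter> composable_pairs G" using AB by blast
    then show "z \<in> V" unfolding T(2)[symmetric] ab(4) by simp
  qed
  then show thesis using that AB by blast
qed

lemma openin_ginv_image:
  assumes "openin (gtop G) V" shows "openin (gtop G) (ginv G ` V)"
proof -
  have "ginv G ` V = {x \<in> carrier G. ginv G x \<in> V}"
    using openin_gtop_subset[OF assms] by (force simp: image_iff)
  then show ?thesis using openin_preimage[OF continuous_ginv assms] by simp
qed

end

context etale_groupoid
begin

text \<open>On a neighbourhood \<open>U\<close> where the domain map is injective, an arrow
  \<open>y\<close> with \<open>y\<close> and \<open>gdom G y\<close> both in \<open>U\<close> has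
  the same domain as \<open>gdom G y\<close>, hence is an identity. Such arrows form an open set
  around each identity.\<close>

lemma openin_identities: "openin (gtop G) (identities G)"
  unfolding openin_subopen[of _ "identities G"]
proof
  fix x assume x: "x \<in> identities G"
  then have "x \<in> carrier G" "gdom G x = x" by (auto simp: identities_def)
  then obtain U where U: "x \<in> U" "openin (gtop G) U"
      "homeomorphic_map (subtopology (gtop G) U) (subtopology (gtop G) (gdom G ` U)) (gdom G)"
    using gdom_local_homeomorphism by blast
  have inj: "inj_on (gdom G) U"
    using homeomorphic_imp_injective_map[OF U(3)] openin_subset[OF U(2)] by (simp add: inf.absorb2)
  let ?V = "U \<inter> {y \<in> carrier G. gdom G y \<in> U}"
  have "openin (gtop G) ?V" using U(2) openin_preimage[OF continuous_gdom] by blast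
  moreover have "x \<in> ?V" using U x by (auto simp: identities_def)
  moreover have "?V \<subseteq> identities G"
  proof
    fix y assume y: "y \<in> ?V"
    then have "gdom G y = y" using inj_onD[OF inj, of "gdom G y" y] by simp
    then show "y \<in> identities G" using y by (simp add: identities_def)
  qed
  ultimately show "\<exists>T. openin (gtop G) T \<and> x \<in> T \<and> T \<subseteq> identities G" by blast
qed

lemma openin_gdom_image:
  assumes V: "openin (gtop G) V"
  shows "openin (gtop G) (gdom G ` V)"
  unfolding openin_subopen[of _ "gdom G ` V"]
proof
  fix y assume "y \<in> gdom G ` V"
  then obtain x where x: "x \<in> V" "y = gdom G x" "x \<in> carrier G" using openin_gtop_subset[OF V] by blast
  obtain U where U: "x \<in> U" "openin (gtop G) U"
      "openin (subtopology (gtop G) (identities G)) (gdom G ` U)"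
      "homeomorphic_map (subtopology (gtop G) U) (subtopology (gtop G) (gdom G ` U)) (gdom G)"
    using gdom_local_homeomorphism[OF x(3)] by blast
  have dU: "openin (gtop G) (gdom G ` U)" using openin_trans_full[OF U(3) openin_identities] .
  have "openin (subtopology (gtop G) U) (V \<inter> U)" using V by (auto simp: openin_subtopology)
  then have "openin (subtopology (gtop G) (gdom G ` U)) (gdom G ` (V \<inter> U))"
    using homeomorphic_imp_open_map[OF U(4)] unfolding open_map_def by blast
  then have "openin (gtop G) (gdom G ` (V \<inter> U))" using openin_trans_full[OF _ dU] by blast
  then show "\<exists>T. openin (gtop G) T \<and> y \<in> T \<and> T \<subseteq> gdom G ` V" using x U(1) by blast
qed

lemma openin_gran_image:
  assumes V: "openin (gtop G) V"
  shows "openin (gtop G) (gran G ` V)"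
proof -
  have "gran G ` V = gdom G ` ginv G ` V"
    using openin_gtop_subset[OF V] by (force simp: image_image)
  then show ?thesis using openin_gdom_image[OF openin_ginv_image[OF V]] by simp
qed

text \<open>For \<open>y\<close> near \<open>gcomp G a b\<close>, openness of the range map supplies
  \<open>k\<close> in \<open>A\<close> near \<open>a\<close> with the range of \<open>y\<close>. The
  quotient of \<open>y\<close> by \<open>k\<close> is then near \<open>b\<close>, hence in
  \<open>B\<close>, and composing it with \<open>k\<close> returns \<open>y\<close>.\<close>

lemma openin_gsetprod:
  assumes A: "openin (gtop G) A" and B: "openin (gtop G) B"
  shows "openin (gtop G) (gsetprod G A B)"
  unfolding openin_subopen[of _ "gsetprod G A B"]
proof
  fix x assume "x \<in> gsetprod G A B"
  then obtain a b where ab: "a \<in> A" "b \<in> B" and S: "a \<in> carrier G" "b \<in> carrier G" "gdom G a = gran G b"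
    and x: "x = gcomp G a b" by (elim gsetprodE)
  have "gcomp G (ginv G a) x \<in> B" using S x ab by simp
  then obtain K V where KV: "openin (gtop G) K" "openin (gtop G) V" "ginv G a \<in> K" "x \<in> V" "gsetprod G K V \<subseteq> B"
    using gcomp_nbhd[OF B, of "ginv G a" x] S x by auto
  define L where "L = A \<inter> {y \<in> carrier G. ginv G y \<in> K}"
  have L: "openin (gtop G) L" unfolding L_def using A openin_preimage[OF continuous_ginv KV(1)] by blast
  let ?T = "V \<inter> {y \<in> carrier G. gran G y \<in> gran G ` L}"
  have "openin (gtop G) ?T"
    using KV(2) openin_preimage[OF continuous_gran openin_gran_image[OF L]] by blast
  moreover have "x \<in> ?T" using KV(3,4) ab S x unfolding L_def by auto
  moreover have "?T \<subseteq> gsetprod G A B"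
  proof
    fix y assume "y \<in> ?T"
    then obtain k where k: "k \<in> A" "k \<in> carrier G" "ginv G k \<in> K" "gran G y = gran G k"
      and y: "y \<in> V" "y \<in> carrier G" unfolding L_def by blast
    have "gcomp G (ginv G k) y \<in> gsetprod G K V" using k y by (intro gsetprodI) auto
    then have "gcomp G (ginv G k) y \<in> B" using KV(5) by blast
    then have "gcomp G k (gcomp G (ginv G k) y) \<in> gsetprod G A B" using k y by (intro gsetprodI) auto
    then show "y \<in> gsetprod G A B" using k y by simp
  qed
  ultimately show "\<exists>T. openin (gtop G) T \<and> x \<in> T \<and> T \<subseteq> gsetprod G A B" by blast
qed

end

section \<open>Boolean algebras of sets\<close>

lemma least_unique_set:
  assumes eq: "\<forall>x\<in>carrier L. \<forall>y\<in>carrier L. le L x y \<longrightarrow> le L y x \<longrightarrow> x = y"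
  shows "least L x A \<Longrightarrow> least L y A \<Longrightarrow> x = y" "greatest L x A \<Longrightarrow> greatest L y A \<Longrightarrow> x = y"
  using eq unfolding least_def greatest_def by (meson subsetD)+

lemma generalized_boolean_algebraI:
  fixes L :: "'a set gorder"
  assumes eq: "eq L = (=)"
    and le: "\<And>A B. \<lbrakk>A \<in> carrier L; B \<in> carrier L\<rbrakk> \<Longrightarrow> le L A B \<longleftrightarrow> A \<subseteq> B"
    and empty: "{} \<in> carrier L"
    and Un: "\<And>A B. \<lbrakk>A \<in> carrier L; B \<in> carrier L\<rbrakk> \<Longrightarrow> A \<union> B \<in> carrier L"
    and Int: "\<And>A B. \<lbrakk>A \<in> carrier L; B \<in> carrier L\<rbrakk> \<Longrightarrow> A \<inter> B \<in> carrier L"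
    and Diff: "\<And>A B. \<lbrakk>A \<in> carrier L; B \<in> carrier L\<rbrakk> \<Longrightarrow> A - B \<in> carrier L"
  shows "generalized_boolean_algebra L"
proof -
  have antisym: "\<forall>A\<in>carrier L. \<forall>B\<in>carrier L. le L A B \<longrightarrow> le L B A \<longrightarrow> A = B"
    using le by blast
  have Upper: "Upper L {A, B} = {C \<in> carrier L. A \<subseteq> C \<and> B \<subseteq> C}"
    and Lower: "Lower L {A, B} = {C \<in> carrier L. C \<subseteq> A \<and> C \<subseteq> B}"
    if "A \<in> carrier L" "B \<in> carrier L" for A B
    using that le unfolding Upper_def Lower_def by blast+
  have least: "least L (A \<union> B) (Upper L {A, B})" and greatest: "greatest L (A \<inter> B) (Lower L {A, B})"
    if "A \<in> carrier L" "B \<in> carrier L" for A B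
    using that Un[OF that] Int[OF that] unfolding Upper[OF that] Lower[OF that] least_def greatest_def
    by (simp_all add: le Collect_restrict)
  \<comment> \<open>The lattice operations are defined by choice, so they are identified through
    uniqueness of least and greatest elements.\<close>
  have join: "join L A B = A \<union> B" and meet: "meet L A B = A \<inter> B" if "A \<in> carrier L" "B \<in> carrier L" for A B
    using some_equality[where P = "\<lambda>x. least L x (Upper L {A, B})", OF least[OF that]]
      some_equality[where P = "\<lambda>x. greatest L x (Lower L {A, B})", OF greatest[OF that]]
      least_unique_set(1)[OF antisym _ least[OF that]] least_unique_set(2)[OF antisym _ greatest[OF that]]
    unfolding join_def sup_def meet_def inf_def by metis+
  have least_empty: "least L {} (carrier L)" using empty le by (simp add: least_def)
  have bottom: "bottom L = {}"
    using some_equality[where P = "\<lambda>x. least L x (carrier L)", OF least_empty]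
      least_unique_set(1)[OF antisym _ least_empty]
    unfolding bottom_def by metis
  show ?thesis
  proof unfold_locales
    show "\<exists>x. least L x (carrier L)" using least_empty by blast
  next
    fix x y assume xy: "x \<in> carrier L" "y \<in> carrier L"
    show "\<exists>s. least L s (Upper L {x, y})" "\<exists>s. greatest L s (Lower L {x, y})"
      using least[OF xy] greatest[OF xy] by blast+
  next
    fix x y z assume "x \<in> carrier L" "y \<in> carrier L" "z \<in> carrier L"
    then show "x \<sqinter>\<^bsub>L\<^esub> (y \<squnion>\<^bsub>L\<^esub> z) = (x \<sqinter>\<^bsub>L\<^esub> y) \<squnion>\<^bsub>L\<^esub> (x \<sqinter>\<^bsub>L\<^esub> z)"
      by (simp add: join meet Un Int Int_Un_distrib)
  next
    fix x y assume "x \<in> carrier L" "y \<in> carrier L" "x \<sqsubseteq>\<^bsub>L\<^esub> y"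
    then show "\<exists>z\<in>carrier L. x \<sqinter>\<^bsub>L\<^esub> z = \<bottom>\<^bsub>L\<^esub> \<and> x \<squnion>\<^bsub>L\<^esub> z = y"
      using Diff[of y x] by (intro bexI[of _ "y - x"]) (auto simp: join meet bottom le)
  qed (use le in \<open>auto simp: eq\<close>)
qed

section \<open>The inverse semigroup of compact-open bisections\<close>

context boolean_groupoid
begin

abbreviation KBset :: "'g set set" where "KBset \<equiv> carrier (KB G)"

lemma KB_iff: "A \<in> KBset \<longleftrightarrow> openin (gtop G) A \<and> compactin (gtop G) A \<and> bisection G A"
  and mult_KB [simp]: "mult (KB G) = gsetprod G"
  by (simp_all add: compact_open_bisections_def)

lemma KB_subset: "A \<in> KBset \<Longrightarrow> A \<subseteq> carrier G"
  by (simp add: KB_iff bisection_iff)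

lemma KB_subset': "A \<in> KBset \<Longrightarrow> a \<in> A \<Longrightarrow> a \<in> carrier G"
  using KB_subset by blast

text \<open>Composable pairs form the equaliser of two continuous maps into the unit space, which is
  Hausdorff.\<close>

lemma closedin_composable: "closedin (prod_topology (gtop G) (gtop G)) (composable_pairs G)"
proof -
  let ?P = "prod_topology (gtop G) (gtop G)" and ?I = "subtopology (gtop G) (identities G)"
  have "continuous_map ?P ?I (gdom G \<circ> fst)"
    using continuous_map_compose[OF continuous_map_fst continuous_gdom]
    by (auto simp: continuous_map_in_subtopology topspace_carrier)
  moreover have "continuous_map ?P ?I (gran G \<circ> snd)"
    using continuous_map_compose[OF continuous_map_snd continuous_gran]
    by (auto simp: continuous_map_in_subtopology topspace_carrier)
  ultimately have "closedin ?P {p \<in> topspace ?P. (gdom G \<circ> fst) p = (gran G \<circ> snd) p}"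
    by (rule closedin_continuous_maps_eq[OF hausdorff_identities])
  moreover have "{p \<in> topspace ?P. (gdom G \<circ> fst) p = (gran G \<circ> snd) p} = composable_pairs G"
    by (auto simp: composable_pairs_iff topspace_carrier)
  ultimately show ?thesis by simp
qed

text \<open>The composable part of \<open>A \<times> B\<close> is closed in a compact set, and
  composition maps it continuously onto the product.\<close>

lemma compactin_gsetprod:
  assumes "compactin (gtop G) A" "compactin (gtop G) B"
  shows "compactin (gtop G) (gsetprod G A B)"
proof -
  let ?P = "prod_topology (gtop G) (gtop G)"
  have "compactin ?P (composable_pairs G \<inter> A \<times> B)"
    using assms by (intro closed_Int_compactin closedin_composable) (simp add: compactin_Times)
  then have "compactin (subtopology ?P (composable_pairs G)) (composable_pairs G \<inter> A \<times> B)"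
    by (simp add: compactin_subtopology)
  from image_compactin[OF this continuous_gcomp]
  have "compactin (gtop G) ((\<lambda>(x, y). gcomp G x y) ` (composable_pairs G \<inter> A \<times> B))" .
  moreover have "(\<lambda>(x, y). gcomp G x y) ` (composable_pairs G \<inter> A \<times> B) = gsetprod G A B"
    by (force simp: gsetprod_def)
  ultimately show ?thesis by simp
qed

lemma KB_mult_closed: "A \<in> KBset \<Longrightarrow> B \<in> KBset \<Longrightarrow> gsetprod G A B \<in> KBset"
  by (simp add: KB_iff openin_gsetprod compactin_gsetprod bisection_gsetprod)

lemma KB_ginv_closed: "A \<in> KBset \<Longrightarrow> ginv G ` A \<in> KBset"
  using image_compactin[OF _ continuous_ginv] by (simp add: KB_iff openin_ginv_image bisection_ginv)

lemma KB_gdom_closed: "A \<in> KBset \<Longrightarrow> gdom G ` A \<in> KBset"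
  using KB_mult_closed[OF KB_ginv_closed] gsetprod_ginv_left KB_iff by metis

lemma KB_regular:
  assumes "A \<in> KBset"
  shows "gsetprod G A (gsetprod G (ginv G ` A) A) = A"
  using assms gsetprod_ginv_left[of A] gsetprod_dom_subset[of A A] by (simp add: KB_iff)

lemma idempotent_KB: "A \<in> idempotents (KB G) \<longleftrightarrow> openin (gtop G) A \<and> compactin (gtop G) A \<and> A \<subseteq> identities G"
proof
  assume "A \<in> idempotents (KB G)"
  then show "openin (gtop G) A \<and> compactin (gtop G) A \<and> A \<subseteq> identities G"
    using idempotent_bisection_subset by (auto simp: idempotents_def KB_iff)
next
  assume A: "openin (gtop G) A \<and> compactin (gtop G) A \<and> A \<subseteq> identities G"
  then have e: "gdom G x = x \<and> gran G x = x" if "x \<in> A" for x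
    using that by (auto simp: identities_iff)
  have "bisection G A"
    unfolding bisection_iff using A e openin_gtop_subset by (auto intro!: inj_onI)
  moreover have "gsetprod G A A = A" using A gsetprod_identities[of A A] openin_gtop_subset
    by (auto simp: identities_def)
  ultimately show "A \<in> idempotents (KB G)" using A by (auto simp: idempotents_def KB_iff)
qed

lemma inverse_semigroup_KB: "inverse_semigroup (KB G)"
proof (rule inverse_semigroupI)
  fix A assume A: "A \<in> KBset"
  have "is_inverse (KB G) A (ginv G ` A)"
    using KB_regular[OF A] KB_regular[OF KB_ginv_closed[OF A]] KB_subset[OF A]
      KB_subset[OF KB_ginv_closed[OF A]] KB_ginv_closed[OF A]
    by (simp add: is_inverse_def gsetprod_assoc)
  then show "\<exists>B. is_inverse (KB G) A B" by blast
next
  fix A B assume "A \<in> idempotents (KB G)" "B \<in> idempotents (KB G)"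
  then have *: "A \<subseteq> identities G" "B \<subseteq> identities G" by (auto simp: idempotent_KB)
  have "gsetprod G A B = A \<inter> B" if "A \<subseteq> identities G" "B \<subseteq> identities G" for A B
  proof -
    have "A \<subseteq> carrier G" "\<forall>a\<in>A. gdom G a = a" using that by (auto simp: identities_def)
    then show ?thesis using gsetprod_identities[of A B] that by auto
  qed
  then show "mult (KB G) A B = mult (KB G) B A" using * by auto
qed (use KB_mult_closed gsetprod_assoc KB_subset in auto)

lemma sinv_KB:
  assumes A: "A \<in> KBset"
  shows "sinv (KB G) A = ginv G ` A"
proof -
  interpret M: inverse_semigroup "KB G" by (rule inverse_semigroup_KB)
  show ?thesis
    using KB_regular[OF A] KB_regular[OF KB_ginv_closed[OF A]] A KB_subset[OF A] KB_ginv_closed[OF A]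
    by (intro M.sinv_eqI) simp_all
qed

lemma sle_KB_iff:
  assumes A: "A \<in> KBset" and B: "B \<in> KBset"
  shows "sle (KB G) A B \<longleftrightarrow> A \<subseteq> B"
proof
  assume "sle (KB G) A B"
  then obtain I where "I \<in> idempotents (KB G)" "A = gsetprod G B I" by (auto simp: sle_def)
  then show "A \<subseteq> B" using gsetprod_identities[OF KB_subset[OF B]] by (auto simp: idempotent_KB)
next
  assume "A \<subseteq> B"
  then have "A = gsetprod G B (gdom G ` A)" using gsetprod_dom_subset[of B A] B by (simp add: KB_iff)
  moreover have "gdom G ` A \<in> idempotents (KB G)"
    using KB_gdom_closed[OF A] KB_subset[OF A] by (auto simp: idempotent_KB KB_iff)
  ultimately show "sle (KB G) A B" by (auto simp: sle_def)
qed

text \<open>The substantial point is closure under finite compatible unions: compatibility says that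
  quotients across two members are identities, so the domain and range maps stay injective on the
  whole union.\<close>

lemma set_inverse_semigroup_KB: "set_inverse_semigroup (KB G) {}"
proof -
  interpret M: inverse_semigroup "KB G" by (rule inverse_semigroup_KB)
  show ?thesis
  proof (unfold_locales, goal_cases)
    case 1 then show ?case by (simp add: KB_iff bisection_iff)
  next
    case (2 A) then show ?case by simp
  next
    case (3 A B) then show ?case by (rule sle_KB_iff)
  next
    case (4 \<A>)
    then have A: "A \<in> KBset" if "A \<in> \<A>" for A using that by (auto simp: compatible_set_def)
    have quot: "gsetprod G (ginv G ` A) B \<subseteq> identities G" "gsetprod G A (ginv G ` B) \<subseteq> identities G"
      if "A \<in> \<A>" "B \<in> \<A>" for A B
    proof -
      have "compatible (KB G) A B" using 4 that by (auto simp: compatible_set_def)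
      then show "gsetprod G (ginv G ` A) B \<subseteq> identities G" "gsetprod G A (ginv G ` B) \<subseteq> identities G"
        using A that by (auto simp: compatible_def sinv_KB idempotent_KB)
    qed
    have d: "x = y" if "x \<in> A" "y \<in> B" "A \<in> \<A>" "B \<in> \<A>" "gdom G x = gdom G y" for x y A B
    proof (rule eq_if_right_quotient)
      show S: "x \<in> carrier G" "y \<in> carrier G" using that A KB_subset' by blast+
      have "gcomp G x (ginv G y) \<in> gsetprod G A (ginv G ` B)" using that S by (intro gsetprodI) auto
      then show "gcomp G x (ginv G y) \<in> identities G" using quot that by blast
    qed (use that in auto)
    have r: "x = y" if "x \<in> A" "y \<in> B" "A \<in> \<A>" "B \<in> \<A>" "gran G x = gran G y" for x y A B
    proof (rule eq_if_left_quotient)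
      show S: "x \<in> carrier G" "y \<in> carrier G" using that A KB_subset' by blast+
      have "gcomp G (ginv G x) y \<in> gsetprod G (ginv G ` A) B" using that S by (intro gsetprodI) auto
      then show "gcomp G (ginv G x) y \<in> identities G" using quot that by blast
    qed (use that in auto)
    have "inj_on (gdom G) (\<Union>\<A>)" "inj_on (gran G) (\<Union>\<A>)"
      using d r by (auto intro!: inj_onI)
    moreover have "\<Union>\<A> \<subseteq> carrier G" using A KB_subset by blast
    ultimately have "bisection G (\<Union>\<A>)"
      unfolding bisection_iff by blast
    then show ?case using A 4(1) by (simp add: KB_iff openin_Union compactin_Union)
  next
    case (5 \<A> C)
    then show ?case unfolding mult_KB gsetprod_def by blast
  next
    case (6 \<A> C)
    then show ?case unfolding mult_KB gsetprod_def by blast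
  qed
qed

lemma openin_identities_Diff:
  assumes "compactin (gtop G) B" "B \<subseteq> identities G"
  shows "openin (gtop G) (identities G - B)"
proof -
  have "compactin (subtopology (gtop G) (identities G)) B" using assms by (simp add: compactin_subtopology)
  then have "closedin (subtopology (gtop G) (identities G)) B"
    by (rule compactin_imp_closedin[OF hausdorff_identities])
  then have "openin (subtopology (gtop G) (identities G)) (identities G - B)"
    using openin_subset[OF openin_identities] by (simp add: closedin_def inf.absorb2)
  then show ?thesis using openin_trans_full openin_identities by blast
qed

lemma compactin_Diff_openin:
  assumes "compactin (gtop G) A" "openin (gtop G) B"
  shows "compactin (gtop G) (A - B)"
proof -
  have "compactin (gtop G) ((topspace (gtop G) - B) \<inter> A)"
    using assms by (intro closed_Int_compactin) (auto intro: closedin_diff)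
  moreover have "(topspace (gtop G) - B) \<inter> A = A - B"
    using compactin_subset_topspace[OF assms(1)] by blast
  ultimately show ?thesis by simp
qed

text \<open>Inside the bisection \<open>A\<close>, the points outside \<open>B\<close> are those
  whose domains avoid the image of \<open>B\<close> in the unit space. That image is compact, hence
  closed among the identities, which makes \<open>A - B\<close> open even though \<open>G\<close>
  may fail to be Hausdorff.\<close>

lemma KB_Diff:
  assumes A: "A \<in> KBset" and B: "B \<in> KBset" "B \<subseteq> A"
  shows "A - B \<in> KBset"
proof -
  have dB: "gdom G ` B \<subseteq> identities G" using KB_subset[OF B(1)] by auto
  have "compactin (gtop G) (gdom G ` B)" using KB_gdom_closed[OF B(1)] by (simp add: KB_iff)
  then have "openin (gtop G) (A \<inter> {x \<in> carrier G. gdom G x \<in> identities G - gdom G ` B})"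
    using A openin_preimage[OF continuous_gdom openin_identities_Diff[OF _ dB]] by (auto simp: KB_iff)
  moreover have "A \<inter> {x \<in> carrier G. gdom G x \<in> identities G - gdom G ` B} = A - B"
    using A B by (auto simp: KB_iff bisection_iff dest: inj_onD)
  moreover have "bisection G (A - B)" using A by (auto simp: KB_iff bisection_iff intro: inj_on_diff)
  ultimately show ?thesis
    using A B compactin_Diff_openin by (simp add: KB_iff)
qed

lemma weakly_boolean_KB: "weakly_boolean_inverse_semigroup (KB G)"
proof -
  interpret M: set_inverse_semigroup "KB G" "{}" by (rule set_inverse_semigroup_KB)
  have Diff: "A - B \<in> idempotents (KB G)" if "A \<in> idempotents (KB G)" "B \<in> idempotents (KB G)" for A B
  proof -
    have "A - B = A \<inter> (identities G - B)" using that by (auto simp: idempotent_KB)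
    then have "openin (gtop G) (A - B)"
      using that openin_identities_Diff[of B] openin_Int[of "gtop G" A "identities G - B"] by (simp add: idempotent_KB)
    then show ?thesis using that compactin_Diff_openin by (auto simp: idempotent_KB)
  qed
  have "generalized_boolean_algebra (idempotent_order (KB G))"
  proof (rule generalized_boolean_algebraI; simp add: idempotent_order_def)
    fix A B assume *: "A \<in> idempotents (KB G)" "B \<in> idempotents (KB G)"
    then show "sle (KB G) A B \<longleftrightarrow> A \<subseteq> B" using sle_KB_iff by simp
    show "A \<union> B \<in> idempotents (KB G)" using * by (auto simp: idempotent_KB compactin_Un)
    \<comment> \<open>Two applications of closure under differences give compactness of the
      intersection.\<close>
    have "A \<inter> B = A - (A - B)" by blast
    then show "A \<inter> B \<in> idempotents (KB G)" using Diff[OF *(1) Diff[OF *]] by simp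
    show "A - B \<in> idempotents (KB G)" by (rule Diff[OF *])
  next
    show "{} \<in> idempotents (KB G)" by (simp add: idempotent_KB)
  qed
  then show ?thesis
    unfolding weakly_boolean_inverse_semigroup_def using M.distributive_inverse_semigroup by blast
qed

section \<open>Points and prime filters of bisections\<close>

definition point_filter :: "'g \<Rightarrow> 'g set set" where
  "point_filter x = {A \<in> KBset. x \<in> A}"

lemma KB_base_subset:
  assumes "openin (gtop G) V" "x \<in> V"
  obtains A where "A \<in> KBset" "x \<in> A" "A \<subseteq> V"
  using KB_base[OF assms] by blast

lemma is_prime_filter_KB_iff:
  "is_prime_filter (KB G) F \<longleftrightarrow> F \<subseteq> KBset \<and> F \<noteq> {} \<and> {} \<notin> F \<and>
     (\<forall>A\<in>F. \<forall>B\<in>KBset. A \<subseteq> B \<longrightarrow> B \<in> F) \<and>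
     (\<forall>A\<in>F. \<forall>B\<in>F. \<exists>C\<in>F. C \<subseteq> A \<and> C \<subseteq> B) \<and>
     (\<forall>A\<in>KBset. \<forall>B\<in>KBset. A \<union> B \<in> F \<longrightarrow> A \<in> F \<or> B \<in> F)"
  by (rule set_inverse_semigroup.is_prime_filter_iff[OF set_inverse_semigroup_KB])

lemma prime_point_filter:
  assumes x: "x \<in> carrier G"
  shows "is_prime_filter (KB G) (point_filter x)"
  unfolding is_prime_filter_KB_iff
proof (intro conjI ballI impI)
  obtain A where "A \<in> KBset" "x \<in> A" "A \<subseteq> carrier G"
    using KB_base_subset[of "carrier G" x] x openin_topspace[of "gtop G"] by (auto simp: topspace_carrier)
  then show "point_filter x \<noteq> {}" by (auto simp: point_filter_def)
next
  fix A B assume "A \<in> point_filter x" "B \<in> point_filter x"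
  then have "openin (gtop G) (A \<inter> B)" "x \<in> A \<inter> B" by (auto simp: point_filter_def KB_iff)
  then obtain C where "C \<in> KBset" "x \<in> C" "C \<subseteq> A \<inter> B" by (rule KB_base_subset)
  then show "\<exists>C\<in>point_filter x. C \<subseteq> A \<and> C \<subseteq> B" by (auto simp: point_filter_def)
qed (auto simp: point_filter_def)

text \<open>Equal filters put \<open>x\<close> and \<open>y\<close> into a common bisection, where
  they are determined by their domains. Distinct domains would be separated by disjoint open sets of
  identities, and a basic bisection with domains in one of them would contain \<open>x\<close> but
  not \<open>y\<close>.\<close>

lemma inj_point_filter: "inj_on point_filter (carrier G)"
proof (rule inj_onI)
  fix x y assume x: "x \<in> carrier G" and y: "y \<in> carrier G" and eq: "point_filter x = point_filter y"
  obtain A where A: "A \<in> KBset" "x \<in> A" "A \<subseteq> carrier G"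
    using KB_base_subset[of "carrier G" x] x openin_topspace[of "gtop G"] by (auto simp: topspace_carrier)
  then have yA: "y \<in> A" using eq by (auto simp: point_filter_def)
  have "gdom G x = gdom G y"
  proof (rule ccontr)
    assume "gdom G x \<noteq> gdom G y"
    moreover have "gdom G x \<in> topspace (subtopology (gtop G) (identities G))"
      "gdom G y \<in> topspace (subtopology (gtop G) (identities G))"
      using x y by (auto simp: topspace_carrier)
    ultimately obtain U V where UV: "openin (subtopology (gtop G) (identities G)) U"
        "gdom G x \<in> U" "gdom G y \<in> V" "disjnt U V"
      using hausdorff_identities unfolding Hausdorff_space_def by meson
    then have "openin (gtop G) U" using openin_trans_full openin_identities by blast
    then have "openin (gtop G) {z \<in> carrier G. gdom G z \<in> U}" by (rule openin_preimage[OF continuous_gdom])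
    then obtain B where "B \<in> KBset" "x \<in> B" "B \<subseteq> {z \<in> carrier G. gdom G z \<in> U}"
      using KB_base_subset x UV(2) by blast
    moreover from this have "y \<in> B" using eq by (auto simp: point_filter_def)
    ultimately show False using UV by (auto simp: disjnt_iff)
  qed
  then show "x = y" using A yA by (auto simp: KB_iff bisection_iff dest: inj_onD)
qed

text \<open>If no point lay in all members of a prime filter, then finitely many sets \<open>A - B\<close> with
  \<open>B\<close> in the filter would cover a fixed compact member \<open>A\<close>, and a common lower bound of these
  \<open>B\<close> would be empty.\<close>

lemma prime_filter_KB_is_point_filter:
  assumes F: "is_prime_filter (KB G) F"
  obtains x where "x \<in> carrier G" "F = point_filter x"
proof -
  have sub: "F \<subseteq> KBset" and ne: "F \<noteq> {}" "{} \<notin> F" and up: "\<And>A B. A \<in> F \<Longrightarrow> B \<in> KBset \<Longrightarrow> A \<subseteq> B \<Longrightarrow> B \<in> F"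
    and dir: "\<And>A B. A \<in> F \<Longrightarrow> B \<in> F \<Longrightarrow> \<exists>C\<in>F. C \<subseteq> A \<and> C \<subseteq> B"
    and prime: "\<And>A B. A \<in> KBset \<Longrightarrow> B \<in> KBset \<Longrightarrow> A \<union> B \<in> F \<Longrightarrow> A \<in> F \<or> B \<in> F"
    using F unfolding is_prime_filter_KB_iff by simp_all
  obtain A where A: "A \<in> F" using ne by blast
  then have AK: "A \<in> KBset" using sub by blast
  have fin: "\<exists>C\<in>F. C \<subseteq> A \<and> (\<forall>B\<in>\<B>. C \<subseteq> B)" if "finite \<B>" "\<B> \<subseteq> F" for \<B>
    using that
  proof induction
    case empty
    then show ?case using A by blast
  next
    case (insert B \<B>)
    then obtain C where C: "C \<in> F" "C \<subseteq> A" "\<forall>B\<in>\<B>. C \<subseteq> B" by blast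
    moreover obtain C' where C': "C' \<in> F" "C' \<subseteq> C" "C' \<subseteq> B" using dir[OF C(1), of B] insert.prems by blast
    ultimately have "C' \<subseteq> A" "\<forall>B'\<in>insert B \<B>. C' \<subseteq> B'" by auto
    then show ?case using C' by blast
  qed
  have "\<exists>x\<in>A. \<forall>B\<in>F. B \<subseteq> A \<longrightarrow> x \<in> B"
  proof (rule ccontr)
    assume contra: "\<not> (\<exists>x\<in>A. \<forall>B\<in>F. B \<subseteq> A \<longrightarrow> x \<in> B)"
    \<comment> \<open>Restricting to members inside \<open>A\<close> makes each \<open>A - B\<close>
      open by \<open>KB_Diff\<close>.\<close>
    let ?\<B> = "{B \<in> F. B \<subseteq> A}"
    have op: "openin (gtop G) U" if "U \<in> (\<lambda>B. A - B) ` ?\<B>" for U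
      using that KB_Diff[OF AK] sub by (auto simp: KB_iff)
    have cover: "A \<subseteq> \<Union>((\<lambda>B. A - B) ` ?\<B>)" using contra by blast
    have "compactin (gtop G) A" using AK by (simp add: KB_iff)
    from compactinD[OF this op cover]
    obtain \<F> where \<F>: "finite \<F>" "\<F> \<subseteq> (\<lambda>B. A - B) ` ?\<B>" "A \<subseteq> \<Union>\<F>"
      by blast
    obtain \<B> where \<B>: "finite \<B>" "\<B> \<subseteq> ?\<B>" "\<F> = (\<lambda>B. A - B) ` \<B>"
      using finite_subset_image[OF \<F>(1,2)] by blast
    then obtain C where "C \<in> F" "C \<subseteq> A" "\<forall>B\<in>\<B>. C \<subseteq> B" using fin[of \<B>] by blast
    then have "C = {}" using \<F>(3) \<B>(3) by blast
    then show False using ne \<open>C \<in> F\<close> by simp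
  qed
  then obtain x where x: "x \<in> A" "\<And>B. B \<in> F \<Longrightarrow> B \<subseteq> A \<Longrightarrow> x \<in> B" by blast
  have "F = point_filter x"
  proof (intro equalityI subsetI)
    fix B assume B: "B \<in> F"
    then obtain C where "C \<in> F" "C \<subseteq> A" "C \<subseteq> B" using dir[OF A] by blast
    then show "B \<in> point_filter x" using x sub B by (auto simp: point_filter_def)
  next
    fix B assume "B \<in> point_filter x"
    then have B: "B \<in> KBset" "x \<in> B" by (auto simp: point_filter_def)
    then have "openin (gtop G) (A \<inter> B)" "x \<in> A \<inter> B" using AK x by (auto simp: KB_iff)
    then obtain C where C: "C \<in> KBset" "x \<in> C" "C \<subseteq> A \<inter> B" by (rule KB_base_subset)
    \<comment> \<open>Primeness is applied to this splitting of \<open>A\<close>: the part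
      \<open>A - C\<close> omits \<open>x\<close>, which lies in all members of \<open>F\<close>
      inside \<open>A\<close>, so \<open>C\<close> must be the one in \<open>F\<close>.\<close>
    then have "A - C \<in> KBset" "C \<union> (A - C) = A" using KB_Diff[OF AK] by auto
    then have "C \<in> F \<or> A - C \<in> F" using prime[OF C(1)] A by simp
    then have "C \<in> F" using x(2)[of "A - C"] C by blast
    then show "B \<in> F" using up B C by blast
  qed
  moreover have "x \<in> carrier G" using x KB_subset'[OF AK] by blast
  ultimately show thesis using that by blast
qed

lemma point_filter_image: "point_filter ` carrier G = {F. is_prime_filter (KB G) F}"
  using prime_point_filter prime_filter_KB_is_point_filter by (auto simp: image_iff) metis

lemma point_filter_image_KB:
  assumes "A \<in> KBset"
  shows "point_filter ` A = Y_set (KB G) A"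
proof (intro equalityI subsetI)
  fix F assume "F \<in> point_filter ` A"
  then show "F \<in> Y_set (KB G) A"
    using assms KB_subset' prime_point_filter by (auto simp: Y_set_def point_filter_def)
next
  fix F assume "F \<in> Y_set (KB G) A"
  then have F: "is_prime_filter (KB G) F" "A \<in> F" by (auto simp: Y_set_def)
  obtain x where "x \<in> carrier G" "F = point_filter x" using prime_filter_KB_is_point_filter[OF F(1)] .
  then show "F \<in> point_filter ` A" using F(2) by (auto simp: point_filter_def)
qed

text \<open>A compact-open bisection \<open>A\<close> corresponds to \<open>Y_set (KB G) A\<close>;
  the former sets are a base of the source topology and the latter generate the target
  topology.\<close>

lemma homeomorphic_point_filter:
  "homeomorphic_map (gtop G) (gtop (G\<^sub>P (KB G))) point_filter"
proof -
  have T: "gtop (G\<^sub>P (KB G)) = topology_generated_by {Y_set (KB G) A | A. A \<in> KBset}"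
    by (simp add: prime_filter_groupoid_def filter_groupoid_def)
  have ts: "\<Union>{Y_set (KB G) A | A. A \<in> KBset} = {F. is_prime_filter (KB G) F}"
    unfolding Y_set_def is_prime_filter_KB_iff by blast
  show ?thesis
  proof (rule bijective_open_imp_homeomorphic_map)
    show "continuous_map (gtop G) (gtop (G\<^sub>P (KB G))) point_filter"
      unfolding T continuous_on_generated_topo_iff ts topspace_carrier
    proof (intro conjI allI impI)
      fix U assume "U \<in> {Y_set (KB G) A | A. A \<in> KBset}"
      then obtain A where A: "A \<in> KBset" "U = Y_set (KB G) A" by blast
      then have "point_filter -` U \<inter> carrier G = A"
        using prime_point_filter KB_subset' by (auto simp: Y_set_def point_filter_def)
      then show "openin (gtop G) (point_filter -` U \<inter> carrier G)" using A by (simp add: KB_iff)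
    qed (use point_filter_image in blast)
    show "open_map (gtop G) (gtop (G\<^sub>P (KB G))) point_filter"
      unfolding open_map_def
    proof (intro allI impI)
      fix V assume V: "openin (gtop G) V"
      have "point_filter ` V = \<Union>{Y_set (KB G) A | A. A \<in> KBset \<and> A \<subseteq> V}" (is "_ = \<Union>?Y")
      proof -
        have "V = \<Union>{A \<in> KBset. A \<subseteq> V}" using KB_base_subset[OF V] by blast
        then have "point_filter ` V = (\<Union>A\<in>{A \<in> KBset. A \<subseteq> V}. point_filter ` A)" by (metis image_Union)
        also have "\<dots> = (\<Union>A\<in>{A \<in> KBset. A \<subseteq> V}. Y_set (KB G) A)" using point_filter_image_KB by simp
        also have "\<dots> = \<Union>?Y" by blast
        finally show ?thesis .
      qed
      moreover have "openin (gtop (G\<^sub>P (KB G))) (\<Union>?Y)"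
        unfolding T by (intro openin_Union topology_generated_by_Basis) blast
      ultimately show "openin (gtop (G\<^sub>P (KB G))) (point_filter ` V)" by simp
    qed
    show "point_filter ` topspace (gtop G) = topspace (gtop (G\<^sub>P (KB G)))"
      unfolding T topology_generated_by_topspace ts topspace_carrier by (rule point_filter_image)
    show "inj_on point_filter (topspace (gtop G))"
      unfolding topspace_carrier by (rule inj_point_filter)
  qed
qed

lemmas mem_upset_KB = set_inverse_semigroup.mem_upset_iff[OF set_inverse_semigroup_KB]

text \<open>Given a bisection around the composite, continuity of composition and the base of
  compact-open bisections provide factors around \<open>x\<close> and \<open>y\<close> whose product
  lies inside it.\<close>

lemma point_filter_gcomp:
  assumes x: "x \<in> carrier G" and y: "y \<in> carrier G" and xy: "gdom G x = gran G y"
  shows "point_filter (gcomp G x y) = upset (KB G) (setprod (KB G) (point_filter x) (point_filter y))"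
proof -
  have K: "setprod (KB G) (point_filter x) (point_filter y) \<subseteq> KBset"
    using KB_mult_closed by (auto simp: setprod_def point_filter_def)
  show ?thesis
  proof (intro Set.set_eqI iffI)
    fix C assume "C \<in> point_filter (gcomp G x y)"
    then have C: "C \<in> KBset" "openin (gtop G) C" "gcomp G x y \<in> C" by (auto simp: point_filter_def KB_iff)
    obtain U V where UV: "openin (gtop G) U" "openin (gtop G) V" "x \<in> U" "y \<in> V" "gsetprod G U V \<subseteq> C"
      using gcomp_nbhd[OF C(2,3) x y xy] .
    obtain A where A: "A \<in> KBset" "x \<in> A" "A \<subseteq> U" using KB_base_subset UV(1,3) .
    obtain B where B: "B \<in> KBset" "y \<in> B" "B \<subseteq> V" using KB_base_subset UV(2,4) .
    have "gsetprod G A B \<subseteq> C" using UV(5) A(3) B(3) unfolding gsetprod_def by blast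
    moreover have "gsetprod G A B \<in> setprod (KB G) (point_filter x) (point_filter y)"
      unfolding setprod_def mult_KB using A B by (force simp: point_filter_def)
    ultimately show "C \<in> upset (KB G) (setprod (KB G) (point_filter x) (point_filter y))"
      unfolding mem_upset_KB[OF K] using C by blast
  next
    fix C assume "C \<in> upset (KB G) (setprod (KB G) (point_filter x) (point_filter y))"
    then obtain A B where C: "C \<in> KBset" "x \<in> A" "y \<in> B" "gsetprod G A B \<subseteq> C"
      unfolding mem_upset_KB[OF K] by (auto simp: setprod_def point_filter_def)
    then have "gcomp G x y \<in> gsetprod G A B" using x y xy by (intro gsetprodI)
    then show "C \<in> point_filter (gcomp G x y)" using C by (auto simp: point_filter_def)
  qed
qed

lemma point_filter_ginv:
  assumes x: "x \<in> carrier G"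
  shows "sinv (KB G) ` point_filter x = point_filter (ginv G x)"
proof (intro equalityI subsetI)
  fix B assume "B \<in> sinv (KB G) ` point_filter x"
  then obtain A where "A \<in> KBset" "x \<in> A" "B = ginv G ` A" using sinv_KB by (auto simp: point_filter_def)
  then show "B \<in> point_filter (ginv G x)" using KB_ginv_closed by (auto simp: point_filter_def)
next
  fix B assume "B \<in> point_filter (ginv G x)"
  then have B: "B \<in> KBset" "ginv G x \<in> B" by (auto simp: point_filter_def)
  have "x \<in> ginv G ` B" using imageI[OF B(2), of "ginv G"] x by simp
  then have "ginv G ` B \<in> point_filter x" using KB_ginv_closed[OF B(1)] by (simp add: point_filter_def)
  moreover have "sinv (KB G) (ginv G ` B) = B"
    using sinv_KB[OF KB_ginv_closed[OF B(1)]] KB_subset[OF B(1)] by simp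
  ultimately show "B \<in> sinv (KB G) ` point_filter x" by (metis imageI)
qed

text \<open>Domain and range are composites of \<open>x\<close> with its inverse, so
  \<open>point_filter_gcomp\<close> applies.\<close>

lemma point_filter_gdom_gran:
  assumes x: "x \<in> carrier G"
  shows "point_filter (gdom G x) = upset (KB G) (setprod (KB G) (sinv (KB G) ` point_filter x) (point_filter x))"
    and "point_filter (gran G x) = upset (KB G) (setprod (KB G) (point_filter x) (sinv (KB G) ` point_filter x))"
  using point_filter_gcomp[of "ginv G x" x] point_filter_gcomp[of x "ginv G x"] x
  by (simp_all add: point_filter_ginv)

lemma groupoid_homeomorphic_prime_filters: "groupoid_homeomorphic G (G\<^sub>P (KB G))"
proof (rule groupoid_homeomorphicI[OF topological_groupoid_axioms homeomorphic_point_filter])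
  show "carrier (G\<^sub>P (KB G)) = point_filter ` carrier G"
    by (simp add: prime_filter_groupoid_def filter_groupoid_def point_filter_image)
qed (simp_all add: prime_filter_groupoid_def filter_groupoid_def point_filter_gdom_gran point_filter_gcomp)

end

section \<open>Filters as prime filters of ideals\<close>

context inverse_semigroup_with_zero
begin

definition ideal_filter :: "'a set \<Rightarrow> 'a set set" where
  "ideal_filter F = {I \<in> carrier (\<D> S). I \<inter> F \<noteq> {}}"

lemma is_prime_filter_ideals_iff:
  "is_prime_filter (\<D> S) P \<longleftrightarrow> P \<subseteq> carrier (\<D> S) \<and> P \<noteq> {} \<and> {\<zero>} \<notin> P \<and>
     (\<forall>I\<in>P. \<forall>J\<in>carrier (\<D> S). I \<subseteq> J \<longrightarrow> J \<in> P) \<and>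
     (\<forall>I\<in>P. \<forall>J\<in>P. \<exists>K\<in>P. K \<subseteq> I \<and> K \<subseteq> J) \<and>
     (\<forall>I\<in>carrier (\<D> S). \<forall>J\<in>carrier (\<D> S). I \<union> J \<in> P \<longrightarrow> I \<in> P \<or> J \<in> P)"
  by (rule set_inverse_semigroup.is_prime_filter_iff[OF set_inverse_semigroup_ideals])

lemma mem_principal_ideal: "a \<in> carrier S \<Longrightarrow> a \<in> downset S {a}"
  by (simp add: downset_iff)

text \<open>If anything below \<open>a\<close> lies in \<open>F\<close>, upward closure puts
  \<open>a\<close> there too. Hence the principal ideals in \<open>ideal_filter F\<close> recover
  \<open>F\<close>.\<close>

lemma principal_ideal_mem_iff:
  assumes "is_filter S F" "a \<in> carrier S"
  shows "downset S {a} \<in> ideal_filter F \<longleftrightarrow> a \<in> F"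
proof
  assume "downset S {a} \<in> ideal_filter F"
  then obtain y where "y \<in> downset S {a}" "y \<in> F" unfolding ideal_filter_def by blast
  then show "a \<in> F" using filter_up[OF assms(1)] assms(2) by (auto elim!: downsetE)
next
  assume "a \<in> F"
  then show "downset S {a} \<in> ideal_filter F"
    using mem_principal_ideal[OF assms(2)] principal_ideal[OF assms(2)] unfolding ideal_filter_def by blast
qed

lemma principal_ideal_subset: "I \<in> carrier (\<D> S) \<Longrightarrow> a \<in> I \<Longrightarrow> downset S {a} \<subseteq> I"
  using ideal_down by (auto elim!: downsetE)

text \<open>Primeness is immediate because a union meets \<open>F\<close> only if one of its parts
  does. Directedness is witnessed by a principal ideal, generated by a common lower bound in
  \<open>F\<close>.\<close>

lemma prime_ideal_filter:
  assumes F: "is_filter S F"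
  shows "is_prime_filter (\<D> S) (ideal_filter F)"
  unfolding is_prime_filter_ideals_iff
proof (intro conjI ballI impI)
  obtain a where "a \<in> F" "a \<in> carrier S" using filter_nonempty[OF F] .
  then show "ideal_filter F \<noteq> {}" using principal_ideal_mem_iff[OF F] by blast
  show "{\<zero>} \<notin> ideal_filter F" using filter_zero[OF F] by (simp add: ideal_filter_def)
next
  fix I J assume "I \<in> ideal_filter F" "J \<in> ideal_filter F"
  then obtain a b where *: "I \<in> carrier (\<D> S)" "J \<in> carrier (\<D> S)" "a \<in> I" "b \<in> J" "a \<in> F" "b \<in> F"
    unfolding ideal_filter_def by blast
  obtain c where c: "c \<in> F" "c \<preceq> a" "c \<preceq> b" using filter_directed[OF F *(5,6)] .
  then have "c \<in> I" "c \<in> J" using * ideal_down by blast+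
  then have "downset S {c} \<subseteq> I" "downset S {c} \<subseteq> J" using * principal_ideal_subset by blast+
  moreover have "downset S {c} \<in> ideal_filter F"
    using principal_ideal_mem_iff[OF F] c filter_closed[OF F] by blast
  ultimately show "\<exists>K\<in>ideal_filter F. K \<subseteq> I \<and> K \<subseteq> J" by blast
qed (auto simp: ideal_filter_def)

lemma inj_ideal_filter: "inj_on ideal_filter {F. is_filter S F}"
proof (rule inj_onI)
  fix A B assume "A \<in> {F. is_filter S F}" "B \<in> {F. is_filter S F}" and eq: "ideal_filter A = ideal_filter B"
  then have A: "is_filter S A" and B: "is_filter S B" by auto
  show "A = B"
    using principal_ideal_mem_iff[OF A] principal_ideal_mem_iff[OF B] filter_closed[OF A] filter_closed[OF B] eq
    by blast
qed

lemma downset_zero: "downset S {\<zero>} = {\<zero>}"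
  using sle_zero by (auto simp: downset_iff)

text \<open>Including the zero admits an empty \<open>A\<close>, the base case of the induction over
  generators and the case of a basic open set that removes nothing.\<close>

lemma insert_zero_ideal:
  assumes "finite A" "compatible_set S A"
  shows "downset S (insert \<zero> A) \<in> carrier (\<D> S)"
  unfolding ideal_iff
proof (intro exI conjI)
  have "compatible S \<zero> a \<and> compatible S a \<zero>" if "a \<in> A" for a
    using that assms(2) by (simp add: compatible_def compatible_set_def subset_iff)
  then show "compatible_set S (insert \<zero> A)" using assms(2) by (auto simp: compatible_set_def)
qed (use assms in auto)

text \<open>An ideal is the finite union of the principal ideals of its generators, and primeness
  selects one of them.\<close>

lemma prime_filter_principal:
  assumes P: "is_prime_filter (\<D> S) P" and I: "I \<in> P"
  obtains a where "a \<in> I" "downset S {a} \<in> P"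
proof -
  have zero: "{\<zero>} \<notin> P" and sub: "P \<subseteq> carrier (\<D> S)"
    and up: "\<And>I J. I \<in> P \<Longrightarrow> J \<in> carrier (\<D> S) \<Longrightarrow> I \<subseteq> J \<Longrightarrow> J \<in> P"
    and prime: "\<And>I J. I \<in> carrier (\<D> S) \<Longrightarrow> J \<in> carrier (\<D> S) \<Longrightarrow> I \<union> J \<in> P \<Longrightarrow> I \<in> P \<or> J \<in> P"
    using P unfolding is_prime_filter_ideals_iff by simp_all
  \<comment> \<open>With the zero inserted, the base case is the zero ideal, which a proper filter
    does not contain.\<close>
  have *: "\<exists>a\<in>A. downset S {a} \<in> P" if "finite A" "compatible_set S A" "downset S (insert \<zero> A) \<in> P" for A
    using that
  proof induction
    case empty
    then show ?case using zero downset_zero by simp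
  next
    case (insert a A)
    then have A: "compatible_set S A" "a \<in> carrier S" by (auto simp: compatible_set_def)
    have "downset S (insert \<zero> (insert a A)) = downset S {a} \<union> downset S (insert \<zero> A)"
      unfolding downset_def by blast
    then have "downset S {a} \<in> P \<or> downset S (insert \<zero> A) \<in> P"
      using prime[OF principal_ideal[OF A(2)] insert_zero_ideal[OF insert(1) A(1)]] insert.prems by simp
    then show ?case using insert.IH A by blast
  qed
  obtain A where A: "finite A" "compatible_set S A" "I = downset S A"
    using I sub ideal_iff by blast
  have "downset S (insert \<zero> A) \<in> P"
    by (rule up[OF I insert_zero_ideal[OF A(1,2)]]) (auto simp: A(3) downset_def)
  then obtain a where a: "a \<in> A" "downset S {a} \<in> P" using *[OF A(1,2)] by blast
  then have "a \<in> I" using A(2) subset_downset[of A] by (auto simp: A(3) compatible_set_def)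
  then show thesis using that a by blast
qed

lemma prime_filter_is_ideal_filter:
  assumes P: "is_prime_filter (\<D> S) P"
  obtains F where "is_filter S F" "P = ideal_filter F"
proof -
  have zero: "{\<zero>} \<notin> P" and sub: "P \<subseteq> carrier (\<D> S)" and ne: "P \<noteq> {}"
    and up: "\<And>I J. I \<in> P \<Longrightarrow> J \<in> carrier (\<D> S) \<Longrightarrow> I \<subseteq> J \<Longrightarrow> J \<in> P"
    and dir: "\<And>I J. I \<in> P \<Longrightarrow> J \<in> P \<Longrightarrow> \<exists>K\<in>P. K \<subseteq> I \<and> K \<subseteq> J"
    using P unfolding is_prime_filter_ideals_iff by simp_all
  define F where "F = {a \<in> carrier S. downset S {a} \<in> P}"
  obtain I where "I \<in> P" using ne by blast
  then obtain x where x: "x \<in> I" "downset S {x} \<in> P" by (rule prime_filter_principal[OF P])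
  have "is_filter S F"
  proof (rule is_filterI)
    show "x \<in> F" unfolding F_def using x ideal_closed sub \<open>I \<in> P\<close> by blast
    show "F \<subseteq> carrier S" unfolding F_def by blast
    show "\<zero> \<notin> F" unfolding F_def using zero downset_zero by simp
  next
    fix a b assume "a \<in> F" "a \<preceq> b" "b \<in> carrier S"
    moreover from this have "downset S {a} \<subseteq> downset S {b}"
      using sle_trans by (auto simp: downset_iff)
    ultimately show "b \<in> F" unfolding F_def using up principal_ideal by blast
  next
    fix a b assume ab: "a \<in> F" "b \<in> F"
    then obtain K where K: "K \<in> P" "K \<subseteq> downset S {a}" "K \<subseteq> downset S {b}" unfolding F_def using dir by blast
    \<comment> \<open>The common lower bound \<open>K\<close> need not be principal; primeness finds
      a principal ideal inside it that still belongs to \<open>P\<close>.\<close>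
    obtain c where c: "c \<in> K" "downset S {c} \<in> P" using prime_filter_principal[OF P K(1)] .
    have "c \<in> carrier S" "c \<preceq> a" "c \<preceq> b" using c K by (auto elim!: downsetE dest!: subsetD)
    then show "\<exists>c\<in>F. c \<preceq> a \<and> c \<preceq> b" unfolding F_def using c by blast
  qed
  moreover have "P = ideal_filter F"
  proof (intro equalityI subsetI)
    fix I assume I: "I \<in> P"
    then obtain a where a: "a \<in> I" "downset S {a} \<in> P" by (rule prime_filter_principal[OF P])
    then have "a \<in> F" unfolding F_def using I sub ideal_closed by blast
    then show "I \<in> ideal_filter F" unfolding ideal_filter_def using I a sub by blast
  next
    fix I assume "I \<in> ideal_filter F"
    then obtain a where "I \<in> carrier (\<D> S)" "a \<in> I" "downset S {a} \<in> P" unfolding ideal_filter_def F_def by blast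
    then show "I \<in> P" using up principal_ideal_subset by blast
  qed
  ultimately show thesis using that by blast
qed

lemma ideal_filter_image: "ideal_filter ` {F. is_filter S F} = {P. is_prime_filter (\<D> S) P}"
proof (intro equalityI subsetI)
  fix P assume "P \<in> {P. is_prime_filter (\<D> S) P}"
  then obtain F where "is_filter S F" "P = ideal_filter F" using prime_filter_is_ideal_filter by blast
  then show "P \<in> ideal_filter ` {F. is_filter S F}" by blast
qed (use prime_ideal_filter in auto)

text \<open>Principal ideals multiply like their generators, so a product of elements below a member
  of an ideal gives a product of principal ideals inside it; the converse picks elements from the
  two ideals.\<close>

lemma ideal_filter_fmult:
  assumes A: "A \<subseteq> carrier S" and B: "B \<subseteq> carrier S"
  shows "ideal_filter (A \<diamondop> B) = upset (\<D> S) (setprod (\<D> S) (ideal_filter A) (ideal_filter B))"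
proof -
  interpret D: set_inverse_semigroup "\<D> S" "{\<zero>}" by (rule set_inverse_semigroup_ideals)
  have K: "setprod (\<D> S) (ideal_filter A) (ideal_filter B) \<subseteq> carrier (\<D> S)"
    using ideal_mult_closed by (auto simp: setprod_def[of "\<D> S"] fg_compatible_ideals_simps(1) ideal_filter_def)
  show ?thesis
  proof (intro Set.set_eqI iffI)
    fix I assume "I \<in> ideal_filter (A \<diamondop> B)"
    then obtain y where I: "I \<in> carrier (\<D> S)" "y \<in> I" "y \<in> A \<diamondop> B" unfolding ideal_filter_def by blast
    then obtain a b where ab: "a \<in> A" "b \<in> B" "a \<otimes> b \<preceq> y" by (elim fmultE)
    have S: "a \<in> carrier S" "b \<in> carrier S" using ab A B by auto
    have "setprod S {a} {b} = {a \<otimes> b}" by (auto simp: setprod_def)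
    then have "setprod S (downset S {a}) (downset S {b}) = downset S {a \<otimes> b}"
      using setprod_downset[of "{a}" "{b}"] S by simp
    then have "setprod S (downset S {a}) (downset S {b}) \<subseteq> I"
      using principal_ideal_subset[OF I(1) ideal_down[OF I(1,2) ab(3)]] by simp
    moreover have "downset S {a} \<in> ideal_filter A" "downset S {b} \<in> ideal_filter B"
      using ab S mem_principal_ideal principal_ideal unfolding ideal_filter_def by blast+
    then have "setprod S (downset S {a}) (downset S {b}) \<in> setprod (\<D> S) (ideal_filter A) (ideal_filter B)"
      unfolding setprod_def[of "\<D> S"] fg_compatible_ideals_simps(1) by blast
    ultimately show "I \<in> upset (\<D> S) (setprod (\<D> S) (ideal_filter A) (ideal_filter B))"
      unfolding D.mem_upset_iff[OF K] using I by blast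
  next
    fix I assume "I \<in> upset (\<D> S) (setprod (\<D> S) (ideal_filter A) (ideal_filter B))"
    then obtain J K where I: "I \<in> carrier (\<D> S)" and JK: "J \<in> ideal_filter A" "K \<in> ideal_filter B" "setprod S J K \<subseteq> I"
      unfolding D.mem_upset_iff[OF K] unfolding setprod_def[of "\<D> S"] fg_compatible_ideals_simps(1) by blast
    then obtain a b where ab: "a \<in> J" "a \<in> A" "b \<in> K" "b \<in> B" unfolding ideal_filter_def by blast
    then have "a \<otimes> b \<in> I" using JK(3) setprodI by blast
    moreover have "a \<otimes> b \<in> carrier S" using ab A B by (auto intro: m_closed)
    then have "a \<otimes> b \<in> A \<diamondop> B" using ab by (intro upsetI[OF setprodI sle_refl])
    ultimately show "I \<in> ideal_filter (A \<diamondop> B)" using I unfolding ideal_filter_def by blast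
  qed
qed

lemma ideal_filter_sinv:
  assumes A: "A \<subseteq> carrier S"
  shows "sinv (\<D> S) ` ideal_filter A = ideal_filter (\<iota> ` A)"
proof (intro equalityI subsetI)
  fix J assume "J \<in> sinv (\<D> S) ` ideal_filter A"
  then obtain I where I: "I \<in> carrier (\<D> S)" "I \<inter> A \<noteq> {}" "J = \<iota> ` I"
    using sinv_ideal unfolding ideal_filter_def by auto
  then show "J \<in> ideal_filter (\<iota> ` A)" using ideal_sinv_closed unfolding ideal_filter_def by blast
next
  fix J assume "J \<in> ideal_filter (\<iota> ` A)"
  then obtain a where J: "J \<in> carrier (\<D> S)" "\<iota> a \<in> J" "a \<in> A" unfolding ideal_filter_def by blast
  have "\<iota> (\<iota> a) = a" using J A by auto
  then have "a \<in> \<iota> ` J" using imageI[OF J(2), of \<iota>] by simp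
  then have "\<iota> ` J \<in> ideal_filter A" using ideal_sinv_closed J unfolding ideal_filter_def by blast
  moreover have "sinv (\<D> S) (\<iota> ` J) = J"
    using sinv_ideal[OF ideal_sinv_closed[OF J(1)]] ideal_subset[OF J(1)] by simp
  ultimately show "J \<in> sinv (\<D> S) ` ideal_filter A" by (metis imageI)
qed

section \<open>The homeomorphism onto the weak booleanization\<close>

lemma weak_booleanization_simps:
  "carrier (weak_booleanization (\<D> S)) = {P. is_prime_filter (\<D> S) P}"
  "gdom (weak_booleanization (\<D> S)) P = upset (\<D> S) (setprod (\<D> S) (sinv (\<D> S) ` P) P)"
  "gran (weak_booleanization (\<D> S)) P = upset (\<D> S) (setprod (\<D> S) P (sinv (\<D> S) ` P))"
  "gcomp (weak_booleanization (\<D> S)) P Q = upset (\<D> S) (setprod (\<D> S) P Q)"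
  "gtop (weak_booleanization (\<D> S)) = topology_generated_by {Y_set (\<D> S) I - Y_set (\<D> S) J | I J.
     I \<in> carrier (\<D> S) \<and> J \<in> downset (\<D> S) {I}}"
  by (simp_all add: weak_booleanization_def filter_groupoid_def)

lemma mem_Y_set_ideal_filter:
  "is_filter S F \<Longrightarrow> I \<in> carrier (\<D> S) \<Longrightarrow> ideal_filter F \<in> Y_set (\<D> S) I \<longleftrightarrow> I \<inter> F \<noteq> {}"
  using prime_ideal_filter by (auto simp: Y_set_def ideal_filter_def)

text \<open>The set \<open>X\<close> is bounded by \<open>x\<close>, hence compatible, so together
  with the zero it generates one ideal, and a filter meets that ideal exactly when it meets
  \<open>X\<close>. Removing finitely many elements of \<open>S\<close> thus becomes removing a
  single ideal.\<close>

lemma ideal_filter_image_basic_open: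
  assumes x: "x \<in> carrier S" "finite X" "X \<subseteq> downset S {x}"
  shows "ideal_filter ` basic_open x X = Y_set (\<D> S) (downset S {x}) - Y_set (\<D> S) (downset S (insert \<zero> X))"
    "downset S (insert \<zero> X) \<in> downset (\<D> S) {downset S {x}}"
proof -
  have XS: "y \<in> carrier S" "y \<preceq> x" if "y \<in> X" for y using downset_singletonD[OF x(3) that] by auto
  have "compatible_set S X"
    unfolding compatible_set_def using XS compatible_bounded[OF _ _ x(1)] by blast
  then have J: "downset S (insert \<zero> X) \<in> carrier (\<D> S)" by (rule insert_zero_ideal[OF x(2)])
  have I: "downset S {x} \<in> carrier (\<D> S)" by (rule principal_ideal[OF x(1)])
  have "downset S (insert \<zero> X) \<subseteq> downset S {x}"
    using XS x(1) sle_trans zero_sle by (auto simp: downset_iff)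
  then show "downset S (insert \<zero> X) \<in> downset (\<D> S) {downset S {x}}"
    using sle_ideal_iff[OF J I] J unfolding downset_def[of "\<D> S"] by blast
  have iff: "ideal_filter F \<in> Y_set (\<D> S) (downset S {x}) - Y_set (\<D> S) (downset S (insert \<zero> X)) \<longleftrightarrow> F \<in> basic_open x X"
    if F: "is_filter S F" for F
  proof -
    have "y \<notin> F" if "y \<in> downset S (insert \<zero> X)" "X \<inter> F = {}" for y
      using that filter_up[OF F] XS filter_zero[OF F] sle_zero by (auto elim!: downsetE)
    moreover have "X \<subseteq> downset S (insert \<zero> X)" using XS by (auto intro: downsetI)
    ultimately have "downset S (insert \<zero> X) \<inter> F = {} \<longleftrightarrow> X \<inter> F = {}" by blast
    moreover have "downset S {x} \<inter> F \<noteq> {} \<longleftrightarrow> x \<in> F"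
      using principal_ideal_mem_iff[OF F x(1)] I by (auto simp: ideal_filter_def)
    ultimately show ?thesis
      using mem_Y_set_ideal_filter[OF F I] mem_Y_set_ideal_filter[OF F J] F unfolding mem_basic_open by blast
  qed
  show "ideal_filter ` basic_open x X = Y_set (\<D> S) (downset S {x}) - Y_set (\<D> S) (downset S (insert \<zero> X))"
  proof (intro equalityI subsetI)
    fix P assume "P \<in> ideal_filter ` basic_open x X"
    then obtain F where "P = ideal_filter F" "F \<in> basic_open x X" by blast
    then show "P \<in> Y_set (\<D> S) (downset S {x}) - Y_set (\<D> S) (downset S (insert \<zero> X))"
      using iff[of F] mem_basic_open by blast
  next
    fix P assume P: "P \<in> Y_set (\<D> S) (downset S {x}) - Y_set (\<D> S) (downset S (insert \<zero> X))"
    then have "is_prime_filter (\<D> S) P" unfolding Y_set_def by blast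
    then obtain F where "is_filter S F" "P = ideal_filter F" by (rule prime_filter_is_ideal_filter)
    then show "P \<in> ideal_filter ` basic_open x X" using iff[of F] P by blast
  qed
qed

lemma homeomorphic_ideal_filter:
  "homeomorphic_map patch (gtop (weak_booleanization (\<D> S))) ideal_filter"
proof -
  let ?\<S> = "{Y_set (\<D> S) I - Y_set (\<D> S) J | I J. I \<in> carrier (\<D> S) \<and> J \<in> downset (\<D> S) {I}}"
  have T: "gtop (weak_booleanization (\<D> S)) = topology_generated_by ?\<S>"
    by (rule weak_booleanization_simps)
  have U: "\<Union>?\<S> = {P. is_prime_filter (\<D> S) P}"
  proof (intro equalityI subsetI)
    fix P assume "P \<in> {P. is_prime_filter (\<D> S) P}"
    then obtain F where F: "is_filter S F" "P = ideal_filter F" using prime_filter_is_ideal_filter by blast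
    obtain a where a: "a \<in> F" "a \<in> carrier S" using filter_nonempty[OF F(1)] .
    then have "F \<in> basic_open a {}" using F by (simp add: U_set_def)
    then have "P \<in> Y_set (\<D> S) (downset S {a}) - Y_set (\<D> S) (downset S (insert \<zero> {}))"
      using ideal_filter_image_basic_open(1)[OF a(2), of "{}"] F by blast
    then show "P \<in> \<Union>?\<S>"
      using ideal_filter_image_basic_open(2)[OF a(2), of "{}"] principal_ideal[OF a(2)] by blast
  qed (auto simp: Y_set_def)
  show ?thesis
  proof (rule bijective_open_imp_homeomorphic_map)
    show "continuous_map patch (gtop (weak_booleanization (\<D> S))) ideal_filter"
      unfolding T continuous_on_generated_topo_iff U topspace_patch
    proof (intro conjI allI impI)
      fix V assume "V \<in> ?\<S>"
      then obtain I J where IJ: "I \<in> carrier (\<D> S)" "J \<in> downset (\<D> S) {I}" and V: "V = Y_set (\<D> S) I - Y_set (\<D> S) J"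
        by blast
      then have J: "J \<in> carrier (\<D> S)" "J \<subseteq> I" using sle_ideal_iff by (auto simp: downset_def)
      obtain B where B: "finite B" "compatible_set S B" "J = downset S B" using J ideal_iff by blast
      then have BJ: "B \<subseteq> J" using subset_downset by (auto simp: compatible_set_def)
      have pre: "ideal_filter F \<in> V \<longleftrightarrow> I \<inter> F \<noteq> {} \<and> J \<inter> F = {}" if "is_filter S F" for F
        unfolding V using mem_Y_set_ideal_filter[OF that] IJ J by blast
      show "openin patch (ideal_filter -` V \<inter> {F. is_filter S F})"
      proof (rule patch_openinI)
        fix F assume "F \<in> ideal_filter -` V \<inter> {F. is_filter S F}"
        then have F: "is_filter S F" "I \<inter> F \<noteq> {}" "J \<inter> F = {}" using pre by auto
        then obtain a where a: "a \<in> I" "a \<in> F" by blast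
        \<comment> \<open>The generators of \<open>J\<close> need not lie below \<open>a\<close>.
          But they and \<open>a\<close> all belong to the ideal \<open>I\<close> and so are
          compatible; meets with \<open>a\<close> give admissible exclusions with the same effect on
          filters containing \<open>a\<close>.\<close>
        define X where "X = (\<lambda>b. a \<otimes> (\<iota> b \<otimes> b)) ` B"
        have BS: "b \<in> carrier S" if "b \<in> B" for b
          using BJ J(1) that ideal_closed by blast
        have aS: "a \<in> carrier S" using a IJ ideal_closed by blast
        have comp: "compatible S a b" if "b \<in> B" for b
          using ideal_compatible[OF IJ(1) a(1)] BJ J that by blast
        have iff: "F' \<in> basic_open a X \<longleftrightarrow> J \<inter> F' = {}" if F': "is_filter S F'" "a \<in> F'" for F'
        proof -
          have "b \<in> F' \<longleftrightarrow> a \<otimes> (\<iota> b \<otimes> b) \<in> F'" if b: "b \<in> B" for b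
            using filter_meet[OF F'(1,2), of b] filter_up[OF F'(1) _ compatible_meet_sle2[OF comp[OF b] aS BS[OF b]]] BS[OF b]
            by blast
          then have "F' \<in> basic_open a X \<longleftrightarrow> B \<inter> F' = {}" unfolding mem_basic_open X_def using F' by blast
          also have "\<dots> \<longleftrightarrow> J \<inter> F' = {}"
            using BJ filter_up[OF F'(1)] BS unfolding B(3) by (auto elim!: downsetE)
          finally show ?thesis .
        qed
        have "finite X" "X \<subseteq> downset S {a}"
          unfolding X_def using B(1) aS BS by (auto intro!: downset_singletonI)
        moreover have "F \<in> basic_open a X" using iff F a by blast
        moreover have "basic_open a X \<subseteq> ideal_filter -` V \<inter> {F. is_filter S F}"
        proof
          fix F' assume F'X: "F' \<in> basic_open a X"
          then have F': "is_filter S F'" "a \<in> F'" unfolding mem_basic_open by auto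
          then have "J \<inter> F' = {}" using iff F'X by blast
          then show "F' \<in> ideal_filter -` V \<inter> {F. is_filter S F}" using pre F' a by blast
        qed
        ultimately show "\<exists>x X. x \<in> carrier S \<and> finite X \<and> X \<subseteq> downset S {x} \<and>
            F \<in> basic_open x X \<and> basic_open x X \<subseteq> ideal_filter -` V \<inter> {F. is_filter S F}" using aS by blast
      qed
    qed (use ideal_filter_image in blast)
    show "open_map patch (gtop (weak_booleanization (\<D> S))) ideal_filter"
      unfolding open_map_def
    proof (intro allI impI)
      fix V assume V: "openin patch V"
      show "openin (gtop (weak_booleanization (\<D> S))) (ideal_filter ` V)"
        unfolding openin_subopen[of _ "ideal_filter ` V"]
      proof
        fix P assume "P \<in> ideal_filter ` V"
        then obtain F where F: "P = ideal_filter F" "F \<in> V" by blast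
        then have "is_filter S F" using openin_subset[OF V] topspace_patch by blast
        then obtain a where a: "a \<in> F" "a \<in> carrier S" by (rule filter_nonempty)
        obtain x X where x: "x \<in> F" "x \<in> carrier S" "x \<preceq> a" "finite X" "X \<subseteq> downset S {x}"
          "F \<in> basic_open x X" "basic_open x X \<subseteq> V" using patch_nbhd[OF V F(2) a(1)] .
        have "openin (gtop (weak_booleanization (\<D> S))) (ideal_filter ` basic_open x X)"
          unfolding T
        proof (rule topology_generated_by_Basis)
          show "ideal_filter ` basic_open x X \<in> ?\<S>"
            using ideal_filter_image_basic_open[OF x(2,4,5)] principal_ideal[OF x(2)] by blast
        qed
        then show "\<exists>T. openin (gtop (weak_booleanization (\<D> S))) T \<and> P \<in> T \<and> T \<subseteq> ideal_filter ` V"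
          using x(6,7) F(1) by blast
      qed
    qed
    show "ideal_filter ` topspace patch = topspace (gtop (weak_booleanization (\<D> S)))"
      unfolding T topology_generated_by_topspace U topspace_patch by (rule ideal_filter_image)
    show "inj_on ideal_filter (topspace patch)"
      unfolding topspace_patch by (rule inj_ideal_filter)
  qed
qed

lemma universal_homeomorphic_weak_booleanization:
  "groupoid_homeomorphic (G\<^sub>u S) (weak_booleanization (\<D> S))"
proof (rule groupoid_homeomorphicI[OF topological_groupoid_universal homeomorphic_ideal_filter])
  show "carrier (weak_booleanization (\<D> S)) = ideal_filter ` carrier (G\<^sub>u S)"
    by (simp add: weak_booleanization_simps ideal_filter_image)
next
  fix A assume "A \<in> carrier (G\<^sub>u S)"
  then have A: "A \<subseteq> carrier S" "\<iota> ` A \<subseteq> carrier S" using filter_subset filter_sinv by auto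
  show "ideal_filter (gdom (G\<^sub>u S) A) = gdom (weak_booleanization (\<D> S)) (ideal_filter A)"
    "ideal_filter (gran (G\<^sub>u S) A) = gran (weak_booleanization (\<D> S)) (ideal_filter A)"
    unfolding weak_booleanization_simps gdom_universal gran_universal ideal_filter_sinv[OF A(1)]
    using A by (simp_all only: ideal_filter_fmult)
next
  fix A B assume "A \<in> carrier (G\<^sub>u S)" "B \<in> carrier (G\<^sub>u S)"
  then have "A \<subseteq> carrier S" "B \<subseteq> carrier S" using filter_subset by auto
  then show "ideal_filter (gcomp (G\<^sub>u S) A B) = gcomp (weak_booleanization (\<D> S)) (ideal_filter A) (ideal_filter B)"
    unfolding weak_booleanization_simps gcomp_universal by (rule ideal_filter_fmult)
qed

end

theorem theorem5p6:
  fixes S :: "'a sgrp"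
  assumes "inverse_semigroup_with_zero S"
  shows "(distributive_inverse_semigroup (\<D> S) \<and>
          groupoid_homeomorphic (G\<^sub>u S) (weak_booleanization (\<D> S)) \<and>
          etale_groupoid (G\<^sub>u S) \<and>
          weakly_boolean_inverse_semigroup (KB (G\<^sub>u S)) \<and>
          groupoid_homeomorphic (G\<^sub>u S) (G\<^sub>P (KB (G\<^sub>u S))))
         \<and> (weak_meet_condition S \<longrightarrow> is_booleanization (\<D> S) (weak_booleanization (\<D> S)))"
proof -
  interpret inverse_semigroup_with_zero S by (rule assms)
  interpret Gu: boolean_groupoid "G\<^sub>u S" by (rule boolean_groupoid_universal)
  have D: "distributive_inverse_semigroup (\<D> S)"
    by (rule set_inverse_semigroup.distributive_inverse_semigroup[OF set_inverse_semigroup_ideals])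
  show ?thesis
    unfolding is_booleanization_def
    using D universal_homeomorphic_weak_booleanization etale_groupoid_universal Gu.weakly_boolean_KB
      Gu.groupoid_homeomorphic_prime_filters inverse_meet_semigroup_ideals
    by blast
qed

end
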